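(* Let $(\Omega,\mathcal{F},\mu)$ be a $\sigma$-finite measure space, let $1<p<\infty$, let $p'$ be the conjugate exponent of $p$, and let $(T_t)_{t\ge 0}$ be a Kreiss bounded and uniformly eventually positive $C_0$-semigroup on $L^p(\Omega)=L^p(\Omega,\mu)$. Then, as $t\to+\infty$, $$\|T_t\| = \mathcal{O}\left(\frac{t}{\log(t)^{\max\{1/p,\,1/p'\}}}\right).$$
   Context: $L^p(\Omega)$ is the complex Lebesgue space with its usual order (its positive cone consists of the almost everywhere nonnegative functions). The conjugate exponent satisfies $1/p+1/p'=1$. Let $-A$ denote the generator of a $C_0$-semigroup $(T_t)_{t\ge0}$ on a complex Banach space $X$. Write $\mathbb{C}_+=\{\lambda\in\mathbb{C}:\operatorname{Re}\lambda>0\}$, $\mathbb{C}_-=\{\lambda\in\mathbb{C}:\operatorname{Re}\lambda<0\}$, $\rho(A)$ for the resolvent set of $A$ and $R(\mu,A)=(\mu-A)^{-1}$ for $\mu\in\rho(A)$. The semigroup is Kreiss bounded if $\mathbb{C}_-\subseteq\rho(A)$ and there is a constant $C$ such that $\|R(-\lambda,A)\|\le C/\operatorname{Re}(\lambda)$ for every $\lambda\in\mathbb{C}_+$. A bounded operator $S$ on a Banach lattice is positive if $Sx\ge0$ whenever $x\ge0$. The semigroup is uniformly eventually positive if there exists $t_0\ge0$ such that $T_t$ is a positive operator for every $t\ge t_0$. *)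

theory Defs
  imports "HOL-Analysis.Analysis" "HOL-Library.Landau_Symbols" "HOL-Library.Nonpos_Ints"
begin

section \<open>Complex normed spaces with an explicit carrier\<close>

text \<open>
  The space \<open>L\<^sup>p(\<Omega>, \<mu>)\<close> depends on a measure and on an exponent, so it cannot be a type; normed
  spaces are therefore given by a record, and every notion is relative to the carrier.  The
  space axioms are not bundled: the record is only ever used for concrete spaces.
\<close>

record 'x cnspace =
  carrier :: "'x set"
  vadd :: "'x \<Rightarrow> 'x \<Rightarrow> 'x"
  vscale :: "complex \<Rightarrow> 'x \<Rightarrow> 'x"
  vnorm :: "'x \<Rightarrow> real"

definition vdiff :: "'x cnspace \<Rightarrow> 'x \<Rightarrow> 'x \<Rightarrow> 'x" where
  "vdiff X x y = vadd X x (vscale X (-1) y)"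

definition bounded_operator :: "'x cnspace \<Rightarrow> ('x \<Rightarrow> 'x) \<Rightarrow> bool" where
  "bounded_operator X S \<longleftrightarrow>
     (\<forall>x\<in>carrier X. S x \<in> carrier X) \<and>
     (\<forall>x\<in>carrier X. \<forall>y\<in>carrier X. S (vadd X x y) = vadd X (S x) (S y)) \<and>
     (\<forall>c. \<forall>x\<in>carrier X. S (vscale X c x) = vscale X c (S x)) \<and>
     (\<exists>C. \<forall>x\<in>carrier X. vnorm X (S x) \<le> C * vnorm X x)"

definition op_norm :: "'x cnspace \<Rightarrow> ('x \<Rightarrow> 'x) \<Rightarrow> real" where
  "op_norm X S = (SUP x\<in>{x \<in> carrier X. vnorm X x \<le> 1}. vnorm X (S x))"


section \<open>Resolvents of unbounded operators\<close>

text \<open>An unbounded operator is given by its domain \<open>D\<close> and by a map \<open>A\<close> that matters only on \<open>D\<close>.\<close>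

definition shifted :: "'x cnspace \<Rightarrow> ('x \<Rightarrow> 'x) \<Rightarrow> complex \<Rightarrow> 'x \<Rightarrow> 'x" where
  "shifted X A \<mu> x = vdiff X (vscale X \<mu> x) (A x)"

definition resolvent :: "'x cnspace \<Rightarrow> 'x set \<Rightarrow> ('x \<Rightarrow> 'x) \<Rightarrow> complex \<Rightarrow> 'x \<Rightarrow> 'x" where
  "resolvent X D A \<mu> = inv_into D (shifted X A \<mu>)"

definition resolvent_set :: "'x cnspace \<Rightarrow> 'x set \<Rightarrow> ('x \<Rightarrow> 'x) \<Rightarrow> complex set" where
  "resolvent_set X D A =
     {\<mu>. bij_betw (shifted X A \<mu>) D (carrier X) \<and> bounded_operator X (resolvent X D A \<mu>)}"


section \<open>Strongly continuous semigroups\<close>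

text \<open>A family \<open>T\<close> is indexed by all reals, but only the indices \<open>t \<ge> 0\<close> are relevant.\<close>

definition C0_semigroup :: "'x cnspace \<Rightarrow> (real \<Rightarrow> 'x \<Rightarrow> 'x) \<Rightarrow> bool" where
  "C0_semigroup X T \<longleftrightarrow>
     (\<forall>t\<ge>0. bounded_operator X (T t)) \<and>
     (\<forall>x\<in>carrier X. T 0 x = x) \<and>
     (\<forall>s\<ge>0. \<forall>t\<ge>0. \<forall>x\<in>carrier X. T (s + t) x = T s (T t x)) \<and>
     (\<forall>x\<in>carrier X. ((\<lambda>t. vnorm X (vdiff X (T t x) x)) \<longlongrightarrow> 0) (at_right 0))"

definition is_generator_value ::
    "'x cnspace \<Rightarrow> (real \<Rightarrow> 'x \<Rightarrow> 'x) \<Rightarrow> 'x \<Rightarrow> 'x \<Rightarrow> bool" where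
  "is_generator_value X T x y \<longleftrightarrow> y \<in> carrier X \<and>
     ((\<lambda>t. vnorm X (vdiff X (vscale X (of_real (1 / t)) (vdiff X (T t x) x)) y)) \<longlongrightarrow> 0) (at_right 0)"

definition generator_domain :: "'x cnspace \<Rightarrow> (real \<Rightarrow> 'x \<Rightarrow> 'x) \<Rightarrow> 'x set" where
  "generator_domain X T = {x \<in> carrier X. \<exists>y. is_generator_value X T x y}"

definition generator :: "'x cnspace \<Rightarrow> (real \<Rightarrow> 'x \<Rightarrow> 'x) \<Rightarrow> 'x \<Rightarrow> 'x" where
  "generator X T x = (THE y. is_generator_value X T x y)"

text \<open>Sign convention: the generator of the semigroup is \<open>-A\<close>.\<close>

definition neg_generator :: "'x cnspace \<Rightarrow> (real \<Rightarrow> 'x \<Rightarrow> 'x) \<Rightarrow> 'x \<Rightarrow> 'x" where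
  "neg_generator X T x = vscale X (-1) (generator X T x)"

definition Kreiss_bounded :: "'x cnspace \<Rightarrow> (real \<Rightarrow> 'x \<Rightarrow> 'x) \<Rightarrow> bool" where
  "Kreiss_bounded X T \<longleftrightarrow>
     {\<mu>. Re \<mu> < 0} \<subseteq> resolvent_set X (generator_domain X T) (neg_generator X T) \<and>
     (\<exists>C. \<forall>\<mu>. Re \<mu> > 0 \<longrightarrow>
        op_norm X (resolvent X (generator_domain X T) (neg_generator X T) (-\<mu>)) \<le> C / Re \<mu>)"

text \<open>In the next two definitions \<open>K\<close> is the positive cone of the space.\<close>

definition positive_operator :: "'x set \<Rightarrow> ('x \<Rightarrow> 'x) \<Rightarrow> bool" where
  "positive_operator K S \<longleftrightarrow> (\<forall>x\<in>K. S x \<in> K)"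

definition uniformly_eventually_positive :: "'x set \<Rightarrow> (real \<Rightarrow> 'x \<Rightarrow> 'x) \<Rightarrow> bool" where
  "uniformly_eventually_positive K T \<longleftrightarrow> (\<exists>t0\<ge>0. \<forall>t\<ge>t0. positive_operator K (T t))"


section \<open>Complex Lebesgue spaces\<close>

definition lp_fun :: "'a measure \<Rightarrow> real \<Rightarrow> ('a \<Rightarrow> complex) set" where
  "lp_fun M p = {f \<in> borel_measurable M. integrable M (\<lambda>x. norm (f x) powr p)}"

definition lp_rel :: "'a measure \<Rightarrow> real \<Rightarrow> (('a \<Rightarrow> complex) \<times> ('a \<Rightarrow> complex)) set" where
  "lp_rel M p = {(f, g). f \<in> lp_fun M p \<and> g \<in> lp_fun M p \<and> (AE x in M. f x = g x)}"

definition lp_class :: "'a measure \<Rightarrow> real \<Rightarrow> ('a \<Rightarrow> complex) \<Rightarrow> ('a \<Rightarrow> complex) set" where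
  "lp_class M p f = lp_rel M p `` {f}"

text \<open>
  The operations are defined through all representatives of the classes involved; the lemmas
  below show that the outcome does not depend on them.
\<close>

definition Lp :: "'a measure \<Rightarrow> real \<Rightarrow> ('a \<Rightarrow> complex) set cnspace" where
  "Lp M p = \<lparr>
     carrier = lp_fun M p // lp_rel M p,
     vadd = (\<lambda>F G. \<Union>f\<in>F. \<Union>g\<in>G. lp_class M p (\<lambda>x. f x + g x)),
     vscale = (\<lambda>c F. \<Union>f\<in>F. lp_class M p (\<lambda>x. c * f x)),
     vnorm = (\<lambda>F. the_elem ((\<lambda>f. (LINT x|M. norm (f x) powr p) powr (1 / p)) ` F))\<rparr>"

definition Lp_cone :: "'a measure \<Rightarrow> real \<Rightarrow> ('a \<Rightarrow> complex) set set" where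
  "Lp_cone M p = {F \<in> carrier (Lp M p). \<forall>f\<in>F. AE x in M. f x \<in> \<real>\<^sub>\<ge>\<^sub>0}"

lemma equiv_lp_rel: "equiv (lp_fun M p) (lp_rel M p)"
proof (rule equivI)
  show "lp_rel M p \<subseteq> lp_fun M p \<times> lp_fun M p" "refl_on (lp_fun M p) (lp_rel M p)"
    by (auto simp: lp_rel_def refl_on_def)
  show "sym (lp_rel M p)"
    by (rule symI) (simp add: lp_rel_def eq_commute)
  show "trans (lp_rel M p)"
  proof (rule transI)
    fix f g h
    assume "(f, g) \<in> lp_rel M p" "(g, h) \<in> lp_rel M p"
    then have *: "f \<in> lp_fun M p" "h \<in> lp_fun M p"
      and fg: "AE x in M. f x = g x" and gh: "AE x in M. g x = h x"
      by (simp_all add: lp_rel_def)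
    have "AE x in M. f x = h x" using fg gh by eventually_elim simp
    with * show "(f, h) \<in> lp_rel M p" by (simp add: lp_rel_def)
  qed
qed

lemma lp_class_eq_iff:
  assumes "f \<in> lp_fun M p" "g \<in> lp_fun M p"
  shows "lp_class M p f = lp_class M p g \<longleftrightarrow> (AE x in M. f x = g x)"
  using eq_equiv_class_iff[OF equiv_lp_rel assms] assms
  by (simp add: lp_class_def lp_rel_def)

lemma lp_class_in_carrier: "f \<in> lp_fun M p \<Longrightarrow> lp_class M p f \<in> carrier (Lp M p)"
  by (simp add: Lp_def lp_class_def quotientI)

lemma Lp_carrier_cases:
  assumes "F \<in> carrier (Lp M p)"
  obtains f where "f \<in> lp_fun M p" "F = lp_class M p f"
  using assms by (auto simp: Lp_def lp_class_def elim: quotientE)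

lemma lp_fun_add:
  assumes p: "p \<ge> 0" and f: "f \<in> lp_fun M p" and g: "g \<in> lp_fun M p"
  shows "(\<lambda>x. f x + g x) \<in> lp_fun M p"
proof -
  have b: "norm (f x + g x) powr p \<le> 2 powr p * (norm (f x) powr p + norm (g x) powr p)" for x
  proof -
    have "norm (f x + g x) \<le> 2 * max (norm (f x)) (norm (g x))"
      using norm_triangle_ineq[of "f x" "g x"] by simp
    then have "norm (f x + g x) powr p \<le> (2 * max (norm (f x)) (norm (g x))) powr p"
      using p by (intro powr_mono2) auto
    also have "\<dots> = 2 powr p * max (norm (f x)) (norm (g x)) powr p"
      by (simp add: powr_mult)
    also have "\<dots> \<le> 2 powr p * (norm (f x) powr p + norm (g x) powr p)"
      by (intro mult_left_mono) (auto simp: max_def)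
    finally show ?thesis .
  qed
  have [measurable]: "f \<in> borel_measurable M" "g \<in> borel_measurable M"
    using f g by (auto simp: lp_fun_def)
  have "integrable M (\<lambda>x. norm (f x + g x) powr p)"
    by (rule Bochner_Integration.integrable_bound
          [where f = "\<lambda>x. 2 powr p * (norm (f x) powr p + norm (g x) powr p)"])
       (use f g b in \<open>simp_all add: lp_fun_def\<close>)
  then show ?thesis by (simp add: lp_fun_def)
qed

lemma lp_fun_scale: "f \<in> lp_fun M p \<Longrightarrow> (\<lambda>x. c * f x) \<in> lp_fun M p"
  by (auto simp: lp_fun_def norm_mult powr_mult)

lemma vadd_Lp:
  assumes p: "p \<ge> 0" and f: "f \<in> lp_fun M p" and g: "g \<in> lp_fun M p"
  shows "vadd (Lp M p) (lp_class M p f) (lp_class M p g) = lp_class M p (\<lambda>x. f x + g x)"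
proof -
  have eq: "lp_class M p (\<lambda>x. f' x + g' x) = lp_class M p (\<lambda>x. f x + g x)"
    if "f' \<in> lp_class M p f" "g' \<in> lp_class M p g" for f' g'
  proof -
    have *: "f' \<in> lp_fun M p" "g' \<in> lp_fun M p"
      and ff: "AE x in M. f x = f' x" and gg: "AE x in M. g x = g' x"
      using that by (simp_all add: lp_class_def lp_rel_def)
    have "AE x in M. f' x + g' x = f x + g x" using ff gg by eventually_elim simp
    with * show ?thesis using lp_class_eq_iff lp_fun_add[OF p] f g by blast
  qed
  have "f \<in> lp_class M p f" "g \<in> lp_class M p g"
    using f g by (simp_all add: lp_class_def lp_rel_def)
  then have "(\<Union>f'\<in>lp_class M p f. \<Union>g'\<in>lp_class M p g. lp_class M p (\<lambda>x. f' x + g' x)) =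
      lp_class M p (\<lambda>x. f x + g x)"
    using eq by blast
  then show ?thesis by (simp add: Lp_def)
qed

lemma vscale_Lp:
  assumes f: "f \<in> lp_fun M p"
  shows "vscale (Lp M p) c (lp_class M p f) = lp_class M p (\<lambda>x. c * f x)"
proof -
  have eq: "lp_class M p (\<lambda>x. c * f' x) = lp_class M p (\<lambda>x. c * f x)"
    if "f' \<in> lp_class M p f" for f'
  proof -
    have *: "f' \<in> lp_fun M p" and ff: "AE x in M. f x = f' x"
      using that by (simp_all add: lp_class_def lp_rel_def)
    have "AE x in M. c * f' x = c * f x" using ff by eventually_elim simp
    with * show ?thesis using lp_class_eq_iff lp_fun_scale f by blast
  qed
  have "f \<in> lp_class M p f"
    using f by (simp add: lp_class_def lp_rel_def)
  then have "(\<Union>f'\<in>lp_class M p f. lp_class M p (\<lambda>x. c * f' x)) = lp_class M p (\<lambda>x. c * f x)"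
    using eq by blast
  then show ?thesis by (simp add: Lp_def)
qed

lemma vnorm_Lp:
  assumes f: "f \<in> lp_fun M p"
  shows "vnorm (Lp M p) (lp_class M p f) = (LINT x|M. norm (f x) powr p) powr (1 / p)"
proof -
  let ?N = "\<lambda>f. (LINT x|M. norm (f x) powr p) powr (1 / p)"
  have eq: "?N f' = ?N f" if "f' \<in> lp_class M p f" for f'
  proof -
    have "f' \<in> lp_fun M p" and ae: "AE x in M. f x = f' x"
      using that by (simp_all add: lp_class_def lp_rel_def)
    then have [measurable]: "f \<in> borel_measurable M" "f' \<in> borel_measurable M"
      using f by (simp_all add: lp_fun_def)
    have "AE x in M. norm (f' x) powr p = norm (f x) powr p"
      using ae by eventually_elim simp
    then have "(LINT x|M. norm (f' x) powr p) = (LINT x|M. norm (f x) powr p)"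
      by (intro integral_cong_AE) measurable
    then show ?thesis by simp
  qed
  have "f \<in> lp_class M p f"
    using f by (simp add: lp_class_def lp_rel_def)
  with eq have "?N ` lp_class M p f = {?N f}" by blast
  then show ?thesis by (simp add: Lp_def)
qed

lemma lp_class_in_cone_iff:
  assumes f: "f \<in> lp_fun M p"
  shows "lp_class M p f \<in> Lp_cone M p \<longleftrightarrow> (AE x in M. f x \<in> \<real>\<^sub>\<ge>\<^sub>0)"
proof -
  have "AE x in M. g x \<in> \<real>\<^sub>\<ge>\<^sub>0" if "g \<in> lp_class M p f" "AE x in M. f x \<in> \<real>\<^sub>\<ge>\<^sub>0" for g
  proof -
    have "AE x in M. f x = g x" using that(1) by (simp add: lp_class_def lp_rel_def)
    then show ?thesis using that(2) by eventually_elim simp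
  qed
  moreover have "f \<in> lp_class M p f" using f by (simp add: lp_class_def lp_rel_def)
  ultimately show ?thesis using lp_class_in_carrier[OF f] unfolding Lp_cone_def by blast
qed

end

theory Submission
  imports Defs "HOL-Library.Function_Algebras"
begin

text \<open>
  Discretise time with mesh \<open>1/m\<close>, and write \<open>V k = T (k/m)\<close>.  For a positive semigroup the Kreiss condition
  at the real point \<open>\<lambda> = 1/n\<close> bounds the positive operator that integrates the semigroup over \<open>[0, n]\<close>
  by a multiple of \<open>n\<close>.  A positive operator on \<open>L\<^sup>p\<close> acts on \<open>\<ell>\<^sup>p\<close>-valued functions with the same norm, and
  applying this to convolution with the semigroup gives, with a constant independent of \<open>m\<close>,
  \<open>(\<Sum>k<m n. \<parallel>V k B x\<parallel>\<^sup>p) \<le> m (c n \<parallel>x\<parallel>)\<^sup>p\<close> and, dually,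
  \<open>\<parallel>\<Sum>k<m n. V k B (z k)\<parallel> \<le> c n m\<^bsup>1/q\<^esup> (\<Sum>k. \<parallel>z k\<parallel>\<^sup>p)\<^bsup>1/p\<^esup>\<close>, where \<open>B\<close> averages the orbit over
  an interval of length \<open>1/m\<close> and shifts it by a fixed time.
  Factor \<open>T n B B x = V k B (V (m n - k) B x)\<close>.  The second estimate on the dyadic block \<open>m 2\<^sup>i \<le> k < m 2\<^bsup>i+1\<^esup>\<close>
  bounds \<open>\<parallel>T n B B x\<parallel>\<^sup>p\<close> by the part of the first sum that belongs to the block; adding the \<open>log n\<close> blocks gives
  the exponent \<open>1/p\<close>.  The second estimate with \<open>z k\<close> proportional to \<open>V (m n - k) B x / (m n - k)\<close>, and the first one on
  each block, give the exponent \<open>1/q\<close>.  Finally \<open>m\<close> tends to infinity.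
  Eventual positivity costs only a fixed shift in time.
\<close>

section \<open>Operator semigroups on a normed subspace\<close>

text \<open>Two obstacles shape the construction. First, a single orbit value is not controlled by
  the integrated semigroup, and passing to the mesh naively would lose a power of \<open>m\<close>.
  Hence \<open>B\<close> carries an extra unit of time, split in \<open>m\<close> ways: the
  \<open>i\<close>-th copy spends \<open>i / m\<close> inside the integral and the remaining
  \<open>(m - i) / m\<close> outside. Each orbit value becomes a convolution over a full time unit,
  and the constants stay free of \<open>m\<close>. Second, positivity is known only after time
  \<open>\<tau>\<close>, so resolvents and short integrals need not preserve the cone. They do
  preserve the larger cone \<open>E\<close> of vectors whose orbit is positive from time
  \<open>\<tau>\<close> on; for the resolvent at small \<open>l\<close> this is a second use of the
  Kreiss condition. Integrals and \<open>\<ell>\<^sup>p\<close>-valued functions never appear as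
  such: an integral is the closed expression \<open>(1 - exp (- l t) T t) R l\<close>, and an
  \<open>\<ell>\<^sup>p\<close> norm is the least upper bound of the combinations with coefficients
  in the unit ball of \<open>\<ell>\<^sup>q\<close>, a description that positive operators respect.
  Only real scalars enter until complex functions are split at the end.\<close>

locale normed_subspace =
  fixes V :: "'v::real_vector set" and N :: "'v \<Rightarrow> real"
  assumes subspace_V: "subspace V"
    and N_nonneg: "0 \<le> N x"
    and N_scale: "x \<in> V \<Longrightarrow> N (c *\<^sub>R x) = \<bar>c\<bar> * N x"
    and N_add: "x \<in> V \<Longrightarrow> y \<in> V \<Longrightarrow> N (x + y) \<le> N x + N y"
begin

lemma V_closed [simp, intro]:
  "0 \<in> V" "x \<in> V \<Longrightarrow> y \<in> V \<Longrightarrow> x + y \<in> V" "x \<in> V \<Longrightarrow> y \<in> V \<Longrightarrow> x - y \<in> V"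
  "x \<in> V \<Longrightarrow> c *\<^sub>R x \<in> V" "(\<And>i. i \<in> I \<Longrightarrow> f i \<in> V) \<Longrightarrow> sum f I \<in> V"
  using subspace_V by (auto intro: subspace_0 subspace_add subspace_diff subspace_scale subspace_sum)

lemma N_zero [simp]: "N 0 = 0"
  using N_scale[of 0 0] by simp

lemma N_diff_commute: "x \<in> V \<Longrightarrow> y \<in> V \<Longrightarrow> N (x - y) = N (y - x)"
  using N_scale[of "y - x" "-1"] by simp

lemma N_diff: "x \<in> V \<Longrightarrow> y \<in> V \<Longrightarrow> N (x - y) \<le> N x + N y"
  using N_add[of x "- 1 *\<^sub>R y"] N_scale[of y "- 1"] V_closed(4)[of y "- 1"] by simp

lemma N_triangle3: "x \<in> V \<Longrightarrow> y \<in> V \<Longrightarrow> z \<in> V \<Longrightarrow> N (x - z) \<le> N (x - y) + N (y - z)"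
  using N_add[of "x - y" "y - z"] by simp

lemma N_sum: "(\<And>i. i \<in> I \<Longrightarrow> f i \<in> V) \<Longrightarrow> N (sum f I) \<le> (\<Sum>i\<in>I. N (f i))"
proof (induction I rule: infinite_finite_induct)
  case (insert i I)
  have "N (f i + sum f I) \<le> N (f i) + N (sum f I)"
    using insert.prems by (intro N_add) auto
  moreover have "N (sum f I) \<le> (\<Sum>i\<in>I. N (f i))"
    using insert.prems by (intro insert.IH) auto
  ultimately show ?case using insert.hyps by simp
qed auto

section \<open>Uniform boundedness and local boundedness of semigroups\<close>

lemma N_tendsto_unique_bound:
  assumes "((\<lambda>i. N (f i - x)) \<longlongrightarrow> 0) F" "F \<noteq> bot" "x \<in> V" "\<And>i. f i \<in> V"
    and "eventually (\<lambda>i. N (f i) \<le> b) F"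
  shows "N x \<le> b"
proof -
  have "eventually (\<lambda>i. N x \<le> b + N (f i - x)) F"
    using assms(5)
  proof eventually_elim
    case (elim i)
    have "N x \<le> N (f i) + N (f i - x)" using N_diff[of "f i" "f i - x"] assms(3,4) by auto
    with elim show ?case by simp
  qed
  moreover have "((\<lambda>i. b + N (f i - x)) \<longlongrightarrow> b + 0) F"
    by (intro tendsto_intros assms(1))
  ultimately show ?thesis
    using tendsto_lowerbound[of "\<lambda>i. b + N (f i - x)" "b + 0" F "N x"] assms(2) by simp
qed

text \<open>Here \<open>l\<close> is the exact operator norm. A vector of the unit ball that nearly
  attains it is the hump used in \<open>uniform_boundedness\<close>; any fraction above 1/2 would
  serve there, and 2/3 is the choice made.\<close>

lemma bounded_by_near_supremum:
  assumes "linear S" and bd: "\<And>x. x \<in> V \<Longrightarrow> N (S x) \<le> C * N x" and SV: "\<And>x. x \<in> V \<Longrightarrow> S x \<in> V"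
    and L: "\<not> (\<forall>x\<in>V. N (S x) \<le> b * N x)" "0 \<le> b"
  obtains l u where "b \<le> l" "\<And>x. x \<in> V \<Longrightarrow> N (S x) \<le> l * N x" "u \<in> V" "N u \<le> 1" "2 / 3 * l \<le> N (S u)"
proof -
  define A where "A = (\<lambda>x. N (S x)) ` {x \<in> V. N x \<le> 1}"
  have bdd: "bdd_above A"
  proof (rule bdd_aboveI)
    fix y assume "y \<in> A"
    then obtain x where x: "x \<in> V" "N x \<le> 1" "y = N (S x)" by (auto simp: A_def)
    have "C * N x \<le> \<bar>C\<bar> * 1" using x N_nonneg[of x] by (intro mult_mono) auto
    then show "y \<le> \<bar>C\<bar>" using bd[OF x(1)] x by simp
  qed
  define l where "l = Sup A"
  have le: "N (S x) \<le> l * N x" if x: "x \<in> V" for x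
  proof (cases "N x = 0")
    case True
    then have "N (S x) \<le> 0" using bd[OF x] by simp
    then show ?thesis using True by simp
  next
    case False
    then have pos: "0 < N x" using N_nonneg[of x] by simp
    let ?y = "(1 / N x) *\<^sub>R x"
    have "N (S ?y) \<in> A" unfolding A_def using x pos by (auto simp: N_scale intro!: imageI)
    then have "N (S ?y) \<le> l" unfolding l_def using bdd by (rule cSup_upper)
    moreover have "N (S ?y) = N (S x) / N x"
      using assms(1) SV[OF x] pos by (simp add: linear_scale N_scale)
    ultimately show ?thesis using pos by (simp add: field_simps)
  qed
  have bl: "b < l"
  proof (rule ccontr)
    assume "\<not> b < l"
    then have "N (S x) \<le> b * N x" if "x \<in> V" for x
      using le[OF that] mult_right_mono[of l b "N x"] N_nonneg[of x] by linarith
    then show False using L by blast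
  qed
  have "A \<noteq> {}" unfolding A_def using V_closed(1) by (auto intro!: exI[of _ 0])
  moreover have "2 / 3 * l < l" using bl L(2) by simp
  ultimately obtain y where "y \<in> A" "2 / 3 * l < y" unfolding l_def using less_cSupD by blast
  then obtain u where "u \<in> V" "N u \<le> 1" "2 / 3 * l \<le> N (S u)" by (auto simp: A_def)
  then show ?thesis using that[of l u] bl le by simp
qed

text \<open>Sokal's proof: near any point \<open>x\<close>, one of \<open>x + u\<close>, \<open>x - u\<close> has an image of norm at least \<open>N (S u)\<close>.\<close>
lemma uniform_boundedness:
  assumes complete: "\<And>f. (\<And>k::nat. f k \<in> V) \<Longrightarrow> summable (\<lambda>k. N (f k)) \<Longrightarrow>
      \<exists>x\<in>V. (\<lambda>n. N ((\<Sum>k<n. f k) - x)) \<longlonglongrightarrow> 0"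
    and lin: "\<And>n::nat. linear (S n)" and SV: "\<And>n x. x \<in> V \<Longrightarrow> S n x \<in> V"
    and bd: "\<And>n. \<exists>C. \<forall>x\<in>V. N (S n x) \<le> C * N x"
    and pointwise: "\<And>x. x \<in> V \<Longrightarrow> \<exists>b. \<forall>n. N (S n x) \<le> b"
  shows "\<exists>b. \<forall>n. \<forall>x\<in>V. N (S n x) \<le> b * N x"
proof (rule ccontr)
  assume contr: "\<not> ?thesis"
  \<comment> \<open>Hump \<open>k\<close> contributes at least \<open>2 / 3 * l k / 3 ^ k\<close>,
    and the later ones can cancel at most \<open>l k / 3 ^ k / 2\<close>. What survives is
    \<open>l k / (6 * 3 ^ k)\<close>, which this threshold makes at least
    \<open>Suc k\<close>.\<close>
  have "\<exists>n l u. 6 * 3 ^ k * real (Suc k) \<le> l \<and> (\<forall>x\<in>V. N (S n x) \<le> l * N x) \<and> u \<in> V \<and> N u \<le> 1 \<and> 2 / 3 * l \<le> N (S n u)" for k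
  proof -
    obtain n where n: "\<not> (\<forall>x\<in>V. N (S n x) \<le> (6 * 3 ^ k * real (Suc k)) * N x)" using contr by blast
    obtain C where C: "\<And>x. x \<in> V \<Longrightarrow> N (S n x) \<le> C * N x" using bd by blast
    obtain l u where "6 * 3 ^ k * real (Suc k) \<le> l" "\<And>x. x \<in> V \<Longrightarrow> N (S n x) \<le> l * N x" "u \<in> V" "N u \<le> 1" "2 / 3 * l \<le> N (S n u)"
      using bounded_by_near_supremum[OF lin C SV n] by (auto simp del: of_nat_Suc)
    then show ?thesis by blast
  qed
  then obtain n l u where l: "\<And>k. 6 * 3 ^ k * real (Suc k) \<le> l k" "\<And>k x. x \<in> V \<Longrightarrow> N (S (n k) x) \<le> l k * N x"
    and u: "\<And>k. u k \<in> V" "\<And>k. N (u k) \<le> 1" "\<And>k. 2 / 3 * l k \<le> N (S (n k) (u k))"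
    by metis
  define e where "e k = (1 / 3 ^ k :: real) *\<^sub>R u k" for k
  define x where "x = rec_nat 0 (\<lambda>k x. if N (S (n k) (e k)) \<le> N (S (n k) (x + e k)) then x + e k else x - e k)"
  have x0: "x 0 = 0" and xS: "x (Suc k) = (if N (S (n k) (e k)) \<le> N (S (n k) (x k + e k)) then x k + e k else x k - e k)" for k
    by (simp_all add: x_def)
  have eV: "e k \<in> V" for k unfolding e_def using u by auto
  have xV: "x k \<in> V" for k by (induction k) (auto simp: x0 xS eV)
  have eN: "N (e k) \<le> 1 / 3 ^ k" for k unfolding e_def using u by (simp add: N_scale divide_right_mono)
  have step: "N (x (Suc k) - x k) \<le> 1 / 3 ^ k" for k
    using eN[of k] N_scale[OF eV[of k], of "-1"] by (simp add: xS)
  have large: "N (S (n k) (e k)) \<le> N (S (n k) (x (Suc k)))" for k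
  proof (cases "N (S (n k) (e k)) \<le> N (S (n k) (x k + e k))")
    case False
    let ?a = "S (n k) (x k)" and ?b = "S (n k) (e k)"
    have V: "?a \<in> V" "?b \<in> V" using SV xV eV by auto
    have "2 *\<^sub>R ?b = (?a + ?b) - (?a - ?b)" by (simp add: scaleR_2)
    then have "2 * N ?b \<le> N (?a + ?b) + N (?a - ?b)"
      using N_diff[of "?a + ?b" "?a - ?b"] N_scale[of ?b 2] V by simp
    then show ?thesis using False by (simp add: xS linear_add[OF lin] linear_diff[OF lin])
  qed (simp add: xS)
  have "summable (\<lambda>k. (1 / 3 :: real) ^ k)" by (rule summable_geometric) simp
  then have "summable (\<lambda>k. N (x (Suc k) - x k))"
    by (rule summable_comparison_test[rotated])
      (use step in \<open>auto simp: N_nonneg power_one_over intro!: exI[of _ 0]\<close>)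
  then obtain z where z: "z \<in> V" "(\<lambda>m. N ((\<Sum>k<m. x (Suc k) - x k) - z)) \<longlonglongrightarrow> 0"
    using complete[of "\<lambda>k. x (Suc k) - x k"] xV by auto
  have xz: "(\<lambda>m. N (x m - z)) \<longlonglongrightarrow> 0"
    using z(2) unfolding sum_lessThan_telescope by (simp add: x0)
  have tail: "N (x (Suc k + j) - x (Suc k)) \<le> (1 / 3 ^ k - 1 / 3 ^ (k + j)) / 2" for k j
  proof (induction j)
    case (Suc j)
    have "N (x (Suc k + Suc j) - x (Suc k)) \<le> N (x (Suc (Suc k + j)) - x (Suc k + j)) + N (x (Suc k + j) - x (Suc k))"
      using N_triangle3[OF xV xV xV] by simp
    also have "\<dots> \<le> 1 / 3 ^ (Suc k + j) + (1 / 3 ^ k - 1 / 3 ^ (k + j)) / 2"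
      using Suc by (intro add_mono) (use step[of "Suc k + j"] in simp_all)
    also have "\<dots> = (1 / 3 ^ k - 1 / 3 ^ (k + Suc j)) / 2" by (simp add: field_simps)
    finally show ?case .
  qed simp
  have near: "N (z - x (Suc k)) \<le> 1 / 3 ^ k / 2" for k
  proof (rule N_tendsto_unique_bound[where f = "\<lambda>j. x (Suc k + j) - x (Suc k)"])
    have "(\<lambda>j. N (x (j + Suc k) - z)) \<longlonglongrightarrow> 0" by (rule LIMSEQ_ignore_initial_segment[OF xz])
    then show "(\<lambda>j. N (x (Suc k + j) - x (Suc k) - (z - x (Suc k)))) \<longlonglongrightarrow> 0"
      by (simp add: add.commute)
    have "N (x (Suc k + j) - x (Suc k)) \<le> 1 / 3 ^ k / 2" for j
      by (rule order_trans[OF tail]) (simp add: divide_right_mono)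
    then show "\<forall>\<^sub>F j in sequentially. N (x (Suc k + j) - x (Suc k)) \<le> 1 / 3 ^ k / 2" by simp
  qed (use xV z in auto)
  obtain b where b: "\<And>m. N (S m z) \<le> b" using pointwise[OF z(1)] by blast
  obtain k where k: "b < real k" using reals_Archimedean2 by blast
  have lk: "0 \<le> l k" using l(1)[of k] by (rule order_trans[rotated]) simp
  have "1 / 3 ^ k * (2 / 3 * l k) \<le> 1 / 3 ^ k * N (S (n k) (u k))" using u(3) by (intro mult_left_mono) auto
  also have "\<dots> = N (S (n k) (e k))" unfolding e_def using SV[OF u(1)] by (simp add: linear_scale[OF lin] N_scale)
  also have "\<dots> \<le> N (S (n k) (x (Suc k)))" by (rule large)
  also have "\<dots> \<le> N (S (n k) z) + N (S (n k) (z - x (Suc k)))"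
    using N_diff[of "S (n k) z" "S (n k) (z - x (Suc k))"] SV xV z by (simp add: linear_diff[OF lin])
  also have "\<dots> \<le> b + l k * (1 / 3 ^ k / 2)"
  proof (intro add_mono b)
    have "N (S (n k) (z - x (Suc k))) \<le> l k * N (z - x (Suc k))" using xV z(1) by (intro l(2)) auto
    also have "\<dots> \<le> l k * (1 / 3 ^ k / 2)" using near lk by (intro mult_left_mono)
    finally show "N (S (n k) (z - x (Suc k))) \<le> l k * (1 / 3 ^ k / 2)" .
  qed
  finally have "l k / (6 * 3 ^ k) \<le> b" by (simp add: field_simps)
  moreover have "real (Suc k) \<le> l k / (6 * 3 ^ k)" using l(1)[of k] by (simp add: field_simps)
  ultimately show False using k by simp
qed

text \<open>If no interval at 0 had a uniform bound, there would be times \<open>s n\<close> tending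
  to 0 with unbounded operators. Strong continuity at 0 bounds every single orbit along these times,
  contradicting uniform boundedness. The semigroup law then spreads the bound from a short interval
  to the unit interval.\<close>

lemma semigroup_locally_bounded:
  fixes T :: "real \<Rightarrow> 'v \<Rightarrow> 'v"
  assumes complete: "\<And>f. (\<And>k::nat. f k \<in> V) \<Longrightarrow> summable (\<lambda>k. N (f k)) \<Longrightarrow>
      \<exists>x\<in>V. (\<lambda>n. N ((\<Sum>k<n. f k) - x)) \<longlonglongrightarrow> 0"
    and lin: "\<And>s. 0 \<le> s \<Longrightarrow> linear (T s)" and TV: "\<And>s x. 0 \<le> s \<Longrightarrow> x \<in> V \<Longrightarrow> T s x \<in> V"
    and T0: "\<And>x. x \<in> V \<Longrightarrow> T 0 x = x"
    and T_add: "\<And>s t x. 0 \<le> s \<Longrightarrow> 0 \<le> t \<Longrightarrow> x \<in> V \<Longrightarrow> T (s + t) x = T s (T t x)"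
    and bd: "\<And>s. 0 \<le> s \<Longrightarrow> \<exists>C. \<forall>x\<in>V. N (T s x) \<le> C * N x"
    and cont: "\<And>x. x \<in> V \<Longrightarrow> ((\<lambda>t. N (T t x - x)) \<longlongrightarrow> 0) (at_right 0)"
  obtains M where "1 \<le> M" "\<And>s x. 0 \<le> s \<Longrightarrow> s \<le> 1 \<Longrightarrow> x \<in> V \<Longrightarrow> N (T s x) \<le> M * N x"
proof -
  have "\<exists>d b. 0 < d \<and> (\<forall>s x. 0 \<le> s \<longrightarrow> s \<le> d \<longrightarrow> x \<in> V \<longrightarrow> N (T s x) \<le> b * N x)"
  proof (rule ccontr)
    assume "\<not> ?thesis"
    then have "\<exists>s x. 0 \<le> s \<and> s \<le> 1 / real (Suc n) \<and> x \<in> V \<and> real n * N x < N (T s x)" for n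
      by (metis of_nat_0_less_iff zero_less_Suc zero_less_divide_1_iff not_le)
    then obtain s x where s: "\<And>n. 0 \<le> s n" "\<And>n. s n \<le> 1 / real (Suc n)"
      and x: "\<And>n. x n \<in> V" "\<And>n. real n * N (x n) < N (T (s n) (x n))"
      by metis
    have pw: "\<exists>b. \<forall>n. N (T (s n) y) \<le> b" if y: "y \<in> V" for y
    proof -
      have "eventually (\<lambda>t. N (T t y - y) < 1) (at_right 0)"
        using order_tendstoD(2)[OF cont[OF y]] by simp
      then obtain d where d: "0 < d" "\<And>t. 0 < t \<Longrightarrow> t < d \<Longrightarrow> N (T t y - y) < 1"
        by (auto simp: eventually_at_right_field)
      obtain m where m: "1 / real (Suc m) < d" using nat_approx_posE[OF d(1)] by blast
      have le: "N (T (s n) y) \<le> N y + 1" if "m \<le> n" for n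
      proof (cases "s n = 0")
        case False
        have "1 / real (Suc n) \<le> 1 / real (Suc m)" using that by (simp add: frac_le)
        then have "N (T (s n) y - y) < 1" using s[of n] m False by (intro d(2)) auto
        moreover have "N (T (s n) y) \<le> N (T (s n) y - y) + N y"
          using N_add[of "T (s n) y - y" y] TV[OF s(1) y] y by simp
        ultimately show ?thesis by simp
      qed (use T0 y in simp)
      have "N (T (s n) y) \<le> (N y + 1) + (\<Sum>k<m. N (T (s k) y))" for n
      proof (cases "m \<le> n")
        case True
        then show ?thesis using le[OF True] sum_nonneg[of "{..<m}" "\<lambda>k. N (T (s k) y)"] by (simp add: N_nonneg)
      next
        case False
        then have "N (T (s n) y) \<le> (\<Sum>k<m. N (T (s k) y))"
          by (intro member_le_sum) (auto simp: N_nonneg)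
        then show ?thesis using N_nonneg[of y] by linarith
      qed
      then show ?thesis by blast
    qed
    have "\<exists>b. \<forall>n. \<forall>y\<in>V. N (T (s n) y) \<le> b * N y"
      by (rule uniform_boundedness[OF complete]) (use lin TV bd pw s(1) in auto)
    then obtain b where b: "\<And>n y. y \<in> V \<Longrightarrow> N (T (s n) y) \<le> b * N y" by blast
    obtain n where "b < real n" using reals_Archimedean2 by blast
    then have "b * N (x n) \<le> real n * N (x n)" by (intro mult_right_mono) (auto simp: N_nonneg)
    then show False using b[OF x(1)[of n], of n] x(2)[of n] by linarith
  qed
  then obtain d b' where d: "0 < d" "\<And>s x. 0 \<le> s \<Longrightarrow> s \<le> d \<Longrightarrow> x \<in> V \<Longrightarrow> N (T s x) \<le> b' * N x"
    by blast
  define b where "b = max b' 1"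
  have b: "1 \<le> b" "N (T s x) \<le> b * N x" if "0 \<le> s" "s \<le> d" "x \<in> V" for s x
    using d(2)[OF that] mult_right_mono[of b' b "N x"] by (auto simp: b_def N_nonneg)
  have b1: "1 \<le> b" by (simp add: b_def)
  have iter: "N (T s x) \<le> b ^ n * N x" if "0 \<le> s" "s \<le> real n * d" "x \<in> V" for s x n
    using that
  proof (induction n arbitrary: s x)
    case 0
    then show ?case using T0 by simp
  next
    case (Suc n)
    define t where "t = min s d"
    have t: "0 \<le> t" "t \<le> d" "0 \<le> s - t" "s - t \<le> real n * d"
      using Suc.prems d(1) by (auto simp: t_def min_def algebra_simps)
    have "N (T s x) = N (T t (T (s - t) x))" using T_add[of t "s - t" x] t Suc.prems by simp
    also have "\<dots> \<le> b * N (T (s - t) x)" using t Suc.prems by (intro b TV) auto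
    also have "\<dots> \<le> b * (b ^ n * N x)" using t Suc.prems b1 by (intro mult_left_mono Suc.IH) auto
    finally show ?case by simp
  qed
  obtain n where "1 / d < real n" using reals_Archimedean2 by blast
  then have n: "1 \<le> real n * d" using d(1) by (simp add: field_simps)
  show ?thesis
  proof (rule that[of "b ^ n"])
    show "1 \<le> b ^ n" using b1 by simp
    show "N (T s x) \<le> b ^ n * N x" if "0 \<le> s" "s \<le> 1" "x \<in> V" for s x
      using that n by (intro iter) auto
  qed
qed

end

text \<open>\<open>R l\<close> is the inverse of \<open>l - G\<close>, where \<open>G\<close> is the
  generator of \<open>T\<close>, that is \<open>G = -A\<close>. The last two axioms say so without
  naming the unbounded operator: \<open>R_generator\<close> puts \<open>R l x\<close> into the
  domain with \<open>G (R l x) = l *\<^sub>R R l x - x\<close>, and \<open>R_inverse\<close> states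
  that \<open>R l\<close> undoes \<open>l - G\<close>.\<close>

locale resolvent_semigroup = normed_subspace V N
  for V :: "'v::real_vector set" and N :: "'v \<Rightarrow> real" +
  fixes T R :: "real \<Rightarrow> 'v \<Rightarrow> 'v" and M C :: real
  assumes T_linear: "0 \<le> s \<Longrightarrow> linear (T s)"
    and T_V [simp]: "0 \<le> s \<Longrightarrow> x \<in> V \<Longrightarrow> T s x \<in> V"
    and T_0 [simp]: "x \<in> V \<Longrightarrow> T 0 x = x"
    and T_add: "0 \<le> s \<Longrightarrow> 0 \<le> t \<Longrightarrow> x \<in> V \<Longrightarrow> T (s + t) x = T s (T t x)"
    and M_ge: "1 \<le> M"
    and T_unit_bound: "0 \<le> s \<Longrightarrow> s \<le> 1 \<Longrightarrow> x \<in> V \<Longrightarrow> N (T s x) \<le> M * N x"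
    and T_cont: "x \<in> V \<Longrightarrow> ((\<lambda>t. N (T t x - x)) \<longlongrightarrow> 0) (at_right 0)"
    and C_pos: "0 < C"
    and R_linear: "0 < l \<Longrightarrow> linear (R l)"
    and R_V [simp]: "0 < l \<Longrightarrow> x \<in> V \<Longrightarrow> R l x \<in> V"
    and R_bound: "0 < l \<Longrightarrow> x \<in> V \<Longrightarrow> N (R l x) \<le> C / l * N x"
    and R_generator: "0 < l \<Longrightarrow> x \<in> V \<Longrightarrow>
      ((\<lambda>t. N ((1 / t) *\<^sub>R (T t (R l x) - R l x) - (l *\<^sub>R R l x - x))) \<longlongrightarrow> 0) (at_right 0)"
    and R_inverse: "0 < l \<Longrightarrow> u \<in> V \<Longrightarrow> y \<in> V \<Longrightarrow>
      ((\<lambda>t. N ((1 / t) *\<^sub>R (T t u - u) - y)) \<longlongrightarrow> 0) (at_right 0) \<Longrightarrow> R l (l *\<^sub>R u - y) = u"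
begin

section \<open>Growth bounds, commutation relations and the resolvent identity\<close>

lemmas T_simps = linear_add[OF T_linear] linear_diff[OF T_linear] linear_scale[OF T_linear] linear_sum[OF T_linear]
lemmas R_simps = linear_add[OF R_linear] linear_diff[OF R_linear] linear_scale[OF R_linear] linear_sum[OF R_linear]

lemma T_commute: "0 \<le> s \<Longrightarrow> 0 \<le> t \<Longrightarrow> x \<in> V \<Longrightarrow> T s (T t x) = T t (T s x)"
  using T_add[of s t x] T_add[of t s x] by (simp add: add.commute)

lemma T_nat_bound: "0 \<le> s \<Longrightarrow> s \<le> real n \<Longrightarrow> x \<in> V \<Longrightarrow> N (T s x) \<le> M ^ n * N x"
proof (induction n arbitrary: s x)
  case (Suc n)
  show ?case
  proof (cases "s \<le> 1")
    case True
    have "N (T s x) \<le> M * N x" using Suc.prems True by (intro T_unit_bound) auto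
    also have "\<dots> \<le> (M ^ n * M) * N x"
      using M_ge N_nonneg[of x] one_le_power[OF M_ge, of n]
      by (intro mult_right_mono) (auto intro: mult_left_le)
    finally show ?thesis by (simp add: mult.commute)
  next
    case False
    have "N (T s x) = N (T 1 (T (s - 1) x))" using False Suc.prems T_add[of 1 "s - 1" x] by simp
    also have "\<dots> \<le> M * N (T (s - 1) x)" using False Suc.prems by (intro T_unit_bound) auto
    also have "\<dots> \<le> M * (M ^ n * N x)" using False Suc.prems M_ge by (intro mult_left_mono Suc.IH) auto
    finally show ?thesis by (simp add: mult.assoc)
  qed
qed auto

definition bnd :: "real \<Rightarrow> real" where "bnd t = M ^ nat \<lceil>t\<rceil>"

lemma bnd_ge1: "1 \<le> bnd t"
  unfolding bnd_def using M_ge by simp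

lemma bnd_mono: "s \<le> t \<Longrightarrow> bnd s \<le> bnd t"
  unfolding bnd_def using M_ge by (intro power_increasing nat_mono ceiling_mono)

lemma T_bound: "0 \<le> s \<Longrightarrow> s \<le> t \<Longrightarrow> x \<in> V \<Longrightarrow> N (T s x) \<le> bnd t * N x"
  unfolding bnd_def by (rule T_nat_bound) (assumption | linarith)+

lemma T_tendsto:
  assumes "((\<lambda>i. N (f i - x)) \<longlongrightarrow> 0) F" "\<And>i. f i \<in> V" "x \<in> V" "0 \<le> s"
  shows "((\<lambda>i. N (T s (f i) - T s x)) \<longlongrightarrow> 0) F"
proof (rule tendsto_sandwich[of "\<lambda>_. 0" _ _ "\<lambda>i. bnd s * N (f i - x)"])
  show "((\<lambda>i. bnd s * N (f i - x)) \<longlongrightarrow> 0) F"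
    using tendsto_mult_right_zero[OF assms(1)] by simp
  show "\<forall>\<^sub>F i in F. N (T s (f i) - T s x) \<le> bnd s * N (f i - x)"
    using T_bound[OF assms(4) order_refl V_closed(3)[OF assms(2,3)]] assms(4) by (simp add: T_simps)
qed (auto simp: N_nonneg)

text \<open>\<open>T s\<close> carries the difference quotients of \<open>R l x\<close> to those of
  \<open>T s (R l x)\<close>, so \<open>R_inverse\<close> recognises the latter vector as a value of
  the resolvent.\<close>

lemma T_R_commute:
  assumes "0 \<le> s" "0 < l" "x \<in> V"
  shows "T s (R l x) = R l (T s x)"
proof -
  let ?u = "R l x" and ?y = "l *\<^sub>R R l x - x"
  have V: "?u \<in> V" "?y \<in> V" using assms by auto
  have "((\<lambda>t. N ((1 / t) *\<^sub>R (T t (T s ?u) - T s ?u) - T s ?y)) \<longlongrightarrow> 0) (at_right 0)"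
  proof (rule tendsto_sandwich[of "\<lambda>_. 0" _ _ "\<lambda>t. bnd s * N ((1 / t) *\<^sub>R (T t ?u - ?u) - ?y)"])
    show "((\<lambda>t. bnd s * N ((1 / t) *\<^sub>R (T t ?u - ?u) - ?y)) \<longlongrightarrow> 0) (at_right 0)"
      using R_generator[OF assms(2,3)] by (rule tendsto_mult_right_zero)
    show "\<forall>\<^sub>F t in at_right 0. N ((1 / t) *\<^sub>R (T t (T s ?u) - T s ?u) - T s ?y)
            \<le> bnd s * N ((1 / t) *\<^sub>R (T t ?u - ?u) - ?y)"
    proof (rule eventually_at_rightI[of 0 1])
      fix t :: real assume t: "t \<in> {0<..<1}"
      have "(1 / t) *\<^sub>R (T t (T s ?u) - T s ?u) - T s ?y = T s ((1 / t) *\<^sub>R (T t ?u - ?u) - ?y)"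
        using t V assms by (simp only: T_simps) (simp add: T_commute[of t s])
      then show "N ((1 / t) *\<^sub>R (T t (T s ?u) - T s ?u) - T s ?y)
            \<le> bnd s * N ((1 / t) *\<^sub>R (T t ?u - ?u) - ?y)"
        using t V assms by (metis T_V T_bound V_closed(3,4) greaterThanLessThan_iff less_imp_le order_refl)
    qed simp
  qed (auto simp: N_nonneg)
  then have "R l (l *\<^sub>R T s ?u - T s ?y) = T s ?u"
    using V assms by (intro R_inverse) auto
  then show ?thesis using assms by (simp add: T_simps)
qed

text \<open>\<open>R l' x\<close> lies in the domain, so \<open>R_inverse\<close> at
  \<open>l\<close> recovers it from \<open>x + (l - l') *\<^sub>R R l' x\<close>.\<close>

lemma resolvent_identity:
  assumes "0 < l" "0 < l'" "x \<in> V"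
  shows "R l' x = R l x + (l - l') *\<^sub>R R l (R l' x)"
proof -
  let ?u = "R l' x"
  have "R l (l *\<^sub>R ?u - (l' *\<^sub>R ?u - x)) = ?u"
    using assms by (intro R_inverse R_generator) auto
  then show ?thesis
    using assms by (simp add: R_simps algebra_simps)
qed

section \<open>Weighted orbit integrals, in closed form and as limits of Riemann sums\<close>

definition W :: "real \<Rightarrow> real \<Rightarrow> 'v \<Rightarrow> 'v" where
  "W l t x = R l x - exp (- l * t) *\<^sub>R T t (R l x)"

lemma W_V [simp]: "0 < l \<Longrightarrow> 0 \<le> t \<Longrightarrow> x \<in> V \<Longrightarrow> W l t x \<in> V"
  by (auto simp: W_def)

lemma W_linear: "0 < l \<Longrightarrow> 0 \<le> t \<Longrightarrow> linear (W l t)"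
  by (rule linearI) (simp_all add: W_def T_simps R_simps algebra_simps)

lemmas W_simps = linear_add[OF W_linear] linear_diff[OF W_linear] linear_scale[OF W_linear] linear_sum[OF W_linear]

lemma T_W_commute: "0 \<le> s \<Longrightarrow> 0 < l \<Longrightarrow> 0 \<le> t \<Longrightarrow> x \<in> V \<Longrightarrow> T s (W l t x) = W l t (T s x)"
  by (simp add: W_def T_simps T_commute[of s t] T_R_commute)

lemma T_sum_index:
  "0 \<le> h \<Longrightarrow> x \<in> V \<Longrightarrow> T (real i * h) (T (real j * h) x) = T (real (i + j) * h) x"
  by (simp add: T_add distrib_right)

text \<open>The sum telescopes: its \<open>i\<close>-th term is the integral over the cell from
  \<open>i h\<close> to \<open>(i + 1) h\<close>, a difference of consecutive values of
  \<open>exp (- l s) T s (R l x)\<close>.\<close>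

lemma sum_W:
  assumes "0 < l" "0 \<le> h" "x \<in> V"
  shows "(\<Sum>i<n. exp (- l * h * i) *\<^sub>R T (real i * h) (W l h x)) =
     R l x - exp (- l * h * n) *\<^sub>R T (real n * h) (R l x)"
proof (induction n)
  case (Suc n)
  have "T (real n * h) (W l h x) = T (real n * h) (R l x) - exp (- l * h) *\<^sub>R T (real (Suc n) * h) (R l x)"
    using assms T_sum_index[of h "R l x" n 1] by (simp add: W_def T_simps)
  moreover have "exp (- l * h * real (Suc n)) = exp (- l * h * n) * exp (- l * h)"
    by (simp add: algebra_simps flip: exp_add)
  ultimately show ?case unfolding sum.lessThan_Suc Suc.IH
    by (simp add: scaleR_diff_right)
qed (use assms in simp)

text \<open>Averages over shrinking intervals recover \<open>x\<close>. The error splits into the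
  generator quotient of \<open>R l x\<close>, the scalar quotient of the exponential, whose limit is
  \<open>l\<close>, and the continuity of the orbit of \<open>R l x\<close> at 0.\<close>

lemma difference_quotient:
  assumes "0 < l" "x \<in> V"
  shows "((\<lambda>h. N ((1 / h) *\<^sub>R W l h x - x)) \<longlongrightarrow> 0) (at_right 0)"
proof -
  let ?u = "R l x" and ?y = "l *\<^sub>R R l x - x"
  have V: "?u \<in> V" "?y \<in> V" using assms by auto
  let ?b = "\<lambda>h. N ((1 / h) *\<^sub>R (T h ?u - ?u) - ?y) + \<bar>(1 - exp (- l * h)) / h - l\<bar> * N ?u
       + \<bar>(1 - exp (- l * h)) / h\<bar> * N (T h ?u - ?u)"
  show ?thesis
  proof (rule tendsto_sandwich[of "\<lambda>_. 0" _ _ ?b])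
    have "((\<lambda>h::real. (1 - exp (- l * h)) / h) \<longlongrightarrow> l) (at 0)"
    proof -
      have "((\<lambda>h. 1 - exp (- l * h)) has_real_derivative l) (at 0)"
        by (auto intro!: derivative_eq_intros)
      then show ?thesis by (simp add: has_field_derivative_iff)
    qed
    then have e: "((\<lambda>h::real. (1 - exp (- l * h)) / h) \<longlongrightarrow> l) (at_right 0)"
      by (rule filterlim_mono) (auto simp: at_le)
    have "(?b \<longlongrightarrow> 0 + \<bar>l - l\<bar> * N ?u + \<bar>l\<bar> * 0) (at_right 0)"
      by (intro tendsto_intros R_generator T_cont e V assms)
    then show "(?b \<longlongrightarrow> 0) (at_right 0)" by simp
    show "\<forall>\<^sub>F h in at_right 0. N ((1 / h) *\<^sub>R W l h x - x) \<le> ?b h"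
    proof (rule eventually_at_rightI[of 0 1])
      fix h :: real assume h: "h \<in> {0<..<1}"
      let ?c = "(1 - exp (- l * h)) / h"
      have inV: "(1 / h) *\<^sub>R (T h ?u - ?u) - ?y \<in> V" "(?c - l) *\<^sub>R ?u \<in> V" "?c *\<^sub>R (T h ?u - ?u) \<in> V"
        using V h by auto
      have "(1 / h) *\<^sub>R W l h x - x = ((?c - l) *\<^sub>R ?u + ?c *\<^sub>R (T h ?u - ?u)) - ((1 / h) *\<^sub>R (T h ?u - ?u) - ?y)"
      proof -
        have "(1 / h) *\<^sub>R (exp (- l * h) *\<^sub>R T h ?u) = (1 / h) *\<^sub>R T h ?u - ?c *\<^sub>R T h ?u"
          by (simp add: diff_divide_distrib scaleR_diff_left)
        then show ?thesis
          by (simp only: W_def scaleR_diff_right scaleR_diff_left) simp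
      qed
      also have "N \<dots> \<le> N ((?c - l) *\<^sub>R ?u) + N (?c *\<^sub>R (T h ?u - ?u)) + N ((1 / h) *\<^sub>R (T h ?u - ?u) - ?y)"
        using N_diff[OF V_closed(2)[OF inV(2,3)] inV(1)] N_add[OF inV(2,3)] by linarith
      also have "\<dots> = ?b h" using V h by (subst (1 2) N_scale) auto
      finally show "N ((1 / h) *\<^sub>R W l h x - x) \<le> ?b h" .
    qed simp
  qed (auto simp: N_nonneg)
qed

definition riemann :: "real \<Rightarrow> real \<Rightarrow> nat \<Rightarrow> 'v \<Rightarrow> 'v" where
  "riemann l t r x = (\<Sum>j<r. (t / r * exp (- l * (t / r) * j)) *\<^sub>R T (real j * (t / r)) x)"

lemma riemann_V: "0 \<le> t \<Longrightarrow> x \<in> V \<Longrightarrow> riemann l t r x \<in> V"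
  unfolding riemann_def by (intro V_closed T_V) auto

text \<open>The operator \<open>W l t\<close> is the integral of \<open>exp (- l s) T s\<close> over \<open>[0, t]\<close>: since the
  resolvent maps onto the domain of the generator, the Riemann sums are telescoping sums up to an error
  controlled by a single difference quotient.  This replaces integration throughout.\<close>
lemma riemann_tendsto:
  assumes "0 < l" "0 < t" "x \<in> V"
  shows "(\<lambda>r. N (riemann l t r x - W l t x)) \<longlonglongrightarrow> 0"
proof (rule tendsto_sandwich[of "\<lambda>_. 0" _ _ "\<lambda>r::nat. t * bnd t * N ((1 / (t / r)) *\<^sub>R W l (t / r) x - x)"])
  have "filterlim (\<lambda>r. t / real r) (at_right 0) sequentially"
    unfolding filterlim_at
  proof (intro conjI)
    show "\<forall>\<^sub>F r in sequentially. t / real r \<in> {0<..} \<and> t / real r \<noteq> 0"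
      using eventually_gt_at_top[of 0] by eventually_elim (use assms in auto)
    show "(\<lambda>r. t / real r) \<longlonglongrightarrow> 0"
      by (rule lim_const_over_n)
  qed
  from filterlim_compose[OF difference_quotient[OF assms(1,3)] this]
  show "(\<lambda>r. t * bnd t * N ((1 / (t / r)) *\<^sub>R W l (t / r) x - x)) \<longlonglongrightarrow> 0"
    by (rule tendsto_mult_right_zero)
  show "\<forall>\<^sub>F r in sequentially. N (riemann l t r x - W l t x) \<le> t * bnd t * N ((1 / (t / r)) *\<^sub>R W l (t / r) x - x)"
    using eventually_gt_at_top[of 0]
  proof eventually_elim
    case (elim r)
    define d where "d = t / r"
    have d: "0 < d" "real r * d = t" using elim assms by (auto simp: d_def)
    let ?D = "(1 / d) *\<^sub>R W l d x - x"
    let ?f = "\<lambda>j. (d * exp (- l * d * j)) *\<^sub>R T (real j * d) ?D"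
    have DV: "?D \<in> V" using assms d by auto
    have fV: "?f j \<in> V" for j using DV d assms by (intro V_closed T_V) auto
    have "riemann l t r x - W l t x =
       (\<Sum>j<r. (d * exp (- l * d * j)) *\<^sub>R T (real j * d) x) - (\<Sum>j<r. exp (- l * d * j) *\<^sub>R T (real j * d) (W l d x))"
    proof -
      have "W l t x = (\<Sum>j<r. exp (- l * d * j) *\<^sub>R T (real j * d) (W l d x))"
      proof -
        have "- l * d * real r = - l * t" unfolding d(2)[symmetric] by simp
        from sum_W[OF assms(1) less_imp_le[OF d(1)] assms(3), of r, unfolded this d(2)]
        show ?thesis by (simp only: W_def[of l t])
      qed
      then show ?thesis by (simp only: riemann_def d_def)
    qed
    also have "\<dots> = (\<Sum>j<r. - ?f j)"
      unfolding sum_subtractf[symmetric]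
    proof (rule sum.cong[OF refl])
      fix j
      have "T (real j * d) ?D = (1 / d) *\<^sub>R T (real j * d) (W l d x) - T (real j * d) x"
        using d by (simp add: T_simps)
      then show "(d * exp (- l * d * j)) *\<^sub>R T (real j * d) x - exp (- l * d * j) *\<^sub>R T (real j * d) (W l d x) = - ?f j"
        using d by (simp add: scaleR_diff_right)
    qed
    also have "\<dots> = - (\<Sum>j<r. ?f j)"
      by (rule sum_negf)
    finally have "N (riemann l t r x - W l t x) = N (\<Sum>j<r. ?f j)"
      using N_scale[of "\<Sum>j<r. ?f j" "-1"] fV by simp
    also have "\<dots> \<le> (\<Sum>j<r. N (?f j))" using fV by (intro N_sum)
    also have "\<dots> \<le> (\<Sum>j<r. d * (bnd t * N ?D))"
    proof (intro sum_mono)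
      fix j assume j: "j \<in> {..<r}"
      have jt: "0 \<le> real j * d" "real j * d \<le> t"
        using d mult_right_mono[of "real j" "real r" d] j by auto
      have "N (?f j) = d * exp (- l * d * j) * N (T (real j * d) ?D)"
        using d DV by (subst N_scale) auto
      also have "\<dots> \<le> d * 1 * (bnd t * N ?D)"
        using d assms by (intro mult_mono T_bound jt DV) (auto simp: N_nonneg)
      finally show "N (?f j) \<le> d * (bnd t * N ?D)" by simp
    qed
    also have "\<dots> = t * bnd t * N ?D" by (simp add: d(2)[symmetric])
    finally show ?case unfolding d_def .
  qed
qed (auto simp: N_nonneg)

end

section \<open>Eventually positive semigroups\<close>

lemma Holder_sum:
  fixes a b :: "'i \<Rightarrow> real"
  assumes pq: "1 < p" "1 < q" "1 / p + 1 / q = 1"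
    and a: "\<And>i. i \<in> I \<Longrightarrow> 0 \<le> a i" and b: "\<And>i. i \<in> I \<Longrightarrow> 0 \<le> b i"
  shows "(\<Sum>i\<in>I. a i * b i) \<le> (\<Sum>i\<in>I. a i powr p) powr (1 / p) * (\<Sum>i\<in>I. b i powr q) powr (1 / q)"
proof (cases "finite I")
  case fin: True
  let ?A = "\<Sum>i\<in>I. a i powr p" and ?B = "\<Sum>i\<in>I. b i powr q"
  show ?thesis
  proof (cases "?A = 0 \<or> ?B = 0")
    case True
    then have "(\<forall>i\<in>I. a i = 0) \<or> (\<forall>i\<in>I. b i = 0)"
      using sum_nonneg_eq_0_iff[OF fin, of "\<lambda>i. a i powr p"] sum_nonneg_eq_0_iff[OF fin, of "\<lambda>i. b i powr q"] by auto
    then have "(\<Sum>i\<in>I. a i * b i) = 0" by (intro sum.neutral) auto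
    then show ?thesis by simp
  next
    case False
    then have A: "0 < ?A" and B: "0 < ?B" by (auto simp: less_le intro!: sum_nonneg)
    let ?\<alpha> = "?A powr (1 / p)" and ?\<beta> = "?B powr (1 / q)"
    have \<alpha>: "0 < ?\<alpha>" "?\<alpha> powr p = ?A" and \<beta>: "0 < ?\<beta>" "?\<beta> powr q = ?B"
      using A B pq by (auto simp: powr_powr)
    have "(\<Sum>i\<in>I. a i * b i) / (?\<alpha> * ?\<beta>) = (\<Sum>i\<in>I. (a i / ?\<alpha>) * (b i / ?\<beta>))"
      by (simp add: sum_divide_distrib)
    also have "\<dots> \<le> (\<Sum>i\<in>I. (a i / ?\<alpha>) powr p / p + (b i / ?\<beta>) powr q / q)"
      using a b \<alpha> \<beta> pq by (intro sum_mono Youngs_inequality) auto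
    also have "\<dots> = (\<Sum>i\<in>I. a i powr p / ?A / p + b i powr q / ?B / q)"
      using a b \<alpha> \<beta> by (intro sum.cong) (simp_all add: powr_divide)
    also have "\<dots> = ?A / ?A / p + ?B / ?B / q"
      by (simp only: sum.distrib sum_divide_distrib)
    also have "\<dots> = 1" using A B pq by simp
    finally show ?thesis using \<alpha> \<beta> by (simp add: field_simps)
  qed
qed simp

lemma sum_dyadic:
  fixes f :: "nat \<Rightarrow> 'b::comm_monoid_add"
  shows "(\<Sum>k\<in>{m..<m * 2 ^ g}. f k) = (\<Sum>i<g. \<Sum>k\<in>{m * 2 ^ i..<m * 2 ^ Suc i}. f k)"
proof (induction g)
  case (Suc g)
  have "(\<Sum>k\<in>{m..<m * 2 ^ Suc g}. f k) = (\<Sum>k\<in>{m..<m * 2 ^ g}. f k) + (\<Sum>k\<in>{m * 2 ^ g..<m * 2 ^ Suc g}. f k)"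
    by (intro sum.atLeastLessThan_concat[symmetric] mult_le_mono2) auto
  then show ?case using Suc by simp
qed simp

text \<open>The last two axioms describe the pointwise \<open>\<ell>\<^sup>p\<close> norm of a
  finite family through order and norm alone: it dominates all combinations with nonnegative
  coefficients in the unit ball of \<open>\<ell>\<^sup>q\<close>, and whatever dominates all of them
  is at least as large in norm. Positive linear operators preserve such domination. The index type
  is \<open>int\<close> because the families are translated in time in both directions.\<close>

locale lattice_semigroup = resolvent_semigroup V N T R M C
  for V :: "'v::real_vector set" and N :: "'v \<Rightarrow> real" and T R :: "real \<Rightarrow> 'v \<Rightarrow> 'v" and M C :: real +
  fixes K :: "'v set" and \<tau> p q :: real
  assumes K_V: "x \<in> K \<Longrightarrow> x \<in> V"
    and K_0: "0 \<in> K"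
    and K_add: "x \<in> K \<Longrightarrow> y \<in> K \<Longrightarrow> x + y \<in> K"
    and K_scale: "x \<in> K \<Longrightarrow> 0 \<le> c \<Longrightarrow> c *\<^sub>R x \<in> K"
    and K_closed: "(\<And>i. f i \<in> K) \<Longrightarrow> x \<in> V \<Longrightarrow> (\<lambda>i::nat. N (f i - x)) \<longlonglongrightarrow> 0 \<Longrightarrow> x \<in> K"
    and tau: "0 \<le> \<tau>"
    and T_positive: "\<tau> \<le> s \<Longrightarrow> x \<in> K \<Longrightarrow> T s x \<in> K"
    and pq: "1 < p" "1 / p + 1 / q = 1"
    and lattice_upper: "finite I \<Longrightarrow> (\<And>i::int. i \<in> I \<Longrightarrow> z i \<in> K) \<Longrightarrow>
       \<exists>F\<in>K. N F powr p \<le> (\<Sum>i\<in>I. N (z i) powr p) \<and>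
         (\<forall>c. (\<forall>i\<in>I. 0 \<le> c i) \<and> (\<Sum>i\<in>I. c i powr q) \<le> 1 \<longrightarrow> F - (\<Sum>i\<in>I. c i *\<^sub>R z i) \<in> K)"
    and lattice_lower: "finite J \<Longrightarrow> (\<And>j::int. j \<in> J \<Longrightarrow> g j \<in> K) \<Longrightarrow> G \<in> K \<Longrightarrow>
       (\<And>c. (\<And>j. j \<in> J \<Longrightarrow> 0 \<le> c j) \<Longrightarrow> (\<Sum>j\<in>J. c j powr q) \<le> 1 \<Longrightarrow> G - (\<Sum>j\<in>J. c j *\<^sub>R g j) \<in> K) \<Longrightarrow>
       (\<Sum>j\<in>J. N (g j) powr p) \<le> N G powr p"
begin

text \<open>The operators \<open>T s\<close> with \<open>s < \<tau>\<close> need not be positive, so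
  \<open>K\<close> is too small for resolvents and integrals. This cone is closed and invariant
  under \<open>T\<close>, \<open>W\<close> and \<open>R\<close>, and one shift by
  \<open>\<tau>\<close> returns to \<open>K\<close>.\<close>

definition E :: "'v set" where "E = {x \<in> V. \<forall>s\<ge>\<tau>. T s x \<in> K}"

lemma E_V: "x \<in> E \<Longrightarrow> x \<in> V"
  by (simp add: E_def)

lemma K_E: "x \<in> K \<Longrightarrow> x \<in> E"
  by (simp add: E_def K_V T_positive)

lemma E_T: "x \<in> E \<Longrightarrow> 0 \<le> s \<Longrightarrow> T s x \<in> E"
  using tau by (auto simp: E_def T_add[symmetric])

lemma T_tau_E: "x \<in> E \<Longrightarrow> T \<tau> x \<in> K"
  by (simp add: E_def)

lemma E_0: "0 \<in> E"
  using K_0 K_E by blast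

lemma E_add: "x \<in> E \<Longrightarrow> y \<in> E \<Longrightarrow> x + y \<in> E"
  using tau by (auto simp: E_def T_simps K_add)

lemma E_scale: "x \<in> E \<Longrightarrow> 0 \<le> c \<Longrightarrow> c *\<^sub>R x \<in> E"
  using tau by (auto simp: E_def T_simps K_scale)

lemma E_sum: "(\<And>i. i \<in> I \<Longrightarrow> f i \<in> E) \<Longrightarrow> sum f I \<in> E"
  by (induction I rule: infinite_finite_induct) (auto simp: E_0 E_add)

lemma K_sum: "(\<And>i. i \<in> I \<Longrightarrow> f i \<in> K) \<Longrightarrow> sum f I \<in> K"
  by (induction I rule: infinite_finite_induct) (auto simp: K_0 K_add)

lemma E_closed:
  assumes "\<And>i. f i \<in> E" "x \<in> V" "(\<lambda>i::nat. N (f i - x)) \<longlonglongrightarrow> 0"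
  shows "x \<in> E"
  unfolding E_def
proof (intro CollectI conjI allI impI)
  fix s assume s: "\<tau> \<le> s"
  show "T s x \<in> K"
  proof (rule K_closed)
    show "T s (f i) \<in> K" for i using assms(1)[of i] s by (simp add: E_def)
    show "T s x \<in> V" using assms(2) s tau by simp
    show "(\<lambda>i. N (T s (f i) - T s x)) \<longlonglongrightarrow> 0"
      using assms s tau by (intro T_tendsto) (auto simp: E_V)
  qed
qed fact

section \<open>Positivity of orbit integrals and of the resolvent at every real point\<close>

lemma E_riemann: "0 \<le> t \<Longrightarrow> x \<in> E \<Longrightarrow> riemann l t r x \<in> E"
  unfolding riemann_def by (intro E_sum E_scale E_T) auto

lemma E_W:
  assumes "0 < l" "0 < t" "x \<in> E"
  shows "W l t x \<in> E"
  using E_riemann[OF less_imp_le[OF assms(2)] assms(3)] W_V[OF assms(1) less_imp_le[OF assms(2)] E_V[OF assms(3)]]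
    riemann_tendsto[OF assms(1,2) E_V[OF assms(3)]]
  by (rule E_closed)

text \<open>A larger rate gives a smaller weight; the comparison is made term by term in the Riemann
  sums and passes to the limit in the closed cone. It serves to trade the rate 1 for the rate
  \<open>1 / n\<close>.\<close>

lemma E_W_antimono:
  assumes "0 < l" "l \<le> l'" "0 < t" "x \<in> E"
  shows "W l t x - W l' t x \<in> E"
proof (rule E_closed)
  show "riemann l t r x - riemann l' t r x \<in> E" for r
  proof -
    have "riemann l t r x - riemann l' t r x =
      (\<Sum>j<r. (t / r * exp (- l * (t / r) * j) - t / r * exp (- l' * (t / r) * j)) *\<^sub>R T (real j * (t / r)) x)"
      unfolding riemann_def sum_subtractf[symmetric] scaleR_diff_left ..
    also have "\<dots> \<in> E"
      using assms by (intro E_sum E_scale E_T) (auto intro!: mult_left_mono mult_right_mono divide_right_mono)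
    finally show ?thesis .
  qed
  show "W l t x - W l' t x \<in> V" using assms E_V by auto
  show "(\<lambda>r. N ((riemann l t r x - riemann l' t r x) - (W l t x - W l' t x))) \<longlonglongrightarrow> 0"
  proof (rule tendsto_sandwich[of "\<lambda>_. 0" _ _ "\<lambda>r. N (riemann l t r x - W l t x) + N (riemann l' t r x - W l' t x)"])
    have "(\<lambda>r. N (riemann l t r x - W l t x) + N (riemann l' t r x - W l' t x)) \<longlonglongrightarrow> 0 + 0"
      using assms E_V by (intro tendsto_add riemann_tendsto) auto
    then show "(\<lambda>r. N (riemann l t r x - W l t x) + N (riemann l' t r x - W l' t x)) \<longlonglongrightarrow> 0" by simp
    have "N ((riemann l t r x - riemann l' t r x) - (W l t x - W l' t x))
         \<le> N (riemann l t r x - W l t x) + N (riemann l' t r x - W l' t x)" for r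
    proof -
      have "(riemann l t r x - riemann l' t r x) - (W l t x - W l' t x)
         = (riemann l t r x - W l t x) - (riemann l' t r x - W l' t x)" by simp
      then show ?thesis
        using assms E_V riemann_V by (simp only:) (intro N_diff V_closed W_V; simp)
    qed
    then show "\<forall>\<^sub>F r in sequentially. N ((riemann l t r x - riemann l' t r x) - (W l t x - W l' t x))
         \<le> N (riemann l t r x - W l t x) + N (riemann l' t r x - W l' t x)"
      by simp
  qed (auto simp: N_nonneg)
qed

text \<open>Beyond \<open>ln M\<close> the weight \<open>exp (- l)\<close> beats the growth factor
  \<open>M\<close> per unit of time, so the resolvent is the limit of the integrals over growing
  intervals.\<close>

lemma E_R_large:
  assumes "ln M < l" "0 < l" "x \<in> E"
  shows "R l x \<in> E"
proof (rule E_closed)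
  show "W l (real (Suc n)) x \<in> E" for n using assms by (intro E_W) auto
  show "R l x \<in> V" using assms E_V by auto
  let ?b = "\<lambda>n. (exp (- l) * M) ^ Suc n * N (R l x)"
  show "(\<lambda>n. N (W l (real (Suc n)) x - R l x)) \<longlonglongrightarrow> 0"
  proof (rule tendsto_sandwich[of "\<lambda>_. 0" _ _ ?b])
    have "M < exp l" using assms(1) M_ge exp_less_mono[of "ln M" l] by simp
    then have "exp (- l) * M < exp (- l) * exp l" by (intro mult_strict_left_mono) auto
    then have "exp (- l) * M < 1" by (simp add: exp_minus)
    then have "(\<lambda>n. (exp (- l) * M) ^ Suc n) \<longlonglongrightarrow> 0"
      using M_ge by (intro LIMSEQ_Suc LIMSEQ_power_zero) auto
    then show "?b \<longlonglongrightarrow> 0" by (rule tendsto_mult_left_zero)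
    have "N (W l (real (Suc n)) x - R l x) \<le> ?b n" for n
    proof -
      let ?u = "R l x"
      have u: "?u \<in> V" using assms E_V by auto
      have "W l (real (Suc n)) x - ?u = (- exp (- l * real (Suc n))) *\<^sub>R T (real (Suc n)) ?u"
        by (simp add: W_def)
      also have "N \<dots> = exp (- l * real (Suc n)) * N (T (real (Suc n)) ?u)"
        using u by (subst N_scale) auto
      also have "\<dots> \<le> exp (- l * real (Suc n)) * (M ^ Suc n * N ?u)"
        using u by (intro mult_left_mono T_nat_bound) auto
      also have "exp (- l * real (Suc n)) = exp (- l) ^ Suc n"
        by (simp only: exp_of_nat_mult[symmetric] mult.commute)
      finally show ?thesis by (simp add: power_mult_distrib mult_ac)
    qed
    then show "\<forall>\<^sub>F n in sequentially. N (W l (real (Suc n)) x - R l x) \<le> ?b n" by simp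
  qed (auto simp: N_nonneg)
qed

text \<open>Neumann series: the resolvent identity expresses \<open>R l'\<close> for \<open>l' < l\<close> as a power series in \<open>R l\<close>
  with nonnegative coefficients.  The Kreiss condition makes its radius proportional to \<open>l\<close>, so that
  positivity propagates from large \<open>l\<close> down to every \<open>l > 0\<close>.\<close>
lemma E_R_step:
  assumes "0 < l'" "l' \<le> l" "(l - l') * C / l \<le> 1 / 2" and pos: "\<And>x. x \<in> E \<Longrightarrow> R l x \<in> E" and x: "x \<in> E"
  shows "R l' x \<in> E"
proof -
  \<comment> \<open>Partial sums of the Neumann series, produced as iterates of the affine map whose
    fixed point is \<open>R l' x\<close> by \<open>resolvent_identity\<close>. The assumed
    inequality makes this map a contraction with factor 1/2.\<close>
  define S where "S = rec_nat 0 (\<lambda>_ s. R l x + (l - l') *\<^sub>R R l s)"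
  have S: "S 0 = 0" "S (Suc n) = R l x + (l - l') *\<^sub>R R l (S n)" for n
    by (simp_all add: S_def)
  have l: "0 < l" using assms by simp
  have SE: "S n \<in> E" for n
    by (induction n) (simp_all add: S E_0 E_add E_scale pos x assms(2))
  have u: "R l' x \<in> V" using R_V[OF assms(1) E_V[OF x]] .
  have bound: "N (S n - R l' x) \<le> (1 / 2) ^ n * N (R l' x)" for n
  proof (induction n)
    case 0
    then show ?case using N_diff_commute[of 0 "R l' x"] u by (simp add: S)
  next
    case (Suc n)
    have d: "S n - R l' x \<in> V" using E_V[OF SE] u by (rule V_closed)
    have "S (Suc n) - R l' x = (l - l') *\<^sub>R R l (S n - R l' x)"
    proof -
      have "S (Suc n) - R l' x = (R l x + (l - l') *\<^sub>R R l (S n)) - (R l x + (l - l') *\<^sub>R R l (R l' x))"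
        by (simp only: S resolvent_identity[OF l assms(1) E_V[OF x], symmetric])
      then show ?thesis using l by (simp add: R_simps scaleR_diff_right)
    qed
    then have "N (S (Suc n) - R l' x) = (l - l') * N (R l (S n - R l' x))"
      using d l assms(2) by (simp add: N_scale)
    also have "\<dots> \<le> (l - l') * (C / l * N (S n - R l' x))"
      using d l assms(2) by (intro mult_left_mono R_bound) auto
    also have "\<dots> = ((l - l') * C / l) * N (S n - R l' x)" by simp
    also have "\<dots> \<le> (1 / 2) * ((1 / 2) ^ n * N (R l' x))"
      using assms(3) Suc.IH by (intro mult_mono) (auto simp: N_nonneg)
    finally show ?case by simp
  qed
  have "(\<lambda>n. (1 / 2) ^ n * N (R l' x)) \<longlonglongrightarrow> 0"
    by (intro tendsto_mult_left_zero LIMSEQ_power_zero) auto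
  then have "(\<lambda>n. N (S n - R l' x)) \<longlonglongrightarrow> 0"
    by (rule tendsto_sandwich[of "\<lambda>_. 0", rotated 3]) (auto simp: N_nonneg bound)
  then show ?thesis by (rule E_closed[OF SE u])
qed

lemma E_R:
  assumes "0 < l" "x \<in> E"
  shows "R l x \<in> E"
proof -
  \<comment> \<open>Descending from \<open>l / a\<close> to \<open>l\<close> has contraction factor
    \<open>(1 - a) * C\<close>, which this choice keeps below 1/2. As \<open>a\<close> depends on
    \<open>C\<close> only, finitely many descents from \<open>l0\<close> reach any positive
    \<open>l\<close>; the maximum with 1 keeps \<open>a\<close> positive.\<close>
  define a where "a = 1 - 1 / (2 * max C 1)"
  define l0 where "l0 = ln M + 1"
  have a: "0 < a" "a < 1" "(1 - a) * C \<le> 1 / 2"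
    using C_pos by (auto simp: a_def field_simps)
  have l0: "0 < l0" "ln M < l0" using M_ge by (auto simp: l0_def add_nonneg_pos)
  have "\<forall>l x. a ^ k * l0 \<le> l \<longrightarrow> x \<in> E \<longrightarrow> R l x \<in> E" for k
  proof (induction k)
    case 0
    then show ?case using l0 by (auto intro!: E_R_large)
  next
    case (Suc k)
    show ?case
    proof (intro allI impI)
      fix l x assume l: "a ^ Suc k * l0 \<le> l" and x: "x \<in> E"
      have "0 < a ^ Suc k * l0" using a l0 by simp
      then have lpos: "0 < l" using l by linarith
      have "(l / a - l) * C / (l / a) = (1 - a) * C" using a lpos by (simp add: field_simps)
      moreover have "a ^ k * l0 \<le> l / a" using l a by (simp add: field_simps)
      moreover have "l \<le> l / a" using a lpos by (simp add: field_simps)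
      ultimately show "R l x \<in> E"
        using a x Suc.IH lpos by (intro E_R_step[of l "l / a"]) auto
    qed
  qed
  moreover obtain k where "a ^ k < l / l0"
    using real_arch_pow_inv[of "l / l0" a] a l0 assms by auto
  then have "a ^ k * l0 \<le> l" using l0 by (simp add: field_simps)
  ultimately show ?thesis using assms by blast
qed

text \<open>One mesh cell of the orbit integral, moved to the \<open>k\<close>-th cell, with a
  further shift by \<open>\<tau>\<close> that makes the operator positive on \<open>K\<close>. The
  rate 1 is at least every rate \<open>1 / n\<close>, so the cell integral is dominated by the one
  inside \<open>R (1 / n)\<close>.\<close>

definition Q :: "real \<Rightarrow> nat \<Rightarrow> 'v \<Rightarrow> 'v" where
  "Q h k x = T (real k * h) (T \<tau> (W 1 h x))"

lemma Q_linear: "0 < h \<Longrightarrow> linear (Q h k)"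
  using tau by (intro linearI) (simp_all add: Q_def T_simps W_simps)

lemmas Q_simps = linear_add[OF Q_linear] linear_diff[OF Q_linear] linear_scale[OF Q_linear] linear_sum[OF Q_linear] linear_0[OF Q_linear]

lemma T_K: "x \<in> E \<Longrightarrow> 0 \<le> s \<Longrightarrow> T s (T \<tau> x) \<in> K"
  using tau by (simp add: T_commute[of s \<tau>] E_V T_tau_E E_T)

lemma Q_K: "0 < h \<Longrightarrow> x \<in> K \<Longrightarrow> Q h k x \<in> K"
  by (simp add: Q_def T_K E_W K_E)

lemma Q_V [simp]: "0 < h \<Longrightarrow> x \<in> V \<Longrightarrow> Q h k x \<in> V"
  using tau by (simp add: Q_def)

section \<open>From the Kreiss bound to discrete convolutions\<close>

definition c1 :: real where "c1 = exp 1 * bnd \<tau> * C"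

lemma c1_pos: "0 < c1"
  using C_pos bnd_ge1[of \<tau>] by (simp add: c1_def)

text \<open>As long as \<open>k h \<le> n\<close>, the resolvent weight
  \<open>exp (- k h / n)\<close> is at least \<open>exp (- 1)\<close>. Hence
  \<open>exp 1 *\<^sub>R R (1 / n) F\<close> dominates the unweighted sum, and the Kreiss bound at
  \<open>1 / n\<close> for its shift by \<open>\<tau>\<close> yields the constant
  \<open>c1\<close>.\<close>

lemma sum_Q_dominated:
  assumes h: "0 < h" and n: "1 \<le> n" and L: "real L * h \<le> n" and F: "F \<in> K"
  obtains G where "G \<in> K" "G - (\<Sum>k<L. Q h k F) \<in> K" "N G \<le> c1 * n * N F"
proof
  define l where "l = 1 / n"
  have l: "0 < l" "l \<le> 1" using n by (auto simp: l_def)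
  have FV: "F \<in> V" "F \<in> E" using F K_V K_E by auto
  let ?G = "exp 1 *\<^sub>R T \<tau> (R l F)"
  show "?G \<in> K" using l FV by (intro K_scale T_tau_E E_R) auto
  \<comment> \<open>The excess of the resolvent over the sum, written so that each piece lies in
    \<open>E\<close>: on every cell the surplus of the weight over 1 and of the rate
    \<open>l\<close> over the rate 1, and in \<open>?D\<close> the tail of the integral beyond
    \<open>L h\<close> as well.\<close>
  let ?f = "\<lambda>k. (exp 1 * exp (- l * h * real k) - 1) *\<^sub>R W l h F + (W l h F - W 1 h F)"
  let ?D = "(exp 1 * exp (- l * h * real L)) *\<^sub>R T (real L * h) (R l F) + (\<Sum>k<L. T (real k * h) (?f k))"
  have "?D \<in> E"
  proof (intro E_add E_scale E_sum E_T E_R E_W E_W_antimono)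
    fix k assume "k \<in> {..<L}"
    then have "real k * h \<le> real L * h" using h by (intro mult_right_mono) auto
    then have "real k * h \<le> n" using L by linarith
    then have "l * h * real k \<le> 1" using n by (simp add: l_def field_simps)
    then show "0 \<le> exp 1 * exp (- l * h * real k) - 1" by (simp flip: exp_add)
  qed (use l h FV in auto)
  have "(\<Sum>k<L. T (real k * h) (?f k)) =
      exp 1 *\<^sub>R (\<Sum>k<L. exp (- l * h * real k) *\<^sub>R T (real k * h) (W l h F)) - (\<Sum>k<L. T (real k * h) (W 1 h F))"
    unfolding scaleR_sum_right sum_subtractf[symmetric]
    using h by (intro sum.cong) (simp_all add: T_simps algebra_simps)
  also have "\<dots> = exp 1 *\<^sub>R R l F - (exp 1 * exp (- l * h * real L)) *\<^sub>R T (real L * h) (R l F)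
       - (\<Sum>k<L. T (real k * h) (W 1 h F))"
    using sum_W[of l h F L] l h FV by (simp add: scaleR_diff_right)
  finally have D: "?D = exp 1 *\<^sub>R R l F - (\<Sum>k<L. T (real k * h) (W 1 h F))" by simp
  have "T \<tau> ?D = ?G - (\<Sum>k<L. Q h k F)"
    unfolding D Q_def using tau h FV by (simp add: T_simps T_commute[of \<tau>])
  then show "?G - (\<Sum>k<L. Q h k F) \<in> K" using T_tau_E[OF \<open>?D \<in> E\<close>] by simp
  have "N ?G = exp 1 * N (T \<tau> (R l F))" using l tau FV by (subst N_scale) auto
  also have "\<dots> \<le> exp 1 * (bnd \<tau> * (C / l * N F))"
    using l tau FV bnd_ge1[of \<tau>]
    by (intro mult_left_mono order_trans[OF T_bound[of \<tau> \<tau>]] R_bound) (auto simp: N_nonneg)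
  also have "\<dots> = c1 * n * N F" by (simp add: c1_def l_def)
  finally show "N ?G \<le> c1 * n * N F" .
qed

text \<open>A positive operator extends to \<open>\<ell>\<^sup>p\<close>-valued functions with the same norm.  Here this is applied to the
  convolution with \<open>Q\<close> in the discrete time variable.\<close>
lemma convolution_bound:
  fixes z :: "int \<Rightarrow> 'v" and \<sigma> :: int
  assumes h: "0 < h" and n: "1 \<le> n" and L: "real L * h \<le> n" and J: "finite J" and I: "finite I"
    and zI: "\<And>k. k \<in> I \<Longrightarrow> z k \<in> K" and z0: "\<And>k. k \<notin> I \<Longrightarrow> z k = 0"
  shows "(\<Sum>j\<in>J. N (\<Sum>l<L. Q h l (z (j + \<sigma> * int l))) powr p) \<le> (c1 * n) powr p * (\<Sum>k\<in>I. N (z k) powr p)"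
proof -
  obtain F where F: "F \<in> K" "N F powr p \<le> (\<Sum>i\<in>I. N (z i) powr p)"
    and Fc: "\<And>c. (\<And>i. i \<in> I \<Longrightarrow> 0 \<le> c i) \<Longrightarrow> (\<Sum>i\<in>I. c i powr q) \<le> 1 \<Longrightarrow> F - (\<Sum>i\<in>I. c i *\<^sub>R z i) \<in> K"
    using lattice_upper[of I z, OF I zI] by blast
  obtain G where G: "G \<in> K" "G - (\<Sum>k<L. Q h k F) \<in> K" "N G \<le> c1 * n * N F"
    using sum_Q_dominated[OF h n L F(1)] .
  have z: "z k \<in> K" for k using zI z0 K_0 by (cases "k \<in> I") auto
  let ?g = "\<lambda>j. \<Sum>l<L. Q h l (z (j + \<sigma> * int l))"
  have "(\<Sum>j\<in>J. N (?g j) powr p) \<le> N G powr p"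
  proof (rule lattice_lower[OF J _ G(1)])
    show "?g j \<in> K" for j using h z by (intro K_sum Q_K)
    fix c :: "int \<Rightarrow> real" assume c: "\<And>j. j \<in> J \<Longrightarrow> 0 \<le> c j" "(\<Sum>j\<in>J. c j powr q) \<le> 1"
    let ?s = "\<lambda>l. \<Sum>j\<in>J. c j *\<^sub>R z (j + \<sigma> * int l)"
    \<comment> \<open>Translation merely relabels the coefficients, so their
      \<open>\<ell>\<^sup>q\<close> norm does not grow and \<open>F\<close> dominates the translated
      combination too. Coefficients that land outside \<open>I\<close> are dropped, since
      \<open>z\<close> vanishes there.\<close>
    have s: "F - ?s l \<in> K" for l
    proof -
      define d where "d = \<sigma> * int l"
      define c' where "c' k = (if k - d \<in> J then c (k - d) else 0)" for k
      have bij: "bij_betw (\<lambda>j. j + d) J ((\<lambda>j. j + d) ` J)"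
        by (intro bij_betw_imageI inj_onI) auto
      have mem: "k \<in> (\<lambda>j. j + d) ` J \<longleftrightarrow> k - d \<in> J" for k
        by (auto simp: image_iff intro: bexI[of _ "k - d"])
      have "?s l = (\<Sum>k\<in>(\<lambda>j. j + d) ` J. c' k *\<^sub>R z k)"
        unfolding sum.reindex_bij_betw[OF bij, symmetric] by (simp add: c'_def d_def)
      also have "\<dots> = (\<Sum>k\<in>I. c' k *\<^sub>R z k)"
        using I J by (intro sum.mono_neutral_cong) (auto simp: z0 c'_def mem)
      finally have "?s l = (\<Sum>k\<in>I. c' k *\<^sub>R z k)" .
      moreover have "(\<Sum>k\<in>I. c' k powr q) \<le> 1"
      proof -
        have "(\<Sum>k\<in>I. c' k powr q) = (\<Sum>k\<in>I \<inter> (\<lambda>j. j + d) ` J. c' k powr q)"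
          using I by (intro sum.mono_neutral_right) (auto simp: c'_def mem)
        also have "\<dots> \<le> (\<Sum>k\<in>(\<lambda>j. j + d) ` J. c' k powr q)"
          using J by (intro sum_mono2) auto
        also have "\<dots> = (\<Sum>j\<in>J. c j powr q)"
          unfolding sum.reindex_bij_betw[OF bij, symmetric] by (simp add: c'_def)
        finally show ?thesis using c(2) by linarith
      qed
      ultimately show ?thesis using Fc[of c'] c(1) by (simp add: c'_def)
    qed
    have "(\<Sum>j\<in>J. c j *\<^sub>R ?g j) = (\<Sum>l<L. Q h l (?s l))"
      using h by (simp add: Q_simps scaleR_sum_right sum.swap[of _ J])
    \<comment> \<open>After interchanging the sums the coefficients sit inside \<open>Q h l\<close>,
      where \<open>F\<close> dominates for every \<open>l\<close> separately. Positivity of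
      \<open>Q h l\<close> carries this over to the images, and \<open>G\<close> dominates the
      images of \<open>F\<close>.\<close>
    then have "G - (\<Sum>j\<in>J. c j *\<^sub>R ?g j) = (G - (\<Sum>k<L. Q h k F)) + (\<Sum>l<L. Q h l (F - ?s l))"
      using h by (simp add: Q_simps(2) sum_subtractf)
    also have "\<dots> \<in> K" using G s h by (intro K_add K_sum Q_K)
    finally show "G - (\<Sum>j\<in>J. c j *\<^sub>R ?g j) \<in> K" .
  qed
  also have "\<dots> \<le> (c1 * n * N F) powr p" using G pq by (intro powr_mono2) (auto simp: N_nonneg)
  also have "\<dots> = (c1 * n) powr p * N F powr p" by (rule powr_mult)
  also have "\<dots> \<le> (c1 * n) powr p * (\<Sum>k\<in>I. N (z k) powr p)" using F by (intro mult_left_mono) auto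
  finally show ?thesis .
qed

section \<open>Averaged orbit values as convolutions, and the two basic estimates\<close>

lemma q_gt1: "1 < q"
proof -
  have "1 / q = 1 - 1 / p" "1 / p < 1" "0 < 1 / p" using pq by (auto simp: field_simps)
  then have "0 < 1 / q" "1 / q < 1" by linarith+
  then show ?thesis by (simp add: divide_less_eq split: if_splits)
qed

lemma p_div_q: "p / q = p - 1"
proof -
  have "1 / q = 1 - 1 / p" using pq by simp
  then have "p * (1 / q) = p * (1 - 1 / p)" by simp
  then show ?thesis using pq by (simp add: right_diff_distrib)
qed

text \<open>The scaled integral is an average over one cell and tends to the identity as
  \<open>m\<close> grows. The shift supplies what \<open>B_eq_sum\<close> spends: a unit of time to
  be split in \<open>m\<close> ways, one \<open>\<tau>\<close> for the positivity of
  \<open>Q\<close>, and one \<open>\<tau>\<close> so that the remaining factor maps \<open>K\<close>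
  into \<open>K\<close>.\<close>

definition B :: "nat \<Rightarrow> 'v \<Rightarrow> 'v" where
  "B m x = T (1 + 2 * \<tau>) (real m *\<^sub>R W 1 (1 / real m) x)"

lemma B_linear: "1 \<le> m \<Longrightarrow> linear (B m)"
  using tau by (intro linearI) (simp_all add: B_def T_simps W_simps algebra_simps)

lemma B_V [simp]: "1 \<le> m \<Longrightarrow> x \<in> V \<Longrightarrow> B m x \<in> V"
  using tau by (auto simp: B_def)

lemma T_B_commute: "1 \<le> m \<Longrightarrow> 0 \<le> s \<Longrightarrow> x \<in> V \<Longrightarrow> T s (B m x) = B m (T s x)"
  using tau by (simp add: B_def T_commute[of s] T_simps T_W_commute)

lemma B_T_K: "1 \<le> m \<Longrightarrow> x \<in> K \<Longrightarrow> 0 \<le> s \<Longrightarrow> T s (B m x) \<in> K"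
proof -
  assume m: "1 \<le> m" and x: "x \<in> K" and s: "0 \<le> s"
  have E: "real m *\<^sub>R W 1 (1 / real m) x \<in> E" using m x by (intro E_scale E_W K_E) auto
  have "T s (B m x) = T (s + (1 + 2 * \<tau>)) (real m *\<^sub>R W 1 (1 / real m) x)"
    unfolding B_def using s tau E_V[OF E] by (intro T_add[symmetric]) auto
  moreover have "\<tau> \<le> s + (1 + 2 * \<tau>)" using tau s by simp
  ultimately show ?thesis using E unfolding E_def by auto
qed

lemma T_add4:
  "0 \<le> a \<Longrightarrow> 0 \<le> b \<Longrightarrow> x \<in> V \<Longrightarrow> T (a + (\<tau> + (b + \<tau>))) x = T a (T \<tau> (T b (T \<tau> x)))"
  using tau by (simp only: T_add T_V add_nonneg_nonneg)

lemma T_tau_Q: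
  assumes "1 \<le> m" "x \<in> V" "i < m"
  shows "T (real (m - i) * (1 / m)) (T \<tau> (Q (1 / m) (k + i) x)) = T (real k * (1 / m) + (1 + 2 * \<tau>)) (W 1 (1 / m) x)"
proof -
  have eq: "real (m - i) * (1 / m) + (\<tau> + (real (k + i) * (1 / m) + \<tau>)) = real k * (1 / m) + (1 + 2 * \<tau>)"
    using assms by (simp add: of_nat_diff field_simps)
  show ?thesis
    unfolding eq[symmetric] Q_def using assms tau by (intro T_add4[symmetric]) auto
qed

lemma Q_T_commute:
  "0 < h \<Longrightarrow> 0 \<le> s \<Longrightarrow> x \<in> V \<Longrightarrow> T s (Q h k x) = Q h k (T s x)"
  using tau by (simp add: Q_def T_commute[of s] T_W_commute)

text \<open>The factor \<open>real m\<close> in \<open>B\<close> is read as \<open>m\<close> equal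
  summands, in each of which the unit of time is divided differently between \<open>Q\<close> and
  the outer operator. A pointwise orbit value thus becomes a convolution, accessible to
  \<open>convolution_bound\<close>.\<close>

lemma B_eq_sum:
  assumes "1 \<le> m" "x \<in> V"
  shows "T (real k * (1 / m)) (B m x) = (\<Sum>i<m. T (real (m - i) * (1 / m)) (T \<tau> (Q (1 / m) (k + i) x)))"
proof -
  have "T (real k * (1 / m)) (B m x) = real m *\<^sub>R T (real k * (1 / m) + (1 + 2 * \<tau>)) (W 1 (1 / m) x)"
    using assms tau by (simp add: B_def T_simps T_add)
  also have "\<dots> = (\<Sum>i<m. T (real k * (1 / m) + (1 + 2 * \<tau>)) (W 1 (1 / m) x))"
    by (simp add: scaleR_conv_of_real sum_constant_scaleR)
  also have "\<dots> = (\<Sum>i<m. T (real (m - i) * (1 / m)) (T \<tau> (Q (1 / m) (k + i) x)))"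
    using assms by (intro sum.cong refl) (simp only: T_tau_Q lessThan_iff)
  finally show ?thesis .
qed

lemma B_eq_sum':
  assumes "1 \<le> m" "x \<in> V"
  shows "T (real k * (1 / m)) (B m x) = (\<Sum>i<m. Q (1 / m) (k + i) (T (real (m - i) * (1 / m)) (T \<tau> x)))"
proof -
  have "0 < 1 / real m" using assms by simp
  then show ?thesis
    unfolding B_eq_sum[OF assms] using assms tau
    by (intro sum.cong refl) (simp only: Q_T_commute T_V divide_nonneg_nonneg mult_nonneg_nonneg of_nat_0_le_iff less_imp_le)
qed

text \<open>The 2 absorbs \<open>n + 1 \<le> 2 * n\<close>, because the convolution window exceeds
  \<open>n\<close> by one unit of time; \<open>bnd (1 + \<tau>)\<close> is the cost of the outer
  shifts in \<open>T_step_bound\<close>.\<close>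

definition c2 :: real where "c2 = 2 * c1 * bnd (1 + \<tau>)"

lemma c2_pos: "0 < c2"
  using c1_pos bnd_ge1[of "1 + \<tau>"] by (simp add: c2_def)

lemma T_step_bound:
  assumes "1 \<le> m" "x \<in> V" "i \<le> m"
  shows "N (T (real i * (1 / m)) (T \<tau> x)) \<le> bnd (1 + \<tau>) * N x"
proof -
  have "real i * (1 / m) \<le> 1" "0 \<le> real i * (1 / m)" using assms by (auto simp: field_simps)
  then show ?thesis
    using T_bound[of "real i * (1 / m) + \<tau>" "1 + \<tau>" x] tau assms by (simp add: T_add)
qed

text \<open>By \<open>B_eq_sum'\<close> the orbit is a convolution of \<open>Q\<close> with a pulse
  of \<open>m\<close> vectors, each of norm at most \<open>bnd (1 + \<tau>) * N x\<close>; this is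
  \<open>convolution_bound\<close> with \<open>\<sigma> = -1\<close>, and the length of the pulse
  gives the factor \<open>m\<close>.\<close>

lemma orbit_bound:
  assumes m: "1 \<le> m" and n: "1 \<le> n" and x: "x \<in> K"
  shows "(\<Sum>k<m * n. N (T (real k * (1 / m)) (B m x)) powr p) \<le> m * (c2 * n * N x) powr p"
proof -
  have xV: "x \<in> V" and h: "0 < 1 / real m" using x K_V m by auto
  define y where "y i = T (real (m - i) * (1 / m)) (T \<tau> x)" for i
  have y: "y i \<in> K" for i unfolding y_def using x by (intro T_K K_E) auto
  \<comment> \<open>The pulse sits at the indices \<open>- i\<close>, so that
    \<open>int k - int l = - int i\<close> selects \<open>l = k + i\<close>. These \<open>l\<close>
    stay below \<open>m * n + m\<close>, whence the window \<open>L\<close>.\<close>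
  define z where "z k = (if k \<in> (\<lambda>i. - int i) ` {..<m} then y (nat (- k)) else 0)" for k
  define L where "L = m * (n + 1)"
  have *: "(\<Sum>l<L. Q (1 / m) l (z (int k + (- 1) * int l))) = T (real k * (1 / m)) (B m x)" if "k < m * n" for k
  proof -
    have z: "z (int k + (- 1) * int l) = (if l \<in> {k..<k + m} then y (l - k) else 0)" for l
      by (auto simp: z_def image_iff nat_diff_distrib of_nat_diff intro: bexI[of _ "l - k"] dest!: bspec[of _ _ "l - k"])
    have "(\<Sum>l<L. Q (1 / m) l (z (int k + (- 1) * int l))) = (\<Sum>l\<in>{k..<k + m}. Q (1 / m) l (y (l - k)))"
      unfolding z using that h by (intro sum.mono_neutral_cong_right) (auto simp: L_def Q_simps)
    also have "\<dots> = (\<Sum>i<m. Q (1 / m) (k + i) (y i))"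
      by (rule sum.reindex_bij_witness[of _ "\<lambda>i. k + i" "\<lambda>l. l - k"]) auto
    finally show ?thesis unfolding B_eq_sum'[OF m xV] y_def .
  qed
  have "(\<Sum>k<m * n. N (T (real k * (1 / m)) (B m x)) powr p) =
     (\<Sum>j\<in>int ` {..<m * n}. N (\<Sum>l<L. Q (1 / m) l (z (j + (- 1) * int l))) powr p)"
    by (subst sum.reindex, simp) (rule sum.cong, simp_all only: * o_def lessThan_iff)
  also have "\<dots> \<le> (c1 * real (n + 1)) powr p * (\<Sum>k\<in>(\<lambda>i. - int i) ` {..<m}. N (z k) powr p)"
    using m by (intro convolution_bound) (auto simp: L_def z_def y field_simps)
  also have "(\<Sum>k\<in>(\<lambda>i. - int i) ` {..<m}. N (z k) powr p) = (\<Sum>i<m. N (y i) powr p)"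
    by (subst sum.reindex) (auto simp: z_def inj_on_def intro!: sum.cong)
  also have "(\<Sum>i<m. N (y i) powr p) \<le> (\<Sum>i<m. (bnd (1 + \<tau>) * N x) powr p)"
    using m xV pq unfolding y_def by (intro sum_mono powr_mono2 T_step_bound) (auto simp: N_nonneg)
  also have "\<dots> = m * (bnd (1 + \<tau>) * N x) powr p" by simp
  also have "(c1 * real (n + 1)) powr p * (m * (bnd (1 + \<tau>) * N x) powr p)
     = m * (c1 * real (n + 1) * (bnd (1 + \<tau>) * N x)) powr p"
    by (simp only: powr_mult mult_ac)
  also have "\<dots> \<le> m * (c2 * n * N x) powr p"
  proof (intro mult_left_mono powr_mono2)
    have "c1 * real (n + 1) \<le> c1 * (2 * n)" using c1_pos n by simp
    then have "c1 * real (n + 1) * (bnd (1 + \<tau>) * N x) \<le> c1 * (2 * n) * (bnd (1 + \<tau>) * N x)"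
      using bnd_ge1[of "1 + \<tau>"] by (intro mult_right_mono) (auto simp: N_nonneg)
    then show "c1 * real (n + 1) * (bnd (1 + \<tau>) * N x) \<le> c2 * n * N x"
      by (simp add: c2_def mult_ac)
  qed (use pq c1_pos bnd_ge1[of "1 + \<tau>"] in \<open>auto simp: N_nonneg\<close>)
  finally show ?thesis by (simp add: mult_left_mono mult_right_mono)
qed

text \<open>The transposed use of \<open>convolution_bound\<close>, with
  \<open>\<sigma> = 1\<close>: the input is the long family \<open>z\<close>, the output the
  \<open>m\<close> vectors \<open>g i\<close>, one for each way of splitting the unit of time.
  Adding them up by the Holder inequality against the constant 1 costs
  \<open>m powr (1 / q)\<close>.\<close>

lemma sum_orbit_bound:
  assumes m: "1 \<le> m" and n: "1 \<le> n" and z: "\<And>k. k < m * n \<Longrightarrow> z k \<in> K"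
  shows "N (\<Sum>k<m * n. T (real k * (1 / m)) (B m (z k))) \<le> c2 * n * m powr (1 / q) * (\<Sum>k<m * n. N (z k) powr p) powr (1 / p)"
proof -
  have zV: "z k \<in> V" if "k < m * n" for k using z K_V that by blast
  have h: "0 < 1 / real m" using m by auto
  define Z where "Z k = (if k \<in> int ` {..<m * n} then z (nat k) else 0)" for k
  define L where "L = m * (n + 1)"
  define g where "g i = (\<Sum>k<m * n. Q (1 / m) (k + i) (z k))" for i
  have *: "(\<Sum>l<L. Q (1 / m) l (Z (- int i + 1 * int l))) = g i" if "i < m" for i
  proof -
    have Z: "Z (- int i + 1 * int l) = (if l \<in> {i..<i + m * n} then z (l - i) else 0)" for l
      by (auto simp: Z_def image_iff nat_diff_distrib of_nat_diff intro: bexI[of _ "l - i"] dest!: bspec[of _ _ "l - i"])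
    have "(\<Sum>l<L. Q (1 / m) l (Z (- int i + 1 * int l))) = (\<Sum>l\<in>{i..<i + m * n}. Q (1 / m) l (z (l - i)))"
      unfolding Z using that h by (intro sum.mono_neutral_cong_right) (auto simp: L_def Q_simps)
    also have "\<dots> = g i"
      unfolding g_def by (rule sum.reindex_bij_witness[of _ "\<lambda>k. k + i" "\<lambda>l. l - i"]) auto
    finally show ?thesis .
  qed
  have gV: "g i \<in> V" for i unfolding g_def using h zV by (intro V_closed Q_V) auto
  have "(\<Sum>i<m. N (g i) powr p) = (\<Sum>j\<in>(\<lambda>i. - int i) ` {..<m}. N (\<Sum>l<L. Q (1 / m) l (Z (j + 1 * int l))) powr p)"
    by (subst sum.reindex, simp add: inj_on_def) (rule sum.cong, simp_all only: * o_def lessThan_iff)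
  also have "\<dots> \<le> (c1 * real (n + 1)) powr p * (\<Sum>k\<in>int ` {..<m * n}. N (Z k) powr p)"
    using m z by (intro convolution_bound) (auto simp: L_def Z_def field_simps)
  also have "(\<Sum>k\<in>int ` {..<m * n}. N (Z k) powr p) = (\<Sum>k<m * n. N (z k) powr p)"
    by (subst sum.reindex) (auto simp: Z_def intro!: sum.cong)
  finally have g: "(\<Sum>i<m. N (g i) powr p) \<le> (c1 * real (n + 1)) powr p * (\<Sum>k<m * n. N (z k) powr p)" .
  have "(\<Sum>k<m * n. T (real k * (1 / m)) (B m (z k))) =
     (\<Sum>k<m * n. \<Sum>i<m. T (real (m - i) * (1 / m)) (T \<tau> (Q (1 / m) (k + i) (z k))))"
    using m zV by (intro sum.cong refl B_eq_sum) auto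
  also have "\<dots> = (\<Sum>i<m. T (real (m - i) * (1 / m)) (T \<tau> (g i)))"
    unfolding g_def using tau m by (subst sum.swap) (simp add: T_simps)
  also have "N \<dots> \<le> (\<Sum>i<m. N (T (real (m - i) * (1 / m)) (T \<tau> (g i))))"
    using gV tau by (intro N_sum) auto
  also have "\<dots> \<le> (\<Sum>i<m. bnd (1 + \<tau>) * N (g i))"
    using m gV by (intro sum_mono T_step_bound) auto
  also have "\<dots> = bnd (1 + \<tau>) * (\<Sum>i<m. N (g i) * 1)" by (simp add: sum_distrib_left)
  also have "\<dots> \<le> bnd (1 + \<tau>) * ((\<Sum>i<m. N (g i) powr p) powr (1 / p) * (\<Sum>i<m. 1 powr q) powr (1 / q))"
    using pq q_gt1 bnd_ge1[of "1 + \<tau>"] by (intro mult_left_mono Holder_sum) (auto simp: N_nonneg)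
  also have "\<dots> \<le> bnd (1 + \<tau>) * (((c1 * real (n + 1)) powr p * (\<Sum>k<m * n. N (z k) powr p)) powr (1 / p) * m powr (1 / q))"
    using pq q_gt1 bnd_ge1[of "1 + \<tau>"] g by (intro mult_left_mono mult_mono powr_mono2) (auto intro: sum_nonneg)
  also have "\<dots> = (bnd (1 + \<tau>) * m powr (1 / q) * (\<Sum>k<m * n. N (z k) powr p) powr (1 / p)) * (c1 * real (n + 1))"
    using pq c1_pos by (simp add: powr_mult powr_powr)
  also have "\<dots> \<le> (bnd (1 + \<tau>) * m powr (1 / q) * (\<Sum>k<m * n. N (z k) powr p) powr (1 / p)) * (c1 * (2 * n))"
    using bnd_ge1[of "1 + \<tau>"] n c1_pos by (intro mult_left_mono) auto
  finally show ?thesis by (simp add: c2_def mult_ac)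
qed

section \<open>Dyadic blocks and the two growth rates\<close>

lemma sum_orbit_reversed:
  assumes m: "1 \<le> m" and x: "x \<in> K"
  shows "(\<Sum>k\<in>{1..m * n}. N (T (real (m * n - k) * (1 / m)) (B m x)) powr p) =
     (\<Sum>k<m * n. N (T (real k * (1 / m)) (B m x)) powr p)"
  by (rule sum.reindex_bij_witness[of _ "\<lambda>k. m * n - k" "\<lambda>k. m * n - k"]) auto

lemma T_B_reversed:
  assumes m: "1 \<le> m" and x: "x \<in> K" and k: "k \<le> m * n"
  shows "T (real k * (1 / m)) (B m (T (real (m * n - k) * (1 / m)) (B m x))) = T (real n) (B m (B m x))"
proof -
  have V: "x \<in> V" using x K_V by auto
  have eq: "real k * (1 / m) + real (m * n - k) * (1 / m) = n"
    using m k by (simp add: of_nat_diff field_simps)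
  have "T (real k * (1 / m)) (B m (T (real (m * n - k) * (1 / m)) (B m x)))
    = T (real k * (1 / m)) (T (real (m * n - k) * (1 / m)) (B m (B m x)))"
    using m V by (subst T_B_commute) auto
  also have "\<dots> = T (real k * (1 / m) + real (m * n - k) * (1 / m)) (B m (B m x))"
    using m V by (intro T_add[symmetric]) auto
  finally show ?thesis unfolding eq .
qed

text \<open>Each of the \<open>m * 2 ^ i\<close> terms of the block equals the vector to be
  estimated, while \<open>sum_orbit_bound\<close> is used up to time \<open>2 ^ Suc i\<close>. The
  powers of two cancel up to a factor 2, so all blocks give bounds of the same strength.\<close>

lemma dyadic_block_bound:
  assumes m: "1 \<le> m" and x: "x \<in> K" and i: "2 ^ Suc i \<le> n"
  shows "m * N (T (real n) (B m (B m x))) powr p \<le> (2 * c2) powr p *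
     (\<Sum>k\<in>{m * 2 ^ i..<m * 2 ^ Suc i}. N (T (real (m * n - k) * (1 / m)) (B m x)) powr p)"
proof -
  let ?th = "N (T (real n) (B m (B m x)))"
  let ?I = "{m * 2 ^ i..<m * 2 ^ Suc i}"
  define y where "y k = T (real (m * n - k) * (1 / m)) (B m x)" for k
  define z where "z k = (if k \<in> ?I then y k else 0)" for k
  define S where "S = (\<Sum>k\<in>?I. N (y k) powr p)"
  have V: "x \<in> V" using x K_V by auto
  have thV: "T (real n) (B m (B m x)) \<in> V" using m V by auto
  have S0: "0 \<le> S" unfolding S_def by (intro sum_nonneg) auto
  have yK: "y k \<in> K" for k unfolding y_def using m x by (intro B_T_K) auto
  have In: "k \<le> m * n" if "k \<in> ?I" for k
  proof -
    have "m * 2 ^ Suc i \<le> m * n" using i by (intro mult_le_mono2)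
    moreover have "k < m * 2 ^ Suc i" using that by (simp only: atLeastLessThan_iff)
    ultimately show ?thesis by linarith
  qed
  have sub: "?I \<subseteq> {..<m * 2 ^ Suc i}" by auto
  have Bm0: "T (real k * (1 / m)) (B m 0) = 0" for k
    using m linear_0[OF B_linear[OF m]] linear_0[OF T_linear] by simp
  have "(\<Sum>k<m * 2 ^ Suc i. T (real k * (1 / m)) (B m (z k))) = (\<Sum>k\<in>?I. T (real k * (1 / m)) (B m (y k)))"
    using sub Bm0 by (intro sum.mono_neutral_cong_right) (auto simp: z_def)
  also have "\<dots> = (\<Sum>k\<in>?I. T (real n) (B m (B m x)))"
    using In unfolding y_def by (intro sum.cong refl T_B_reversed m x) auto
  also have "\<dots> = real (m * 2 ^ i) *\<^sub>R T (real n) (B m (B m x))"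
    by (simp add: sum_constant_scaleR)
  finally have "m * 2 ^ i * ?th = N (\<Sum>k<m * 2 ^ Suc i. T (real k * (1 / m)) (B m (z k)))"
    using thV by (simp add: N_scale)
  also have "\<dots> \<le> c2 * real (2 ^ Suc i) * m powr (1 / q) * (\<Sum>k<m * 2 ^ Suc i. N (z k) powr p) powr (1 / p)"
    using m yK K_0 by (intro sum_orbit_bound) (auto simp: z_def)
  also have "(\<Sum>k<m * 2 ^ Suc i. N (z k) powr p) = S"
    unfolding S_def using sub by (intro sum.mono_neutral_cong_right) (auto simp: z_def)
  finally have "2 ^ i * (m * ?th) \<le> 2 ^ i * (2 * c2 * m powr (1 / q) * S powr (1 / p))"
    by (simp add: mult_ac)
  then have "m * ?th \<le> 2 * c2 * m powr (1 / q) * S powr (1 / p)" by simp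
  then have "(m * ?th) powr p \<le> (2 * c2 * m powr (1 / q) * S powr (1 / p)) powr p"
    using pq by (intro powr_mono2) (auto simp: N_nonneg)
  \<comment> \<open>Since \<open>p / q = p - 1\<close>, the Holder factor
    \<open>m powr (1 / q)\<close> turns into \<open>m powr (p - 1)\<close>. Cancelling it leaves a
    single factor \<open>m\<close>, matching the one in \<open>orbit_bound\<close>.\<close>
  then have "m powr p * ?th powr p \<le> (2 * c2) powr p * m powr (p - 1) * S"
    using pq S0 p_div_q by (simp add: powr_mult powr_powr)
  also have "m powr p = m powr (p - 1) * m powr 1"
    unfolding powr_add[symmetric] by simp
  finally have "m powr (p - 1) * (m * ?th powr p) \<le> m powr (p - 1) * ((2 * c2) powr p * S)"
    using m by (simp add: mult_ac)
  then have "m * ?th powr p \<le> (2 * c2) powr p * S"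
    using m by simp
  then show ?thesis unfolding S_def y_def .
qed

lemma growth_p:
  assumes m: "1 \<le> m" and x: "x \<in> K" and g: "1 \<le> g" "2 ^ g \<le> n"
  shows "N (T (real n) (B m (B m x))) \<le> 2 * c2\<^sup>2 * n / g powr (1 / p) * N x"
proof -
  let ?th = "N (T (real n) (B m (B m x)))"
  let ?a = "\<lambda>k. N (T (real (m * n - k) * (1 / m)) (B m x)) powr p"
  have n: "1 \<le> n" using g(2) by (metis le_trans one_le_numeral one_le_power)
  have "g * (m * ?th powr p) = (\<Sum>i<g. m * ?th powr p)" by simp
  also have "\<dots> \<le> (\<Sum>i<g. (2 * c2) powr p * (\<Sum>k\<in>{m * 2 ^ i..<m * 2 ^ Suc i}. ?a k))"
  proof (intro sum_mono dyadic_block_bound m x)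
    fix i assume "i \<in> {..<g}"
    then have "(2::nat) ^ Suc i \<le> 2 ^ g" by (intro power_increasing) auto
    then show "2 ^ Suc i \<le> n" using g by linarith
  qed
  also have "\<dots> = (2 * c2) powr p * (\<Sum>k\<in>{m..<m * 2 ^ g}. ?a k)"
    by (simp add: sum_dyadic sum_distrib_left)
  also have "\<dots> \<le> (2 * c2) powr p * (\<Sum>k\<in>{1..m * n}. ?a k)"
  proof (intro mult_left_mono sum_mono2)
    have "m * 2 ^ g \<le> m * n" using g by (intro mult_le_mono2)
    then show "{m..<m * 2 ^ g} \<subseteq> {1..m * n}" using m by (intro subsetI) (simp only: atLeastLessThan_iff atLeastAtMost_iff, linarith)
  qed auto
  also have "\<dots> \<le> (2 * c2) powr p * (m * (c2 * n * N x) powr p)"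
    unfolding sum_orbit_reversed[OF m x] by (intro mult_left_mono orbit_bound m n x) auto
  finally have "m * (g * ?th powr p) \<le> m * ((2 * c2) powr p * (c2 * n * N x) powr p)"
    by (simp add: mult_ac)
  then have "g * ?th powr p \<le> (2 * c2 * (c2 * n * N x)) powr p"
    using m by (simp add: powr_mult mult_ac)
  then have "(g * ?th powr p) powr (1 / p) \<le> ((2 * c2 * (c2 * n * N x)) powr p) powr (1 / p)"
    using pq by (intro powr_mono2) auto
  then have "g powr (1 / p) * ?th \<le> 2 * c2 * (c2 * n * N x)"
    using pq c2_pos by (simp add: powr_mult powr_powr N_nonneg)
  then show ?thesis using g by (simp add: field_simps power2_eq_square)
qed

text \<open>The weights \<open>m / j\<close> give all dyadic blocks equal shares: at least
  \<open>m / 2\<close> each on the left, where all vectors coincide, and at most a fixed multiple of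
  \<open>m\<close> each in the sum of \<open>p\<close>-th powers on the right. So \<open>g\<close>
  stands against \<open>g powr (1 / p)\<close>, and the quotient is
  \<open>g powr (1 / q)\<close>.\<close>

lemma growth_q:
  assumes m: "1 \<le> m" and x: "x \<in> K" and g: "1 \<le> g" "2 ^ g \<le> n"
  shows "N (T (real n) (B m (B m x))) \<le> 4 * c2\<^sup>2 * n / g powr (1 / q) * N x"
proof -
  let ?th = "N (T (real n) (B m (B m x)))"
  have V: "x \<in> V" using x K_V by auto
  have thV: "T (real n) (B m (B m x)) \<in> V" using m V by auto
  have n: "1 \<le> n" using g(2) by (metis le_trans one_le_numeral one_le_power)
  have mg: "m * 2 ^ g \<le> m * n" using g by (intro mult_le_mono2)
  define J where "J = {m..<m * 2 ^ g}"
  have J: "k \<le> m * n" "1 \<le> k" "m \<le> k" if "k \<in> J" for k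
    using that mg m unfolding J_def atLeastLessThan_iff by linarith+
  define y where "y k = T (real k * (1 / m)) (B m x)" for k
  define z where "z k = (if m * n - k \<in> J then (m / real (m * n - k)) *\<^sub>R y (m * n - k) else 0)" for k
  have yK: "y k \<in> K" for k unfolding y_def using m x by (intro B_T_K) auto
  have yV: "y k \<in> V" for k using yK K_V by auto
  have zK: "z k \<in> K" for k using yK K_0 by (auto simp: z_def intro!: K_scale)
  have reindex: "(\<Sum>k<m * n. f (m * n - k)) = (\<Sum>k\<in>J. f k)" if "\<And>k. k \<notin> J \<Longrightarrow> f k = 0"
    for f :: "nat \<Rightarrow> 'c::comm_monoid_add"
  proof -
    have "(\<Sum>k<m * n. f (m * n - k)) = (\<Sum>k\<in>{1..m * n}. f k)"
      by (rule sum.reindex_bij_witness[of _ "\<lambda>k. m * n - k" "\<lambda>k. m * n - k"]) auto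
    also have "\<dots> = (\<Sum>k\<in>J. f k)" using J that by (intro sum.mono_neutral_right) auto
    finally show ?thesis .
  qed
  have Bz: "T (real k * (1 / m)) (B m (z k)) =
      (if m * n - k \<in> J then m / real (m * n - k) else 0) *\<^sub>R T (real n) (B m (B m x))" if "k < m * n" for k
  proof (cases "m * n - k \<in> J")
    case True
    have "T (real k * (1 / m)) (B m (z k)) = (m / real (m * n - k)) *\<^sub>R T (real k * (1 / m)) (B m (y (m * n - k)))"
      using True by (simp add: z_def linear_scale[OF B_linear[OF m]] T_simps)
    also have "T (real k * (1 / m)) (B m (y (m * n - k))) = T (real n) (B m (B m x))"
      unfolding y_def using that by (intro T_B_reversed m x) auto
    finally show ?thesis using True by simp
  qed (simp add: z_def linear_0[OF B_linear[OF m]] linear_0[OF T_linear])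
  have "(\<Sum>k<m * n. T (real k * (1 / m)) (B m (z k))) = (\<Sum>k\<in>J. m / real k) *\<^sub>R T (real n) (B m (B m x))"
  proof -
    let ?w = "\<lambda>k. if k \<in> J then m / real k else 0"
    have "(\<Sum>k<m * n. T (real k * (1 / m)) (B m (z k))) = (\<Sum>k<m * n. ?w (m * n - k) *\<^sub>R T (real n) (B m (B m x)))"
      by (intro sum.cong refl Bz) auto
    also have "\<dots> = (\<Sum>k<m * n. ?w (m * n - k)) *\<^sub>R T (real n) (B m (B m x))"
      by (simp only: scaleR_sum_left)
    also have "(\<Sum>k<m * n. ?w (m * n - k)) = (\<Sum>k\<in>J. m / real k)"
      by (subst reindex[of ?w]) auto
    finally show ?thesis .
  qed
  moreover have "0 \<le> (\<Sum>k\<in>J. m / real k)" by (intro sum_nonneg) auto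
  ultimately have "(\<Sum>k\<in>J. m / real k) * ?th = N (\<Sum>k<m * n. T (real k * (1 / m)) (B m (z k)))"
    using thV by (simp add: N_scale)
  also have "\<dots> \<le> c2 * n * m powr (1 / q) * (\<Sum>k<m * n. N (z k) powr p) powr (1 / p)"
    by (intro sum_orbit_bound m n zK)
  finally have th: "(\<Sum>k\<in>J. m / real k) * ?th \<le> c2 * n * m powr (1 / q) * (\<Sum>k<m * n. N (z k) powr p) powr (1 / p)" .
  have "(\<Sum>k<m * n. N (z k) powr p) = (\<Sum>k\<in>J. (m / real k * N (y k)) powr p)"
  proof -
    let ?f = "\<lambda>k. if k \<in> J then (m / real k * N (y k)) powr p else 0"
    have "N (z k) powr p = ?f (m * n - k)" for k
      using N_scale[OF yV, of "m / real (m * n - k)"] by (simp only: z_def split: if_split) simp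
    then show ?thesis using reindex[of ?f] by simp
  qed
  also have "\<dots> \<le> g * (m * (2 * c2 * N x) powr p)"
  proof -
    \<comment> \<open>On block \<open>i\<close> the weight is at most \<open>1 / 2 ^ i\<close>, and
      \<open>orbit_bound\<close> up to time \<open>2 ^ Suc i\<close> brings in a factor
      \<open>2 ^ Suc i\<close>; the product no longer depends on \<open>i\<close>.\<close>
    have "(\<Sum>k\<in>{m * 2 ^ i..<m * 2 ^ Suc i}. (m / real k * N (y k)) powr p) \<le> m * (2 * c2 * N x) powr p" for i
    proof -
      have "(\<Sum>k\<in>{m * 2 ^ i..<m * 2 ^ Suc i}. (m / real k * N (y k)) powr p)
         \<le> (\<Sum>k\<in>{m * 2 ^ i..<m * 2 ^ Suc i}. (1 / 2 ^ i) powr p * N (y k) powr p)"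
        unfolding powr_mult[symmetric]
      proof (intro sum_mono powr_mono2 mult_right_mono N_nonneg mult_nonneg_nonneg)
        fix k assume "k \<in> {m * 2 ^ i..<m * 2 ^ Suc i}"
        then have k: "m * 2 ^ i \<le> k" by simp
        then have "real (m * 2 ^ i) \<le> real k" by (simp only: of_nat_le_iff)
        moreover have "0 < real (m * 2 ^ i)" using m by simp
        ultimately show "m / real k \<le> 1 / 2 ^ i" by (simp add: field_simps)
      qed (use pq in auto)
      also have "\<dots> \<le> (1 / 2 ^ i) powr p * (\<Sum>k<m * 2 ^ Suc i. N (y k) powr p)"
        unfolding sum_distrib_left[symmetric] by (intro mult_left_mono sum_mono2) auto
      also have "\<dots> \<le> (1 / 2 ^ i) powr p * (m * (c2 * real (2 ^ Suc i) * N x) powr p)"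
        unfolding y_def by (intro mult_left_mono orbit_bound m x) auto
      also have "\<dots> = m * (1 / 2 ^ i * (c2 * real (2 ^ Suc i) * N x)) powr p"
        by (simp only: powr_mult mult_ac)
      finally show ?thesis by (simp add: mult_ac)
    qed
    then have "(\<Sum>k\<in>J. (m / real k * N (y k)) powr p) \<le> (\<Sum>i<g. m * (2 * c2 * N x) powr p)"
      unfolding J_def sum_dyadic by (intro sum_mono)
    then show ?thesis by simp
  qed
  finally have "(\<Sum>k<m * n. N (z k) powr p) powr (1 / p) \<le> (g * (m * (2 * c2 * N x) powr p)) powr (1 / p)"
    using pq by (intro powr_mono2 sum_nonneg) auto
  then have *: "c2 * n * m powr (1 / q) * (\<Sum>k<m * n. N (z k) powr p) powr (1 / p)
      \<le> c2 * n * m powr (1 / q) * (g * (m * (2 * c2 * N x) powr p)) powr (1 / p)"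
    using c2_pos by (intro mult_left_mono) auto
  have "g * (m / 2) \<le> (\<Sum>k\<in>J. m / real k)"
  proof -
    \<comment> \<open>The block has \<open>m * 2 ^ i\<close> terms, each at least
      \<open>1 / 2 ^ Suc i\<close>.\<close>
    have "m / 2 \<le> (\<Sum>k\<in>{m * 2 ^ i..<m * 2 ^ Suc i}. m / real k)" for i
    proof -
      have "m / 2 = (\<Sum>k\<in>{m * 2 ^ i..<m * 2 ^ Suc i}. m / real (m * 2 ^ Suc i))"
        using m by simp
      also have "\<dots> \<le> (\<Sum>k\<in>{m * 2 ^ i..<m * 2 ^ Suc i}. m / real k)"
      proof (intro sum_mono divide_left_mono mult_pos_pos)
        fix k assume k: "k \<in> {m * 2 ^ i..<m * 2 ^ Suc i}"
        then show "real k \<le> real (m * 2 ^ Suc i)" by (simp only: of_nat_le_iff) simp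
        have "0 < m * 2 ^ i" using m by simp
        then have "0 < k" using k by (metis atLeastLessThan_iff order_less_le_trans)
        then show "0 < real k" by simp
      qed (use m in auto)
      finally show ?thesis .
    qed
    then have "(\<Sum>i<g. m / 2) \<le> (\<Sum>k\<in>J. m / real k)"
      unfolding J_def sum_dyadic by (intro sum_mono)
    then show ?thesis by simp
  qed
  then have "g * (m / 2) * ?th \<le> (\<Sum>k\<in>J. m / real k) * ?th"
    by (intro mult_right_mono N_nonneg)
  also note th
  also note *
  also have "(g * (m * (2 * c2 * N x) powr p)) powr (1 / p) = g powr (1 / p) * (m powr (1 / p) * (2 * c2 * N x))"
    using pq c2_pos by (simp add: powr_mult powr_powr N_nonneg)
  also have "c2 * n * m powr (1 / q) * (g powr (1 / p) * (m powr (1 / p) * (2 * c2 * N x)))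
     = (m powr (1 / p) * m powr (1 / q)) * (2 * c2\<^sup>2 * n * g powr (1 / p) * N x)"
    by (simp add: power2_eq_square mult_ac)
  also have "m powr (1 / p) * m powr (1 / q) = m"
    using m pq by (simp flip: powr_add)
  finally have "m * (g * ?th) \<le> m * (4 * c2\<^sup>2 * n * g powr (1 / p) * N x)"
    by (simp add: mult_ac)
  then have gth: "g * ?th \<le> 4 * c2\<^sup>2 * n * g powr (1 / p) * N x"
    using m by simp
  have eq: "g powr (1 / p) * g powr (1 / q) = g"
    using g pq by (simp flip: powr_add)
  have eq': "g powr (1 / p) * (g powr (1 / q) * ?th) = g * ?th"
    unfolding mult.assoc[symmetric] eq ..
  have "g powr (1 / p) * (g powr (1 / q) * ?th) \<le> g powr (1 / p) * (4 * c2\<^sup>2 * n * N x)"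
    unfolding eq' using gth by (simp only: mult_ac)
  then have "g powr (1 / q) * ?th \<le> 4 * c2\<^sup>2 * n * N x"
    using g by simp
  then show ?thesis using g by (simp add: field_simps)
qed

section \<open>Removal of the averaging operators as the mesh shrinks\<close>

lemma W_bound:
  assumes "0 < t" "x \<in> V"
  shows "N (W 1 t x) \<le> t * bnd t * N x"
proof (rule N_tendsto_unique_bound[OF riemann_tendsto])
  show "\<forall>\<^sub>F r in sequentially. N (riemann 1 t r x) \<le> t * bnd t * N x"
    using eventually_gt_at_top[of 0]
  proof eventually_elim
    case (elim r)
    have "N (riemann 1 t r x) \<le> (\<Sum>j<r. N ((t / r * exp (- 1 * (t / r) * j)) *\<^sub>R T (real j * (t / r)) x))"
      unfolding riemann_def using assms by (intro N_sum V_closed T_V) auto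
    also have "\<dots> \<le> (\<Sum>j<r. t / r * (bnd t * N x))"
    proof (intro sum_mono)
      fix j assume j: "j \<in> {..<r}"
      have "N ((t / r * exp (- 1 * (t / r) * j)) *\<^sub>R T (real j * (t / r)) x) =
         t / r * exp (- 1 * (t / r) * j) * N (T (real j * (t / r)) x)"
        using assms by (subst N_scale) auto
      also have "\<dots> \<le> t / r * 1 * (bnd t * N x)"
        using assms j bnd_ge1[of t]
        by (intro mult_mono T_bound) (auto simp: N_nonneg field_simps)
      finally show "N ((t / r * exp (- 1 * (t / r) * j)) *\<^sub>R T (real j * (t / r)) x) \<le> t / r * (bnd t * N x)"
        by simp
    qed
    also have "\<dots> = t * bnd t * N x" using elim by simp
    finally show ?case .
  qed
qed (use assms in \<open>auto intro: riemann_V\<close>)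

lemma B_bound: "1 \<le> m \<Longrightarrow> x \<in> V \<Longrightarrow> N (B m x) \<le> bnd (1 + 2 * \<tau>) * (bnd 1 * N x)"
proof -
  assume m: "1 \<le> m" and x: "x \<in> V"
  have "N (real m *\<^sub>R W 1 (1 / m) x) = real m * N (W 1 (1 / m) x)"
    using m x by (subst N_scale) auto
  also have "\<dots> \<le> real m * (1 / m * bnd (1 / m) * N x)"
    using m x by (intro mult_left_mono W_bound) auto
  also have "\<dots> \<le> bnd 1 * N x" using m bnd_mono[of "1 / m" 1] by (simp add: N_nonneg mult_right_mono)
  finally have w: "N (real m *\<^sub>R W 1 (1 / m) x) \<le> bnd 1 * N x" .
  have "N (B m x) \<le> bnd (1 + 2 * \<tau>) * N (real m *\<^sub>R W 1 (1 / m) x)"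
    unfolding B_def using m x tau by (intro T_bound) auto
  also have "\<dots> \<le> bnd (1 + 2 * \<tau>) * (bnd 1 * N x)"
    using w bnd_ge1[of "1 + 2 * \<tau>"] by (intro mult_left_mono) auto
  finally show "N (B m x) \<le> bnd (1 + 2 * \<tau>) * (bnd 1 * N x)" .
qed

lemma B_tendsto:
  assumes "x \<in> V"
  shows "(\<lambda>m. N (B (Suc m) x - T (1 + 2 * \<tau>) x)) \<longlonglongrightarrow> 0"
proof -
  have "filterlim (\<lambda>m. 1 / real (Suc m)) (at_right 0) sequentially"
    unfolding filterlim_at using LIMSEQ_inverse_real_of_nat by (auto simp: divide_inverse)
  from filterlim_compose[OF difference_quotient[OF zero_less_one assms] this]
  have "(\<lambda>m. N (real (Suc m) *\<^sub>R W 1 (1 / real (Suc m)) x - x)) \<longlonglongrightarrow> 0" by simp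
  from T_tendsto[OF this, of "1 + 2 * \<tau>"] show ?thesis
    unfolding B_def using assms tau by auto
qed

lemma B_B_tendsto:
  assumes "x \<in> V" "0 \<le> s"
  shows "(\<lambda>m. N (T s (B (Suc m) (B (Suc m) x)) - T (s + 2 + 4 * \<tau>) x)) \<longlonglongrightarrow> 0"
proof -
  let ?r = "1 + 2 * \<tau>"
  have r: "0 \<le> ?r" using tau by simp
  let ?e = "\<lambda>m. bnd ?r * (bnd 1 * N (B (Suc m) x - T ?r x)) + N (B (Suc m) (T ?r x) - T ?r (T ?r x))"
  have "(\<lambda>m. N (B (Suc m) (B (Suc m) x) - T ?r (T ?r x))) \<longlonglongrightarrow> 0"
  proof (rule tendsto_sandwich[of "\<lambda>_. 0" _ _ ?e])
    have "?e \<longlonglongrightarrow> bnd ?r * (bnd 1 * 0) + 0"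
      using assms r by (intro tendsto_intros B_tendsto T_V)
    then show "?e \<longlonglongrightarrow> 0" by simp
    have "N (B (Suc m) (B (Suc m) x) - T ?r (T ?r x)) \<le> ?e m" for m
    proof -
      have V: "B (Suc m) x \<in> V" "T ?r x \<in> V" "B (Suc m) (B (Suc m) x) \<in> V" "B (Suc m) (T ?r x) \<in> V" "T ?r (T ?r x) \<in> V"
        using assms r by auto
      have "N (B (Suc m) (B (Suc m) x) - T ?r (T ?r x)) \<le>
          N (B (Suc m) (B (Suc m) x) - B (Suc m) (T ?r x)) + N (B (Suc m) (T ?r x) - T ?r (T ?r x))"
        by (intro N_triangle3 V)
      also have "B (Suc m) (B (Suc m) x) - B (Suc m) (T ?r x) = B (Suc m) (B (Suc m) x - T ?r x)"
        by (intro linear_diff[OF B_linear, symmetric]) simp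
      also have "N \<dots> \<le> bnd ?r * (bnd 1 * N (B (Suc m) x - T ?r x))"
        using V by (intro B_bound V_closed) auto
      finally show ?thesis by simp
    qed
    then show "\<forall>\<^sub>F m in sequentially. N (B (Suc m) (B (Suc m) x) - T ?r (T ?r x)) \<le> ?e m" by simp
  qed (auto simp: N_nonneg)
  then have "(\<lambda>m. N (T s (B (Suc m) (B (Suc m) x)) - T s (T ?r (T ?r x)))) \<longlonglongrightarrow> 0"
    using assms r by (intro T_tendsto) auto
  moreover have "T s (T ?r (T ?r x)) = T (s + (?r + ?r)) x"
    using assms r by (simp only: T_add T_V add_nonneg_nonneg)
  moreover have "s + (?r + ?r) = s + 2 + 4 * \<tau>" by simp
  ultimately show ?thesis by (simp only:)
qed

text \<open>The bounds of \<open>growth_p\<close> and \<open>growth_q\<close> are free of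
  \<open>m\<close>, and applying \<open>B (Suc m)\<close> twice tends strongly to the shift by
  \<open>2 * (1 + 2 * \<tau>)\<close>. This is where the additional time in the argument of
  \<open>T\<close> comes from.\<close>

theorem growth:
  assumes x: "x \<in> K" and g: "1 \<le> g" "2 ^ g \<le> n"
  shows "N (T (real n + 2 + 4 * \<tau>) x) \<le> 4 * c2\<^sup>2 * n / g powr (max (1 / p) (1 / q)) * N x"
proof (rule N_tendsto_unique_bound[OF B_B_tendsto])
  have "N (T (real n) (B (Suc m) (B (Suc m) x))) \<le> 4 * c2\<^sup>2 * n / g powr (max (1 / p) (1 / q)) * N x" for m
  proof (cases "1 / q \<le> 1 / p")
    case True
    have "N (T (real n) (B (Suc m) (B (Suc m) x))) \<le> 2 * c2\<^sup>2 * n / g powr (1 / p) * N x"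
      by (intro growth_p x g) simp
    also have "\<dots> \<le> 4 * c2\<^sup>2 * n / g powr (1 / p) * N x"
      by (intro mult_right_mono divide_right_mono) (auto simp: N_nonneg)
    finally show ?thesis using True by (simp only: max_absorb1)
  next
    case False
    then show ?thesis using growth_q[OF _ x g, of "Suc m"] by (simp add: max_absorb2)
  qed
  then show "\<forall>\<^sub>F m in sequentially. N (T (real n) (B (Suc m) (B (Suc m) x)))
      \<le> 4 * c2\<^sup>2 * n / g powr (max (1 / p) (1 / q)) * N x" by simp
qed (use x K_V tau in auto)

end

section \<open>Lebesgue spaces\<close>

definition Lp_norm :: "'a measure \<Rightarrow> real \<Rightarrow> ('a \<Rightarrow> complex) \<Rightarrow> real" where
  "Lp_norm M p f = (LINT x|M. norm (f x) powr p) powr (1 / p)"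

lemma lp_fun_measurable: "f \<in> lp_fun M p \<Longrightarrow> f \<in> borel_measurable M"
  by (simp add: lp_fun_def)

lemma lp_fun_integrable: "f \<in> lp_fun M p \<Longrightarrow> integrable M (\<lambda>x. norm (f x) powr p)"
  by (simp add: lp_fun_def)

lemma Lp_norm_nonneg: "0 \<le> Lp_norm M p f"
  by (simp add: Lp_norm_def)

lemma Lp_norm_powr: "0 < p \<Longrightarrow> Lp_norm M p f powr p = (LINT x|M. norm (f x) powr p)"
  by (simp add: Lp_norm_def powr_powr)

lemma Lp_norm_scale: "0 < p \<Longrightarrow> Lp_norm M p (\<lambda>x. c * f x) = norm c * Lp_norm M p f"
  by (simp add: Lp_norm_def norm_mult powr_mult powr_powr)

lemma Lp_norm_cong_AE:
  assumes "f \<in> borel_measurable M" "g \<in> borel_measurable M" "AE x in M. f x = g x"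
  shows "Lp_norm M p f = Lp_norm M p g"
proof -
  have "(LINT x|M. norm (f x) powr p) = (LINT x|M. norm (g x) powr p)"
    using assms by (intro integral_cong_AE) auto
  then show ?thesis by (simp add: Lp_norm_def)
qed

lemma Lp_norm_eq_0:
  assumes "f \<in> lp_fun M p" "Lp_norm M p f = 0"
  shows "AE x in M. f x = 0"
proof -
  have "(LINT x|M. norm (f x) powr p) = 0" using assms(2) by (simp add: Lp_norm_def)
  then have "AE x in M. norm (f x) powr p = 0"
    using integral_nonneg_eq_0_iff_AE[OF lp_fun_integrable[OF assms(1)]] by simp
  then show ?thesis by eventually_elim simp
qed

lemma Lp_norm_le:
  assumes "0 < p" "0 \<le> b" "(LINT x|M. norm (f x) powr p) \<le> b powr p"
  shows "Lp_norm M p f \<le> b"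
proof -
  have "Lp_norm M p f \<le> (b powr p) powr (1 / p)"
    unfolding Lp_norm_def using assms by (intro powr_mono2) auto
  then show ?thesis using assms by (simp add: powr_powr)
qed

lemma Lp_norm_mono_AE:
  assumes "0 < p" "f \<in> lp_fun M p" "g \<in> lp_fun M p" "AE x in M. norm (f x) \<le> norm (g x)"
  shows "Lp_norm M p f \<le> Lp_norm M p g"
proof (rule Lp_norm_le)
  show "(LINT x|M. norm (f x) powr p) \<le> Lp_norm M p g powr p"
    unfolding Lp_norm_powr[OF assms(1)]
  proof (intro integral_mono_AE lp_fun_integrable assms(2,3))
    show "AE x in M. norm (f x) powr p \<le> norm (g x) powr p"
      using assms(4) by eventually_elim (use assms(1) in \<open>auto intro: powr_mono2\<close>)
  qed
qed (use assms in \<open>auto simp: Lp_norm_nonneg\<close>)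

lemma powr_convex_combination:
  fixes a b s t p :: real
  assumes "1 \<le> p" "0 \<le> a" "0 \<le> b" "0 \<le> s" "0 \<le> t" "s + t = 1"
  shows "(s * a + t * b) powr p \<le> s * a powr p + t * b powr p"
proof -
  have le: "u powr p \<le> u" if "0 \<le> u" "u \<le> 1" for u :: real
    using that assms(1) powr_mono'[of 1 p u] by simp
  consider "a = 0" | "b = 0" | "0 < a" "0 < b" using assms by linarith
  then show ?thesis
  proof cases
    case 1
    then show ?thesis using assms le[of t] by (simp add: powr_mult mult_right_mono)
  next
    case 2
    then show ?thesis using assms le[of s] by (simp add: powr_mult mult_right_mono)
  next
    case 3
    have s: "s = 1 - t" using assms by simp
    show ?thesis
      unfolding s using assms 3 convex_onD[OF powr_convex[OF assms(1)], of t a b] by simp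
  qed
qed

text \<open>With \<open>a\<close> and \<open>b\<close> the two norms,
  \<open>(f + g) / (a + b)\<close> is a convex combination of \<open>f / a\<close> and
  \<open>g / b\<close>. Convexity of the \<open>p\<close>-th power is applied pointwise and
  integrated.\<close>

lemma Lp_norm_triangle:
  assumes p: "1 \<le> p" and f: "f \<in> lp_fun M p" and g: "g \<in> lp_fun M p"
  shows "Lp_norm M p (\<lambda>x. f x + g x) \<le> Lp_norm M p f + Lp_norm M p g"
proof -
  have fg: "(\<lambda>x. f x + g x) \<in> lp_fun M p" using p f g by (intro lp_fun_add) auto
  consider "Lp_norm M p f = 0" | "Lp_norm M p g = 0" | "0 < Lp_norm M p f" "0 < Lp_norm M p g"
    using Lp_norm_nonneg[of M p f] Lp_norm_nonneg[of M p g] by linarith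
  then show ?thesis
  proof cases
    case 1
    have "AE x in M. f x + g x = g x" using Lp_norm_eq_0[OF f 1] by eventually_elim simp
    then show ?thesis
      using Lp_norm_cong_AE[OF lp_fun_measurable[OF fg] lp_fun_measurable[OF g]] 1 by simp
  next
    case 2
    have "AE x in M. f x + g x = f x" using Lp_norm_eq_0[OF g 2] by eventually_elim simp
    then show ?thesis
      using Lp_norm_cong_AE[OF lp_fun_measurable[OF fg] lp_fun_measurable[OF f]] 2 by simp
  next
    case 3
    let ?a = "Lp_norm M p f" and ?b = "Lp_norm M p g"
    let ?s = "?a / (?a + ?b)" and ?t = "?b / (?a + ?b)"
    have st: "0 \<le> ?s" "0 \<le> ?t" "?s + ?t = 1" using 3 by (auto simp flip: add_divide_distrib)
    have pt: "norm (f x + g x) powr p \<le> (?a + ?b) powr p *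
        (?s * (norm (f x) powr p / ?a powr p) + ?t * (norm (g x) powr p / ?b powr p))" for x
    proof -
      have "norm (f x + g x) \<le> norm (f x) + norm (g x)" by (rule norm_triangle_ineq)
      also have "\<dots> = (?a + ?b) * (?s * (norm (f x) / ?a) + ?t * (norm (g x) / ?b))"
      proof -
        have "?s * (norm (f x) / ?a) = norm (f x) / (?a + ?b)" "?t * (norm (g x) / ?b) = norm (g x) / (?a + ?b)"
          using 3 by simp_all
        then show ?thesis using 3 by (simp flip: add_divide_distrib)
      qed
      finally have "norm (f x + g x) powr p \<le>
          ((?a + ?b) * (?s * (norm (f x) / ?a) + ?t * (norm (g x) / ?b))) powr p"
        using p by (intro powr_mono2) auto
      also have "\<dots> = (?a + ?b) powr p * (?s * (norm (f x) / ?a) + ?t * (norm (g x) / ?b)) powr p"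
        by (rule powr_mult)
      also have "\<dots> \<le> (?a + ?b) powr p * (?s * (norm (f x) / ?a) powr p + ?t * (norm (g x) / ?b) powr p)"
        using 3 p st by (intro mult_left_mono powr_convex_combination) auto
      finally show ?thesis using 3 by (simp add: powr_divide)
    qed
    have "(LINT x|M. norm (f x + g x) powr p) \<le> (LINT x|M. (?a + ?b) powr p *
        (?s * (norm (f x) powr p / ?a powr p) + ?t * (norm (g x) powr p / ?b powr p)))"
      using pt f g fg by (intro integral_mono lp_fun_integrable) (auto simp: lp_fun_integrable)
    also have "\<dots> = (?a + ?b) powr p *
        (?s * ((LINT x|M. norm (f x) powr p) / ?a powr p) + ?t * ((LINT x|M. norm (g x) powr p) / ?b powr p))"
      using f g by (simp add: lp_fun_integrable)
    also have "\<dots> = (?a + ?b) powr p"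
      using 3 p st(3) Lp_norm_powr[of p M f, symmetric] Lp_norm_powr[of p M g, symmetric] by simp
    finally show ?thesis using 3 p by (intro Lp_norm_le) auto
  qed
qed

lemma lp_fun_0: "(\<lambda>x. 0) \<in> lp_fun M p"
  by (simp add: lp_fun_def)

lemma lp_fun_sum: "0 \<le> p \<Longrightarrow> (\<And>i. i \<in> I \<Longrightarrow> f i \<in> lp_fun M p) \<Longrightarrow> (\<lambda>x. \<Sum>i\<in>I. f i x) \<in> lp_fun M p"
  by (induction I rule: infinite_finite_induct) (auto simp: lp_fun_0 lp_fun_add)

lemma Lp_norm_0: "Lp_norm M p (\<lambda>x. 0) = 0"
  by (simp add: Lp_norm_def)

lemma lp_fun_norm: "f \<in> lp_fun M p \<Longrightarrow> (\<lambda>x. complex_of_real (norm (f x))) \<in> lp_fun M p"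
  by (auto simp: lp_fun_def)

lemma Lp_norm_norm: "Lp_norm M p (\<lambda>x. complex_of_real (norm (f x))) = Lp_norm M p f"
  by (simp add: Lp_norm_def)

lemma Lp_norm_sum:
  assumes "1 \<le> p" "\<And>i. i \<in> I \<Longrightarrow> f i \<in> lp_fun M p"
  shows "Lp_norm M p (\<lambda>x. \<Sum>i\<in>I. f i x) \<le> (\<Sum>i\<in>I. Lp_norm M p (f i))"
  using assms(2)
proof (induction I rule: infinite_finite_induct)
  case (insert i I)
  have "Lp_norm M p (\<lambda>x. f i x + (\<Sum>i\<in>I. f i x)) \<le> Lp_norm M p (f i) + Lp_norm M p (\<lambda>x. \<Sum>i\<in>I. f i x)"
    using insert.prems assms(1) by (intro Lp_norm_triangle lp_fun_sum) auto
  moreover have "Lp_norm M p (\<lambda>x. \<Sum>i\<in>I. f i x) \<le> (\<Sum>i\<in>I. Lp_norm M p (f i))"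
    using insert.prems by (intro insert.IH) auto
  ultimately show ?case using insert.hyps by simp
qed (auto simp: Lp_norm_0)

text \<open>The partial sums of the absolute values increase, and their norms stay below the sum of
  the norms. Monotone convergence makes the supremum integrable to the power \<open>p\<close>, hence
  finite almost everywhere; the sum is the majorant needed in \<open>Lp_complete\<close>.\<close>

lemma AE_summable_lp:
  assumes p: "1 \<le> p" and f: "\<And>n::nat. f n \<in> lp_fun M p" and sm: "summable (\<lambda>n. Lp_norm M p (f n))"
  shows "AE x in M. summable (\<lambda>n. norm (f n x))"
    and "(\<lambda>x. complex_of_real (\<Sum>n. norm (f n x))) \<in> lp_fun M p"
proof -
  define S where "S = (\<Sum>n. Lp_norm M p (f n))"
  define u where "u n x = (\<Sum>k<n. norm (f k x))" for n x
  have [measurable]: "f n \<in> borel_measurable M" for n using f by (rule lp_fun_measurable)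
  have [measurable]: "u n \<in> borel_measurable M" for n unfolding u_def by measurable
  have u0: "0 \<le> u n x" for n x unfolding u_def by (intro sum_nonneg) auto
  have umono: "m \<le> n \<Longrightarrow> u m x \<le> u n x" for m n x unfolding u_def by (intro sum_mono2) auto
  have S0: "0 \<le> S" unfolding S_def using sm by (intro suminf_nonneg) (auto simp: Lp_norm_nonneg)
  have ulp: "(\<lambda>x. complex_of_real (u n x)) \<in> lp_fun M p" for n
    unfolding u_def of_real_sum using p f by (intro lp_fun_sum lp_fun_norm) auto
  have uint: "integrable M (\<lambda>x. u n x powr p)" for n
    using lp_fun_integrable[OF ulp[of n]] u0 by simp
  have ule: "(LINT x|M. u n x powr p) \<le> S powr p" for n
  proof -
    have "Lp_norm M p (\<lambda>x. complex_of_real (u n x)) \<le> (\<Sum>k<n. Lp_norm M p (\<lambda>x. complex_of_real (norm (f k x))))"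
      unfolding u_def of_real_sum using p f by (intro Lp_norm_sum lp_fun_norm) auto
    also have "\<dots> \<le> S" unfolding S_def Lp_norm_norm
      using sm by (intro sum_le_suminf) (auto simp: Lp_norm_nonneg)
    finally have "Lp_norm M p (\<lambda>x. complex_of_real (u n x)) powr p \<le> S powr p"
      using p by (intro powr_mono2) (auto simp: Lp_norm_nonneg)
    then show ?thesis using p u0 by (simp add: Lp_norm_powr)
  qed
  have "incseq (\<lambda>n x. ennreal (u n x powr p))"
    using umono u0 p by (auto simp: incseq_def le_fun_def intro!: ennreal_leI powr_mono2)
  then have "(\<integral>\<^sup>+ x. (SUP n. ennreal (u n x powr p)) \<partial>M) = (SUP n. \<integral>\<^sup>+ x. ennreal (u n x powr p) \<partial>M)"
    by (intro nn_integral_monotone_convergence_SUP) auto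
  also have "\<dots> \<le> ennreal (S powr p)"
    using ule by (intro SUP_least) (simp add: nn_integral_eq_integral[OF uint] ennreal_leI)
  finally have fin: "(\<integral>\<^sup>+ x. (SUP n. ennreal (u n x powr p)) \<partial>M) \<le> ennreal (S powr p)" .
  then have "(\<integral>\<^sup>+ x. (SUP n. ennreal (u n x powr p)) \<partial>M) \<noteq> \<infinity>"
    using le_less_trans[OF fin ennreal_less_top] by simp
  then have ae: "AE x in M. (SUP n. ennreal (u n x powr p)) \<noteq> \<infinity>"
    by (intro nn_integral_PInf_AE) auto
  then show sum_ae: "AE x in M. summable (\<lambda>n. norm (f n x))"
  proof eventually_elim
    case (elim x)
    then obtain B where B: "0 \<le> B" "(SUP n. ennreal (u n x powr p)) = ennreal B"
      by (cases "SUP n. ennreal (u n x powr p)") auto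
    have "u n x \<le> B powr (1 / p)" for n
    proof -
      have "ennreal (u n x powr p) \<le> ennreal B" unfolding B(2)[symmetric] by (rule SUP_upper) simp
      then have "u n x powr p \<le> B" using B by simp
      then have "(u n x powr p) powr (1 / p) \<le> B powr (1 / p)" using p by (intro powr_mono2) auto
      then show ?thesis using p u0[of n x] by (simp add: powr_powr)
    qed
    then show ?case unfolding u_def by (intro summableI_nonneg_bounded) auto
  qed
  define G where "G x = (\<Sum>n. norm (f n x))" for x
  have [measurable]: "G \<in> borel_measurable M" unfolding G_def by measurable
  have "(\<integral>\<^sup>+ x. ennreal (G x powr p) \<partial>M) \<le> (\<integral>\<^sup>+ x. (SUP n. ennreal (u n x powr p)) \<partial>M)"
  proof (rule nn_integral_mono_AE)
    show "AE x in M. ennreal (G x powr p) \<le> (SUP n. ennreal (u n x powr p))"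
      using sum_ae
    proof eventually_elim
      case (elim x)
      have "(\<lambda>n. u n x) \<longlonglongrightarrow> G x" unfolding u_def G_def using elim by (rule summable_LIMSEQ)
      then have "(\<lambda>n. u n x powr p) \<longlonglongrightarrow> G x powr p"
        using p by (intro tendsto_powr2 tendsto_const) (auto simp: u0)
      then have "(\<lambda>n. ennreal (u n x powr p)) \<longlonglongrightarrow> ennreal (G x powr p)" by (rule tendsto_ennrealI)
      then show ?case by (rule LIMSEQ_le_const2) (meson SUP_upper UNIV_I)
    qed
  qed
  also note fin
  finally have "(\<integral>\<^sup>+ x. ennreal (G x powr p) \<partial>M) < \<infinity>" by (simp add: le_less_trans)
  then have Gp: "integrable M (\<lambda>x. G x powr p)" by (intro integrableI_nonneg) auto
  \<comment> \<open>Where the series diverges, \<open>suminf\<close> is an unspecified real number,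
    so its sign is known on the set of convergence only.\<close>
  have G: "norm (complex_of_real (G x)) = G x" if "summable (\<lambda>n. norm (f n x))" for x
    using that suminf_nonneg[OF that] by (simp add: G_def)
  have "AE x in M. G x powr p = norm (complex_of_real (G x)) powr p"
    using sum_ae by eventually_elim (simp only: G)
  from integrable_cong_AE_imp[OF Gp _ this]
  have "integrable M (\<lambda>x. norm (complex_of_real (G x)) powr p)" by simp
  then show "(\<lambda>x. complex_of_real (\<Sum>n. norm (f n x))) \<in> lp_fun M p"
    by (simp add: lp_fun_def G_def[symmetric])
qed

text \<open>Riesz-Fischer in the form of absolutely convergent series: the pointwise sum is the
  limit, by dominated convergence of the remainders.\<close>

lemma Lp_complete:
  assumes p: "1 \<le> p" and f: "\<And>n::nat. f n \<in> lp_fun M p" and sm: "summable (\<lambda>n. Lp_norm M p (f n))"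
  obtains g where "g \<in> lp_fun M p" "(\<lambda>n. Lp_norm M p (\<lambda>x. (\<Sum>k<n. f k x) - g x)) \<longlonglongrightarrow> 0"
proof
  define g where "g x = (\<Sum>k. f k x)" for x
  define G where "G x = (\<Sum>n. norm (f n x))" for x
  have [measurable]: "f n \<in> borel_measurable M" for n using f by (rule lp_fun_measurable)
  have [measurable]: "g \<in> borel_measurable M" unfolding g_def by measurable
  have [measurable]: "G \<in> borel_measurable M" unfolding G_def by measurable
  note ae = AE_summable_lp(1)[OF assms]
  have "(\<lambda>x. complex_of_real (G x)) \<in> lp_fun M p"
    unfolding G_def by (rule AE_summable_lp(2)[OF assms])
  then have "integrable M (\<lambda>x. norm (complex_of_real (G x)) powr p)" by (rule lp_fun_integrable)
  then have Gint: "integrable M (\<lambda>x. \<bar>G x\<bar> powr p)" by simp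
  have bound: "AE x in M. norm (norm ((\<Sum>k<n. f k x) - g x) powr p) \<le> \<bar>G x\<bar> powr p" for n
    using ae
  proof eventually_elim
    case (elim x)
    have "g x - (\<Sum>k<n. f k x) = (\<Sum>k. f (k + n) x)"
      using suminf_minus_initial_segment[OF summable_norm_cancel[OF elim], of n] by (simp add: g_def)
    then have "norm ((\<Sum>k<n. f k x) - g x) = norm (\<Sum>k. f (k + n) x)"
      using norm_minus_commute[of "\<Sum>k<n. f k x" "g x"] by simp
    also have "\<dots> \<le> (\<Sum>k. norm (f (k + n) x))"
      using elim by (intro summable_norm) (simp add: summable_iff_shift[of "\<lambda>k. norm (f k x)"])
    also have "\<dots> = G x - (\<Sum>k<n. norm (f k x))"
      unfolding G_def by (rule suminf_minus_initial_segment[OF elim])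
    also have "\<dots> \<le> G x" by (simp add: sum_nonneg)
    finally have "norm ((\<Sum>k<n. f k x) - g x) \<le> \<bar>G x\<bar>" by linarith
    then show ?case using p by (auto intro!: powr_mono2)
  qed
  have "AE x in M. norm (norm (g x) powr p) \<le> norm (\<bar>G x\<bar> powr p)"
    using bound[of 0] by simp
  from Bochner_Integration.integrable_bound[OF Gint _ this]
  have "integrable M (\<lambda>x. norm (g x) powr p)" by simp
  then show "g \<in> lp_fun M p" by (simp add: lp_fun_def)
  have "(\<lambda>n. LINT x|M. norm ((\<Sum>k<n. f k x) - g x) powr p) \<longlonglongrightarrow> (LINT x|M. 0)"
  proof (rule integral_dominated_convergence[where w = "\<lambda>x. \<bar>G x\<bar> powr p"])
    show "integrable M (\<lambda>x. \<bar>G x\<bar> powr p)" by (rule Gint)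
    show "AE x in M. norm (norm ((\<Sum>k<n. f k x) - g x) powr p) \<le> \<bar>G x\<bar> powr p" for n
      by (rule bound)
    show "AE x in M. (\<lambda>n. norm ((\<Sum>k<n. f k x) - g x) powr p) \<longlonglongrightarrow> 0"
      using ae
    proof eventually_elim
      case (elim x)
      have "(\<lambda>n. (\<Sum>k<n. f k x) - g x) \<longlonglongrightarrow> g x - g x"
        unfolding g_def by (intro tendsto_diff summable_LIMSEQ summable_norm_cancel[OF elim] tendsto_const)
      then have "(\<lambda>n. norm ((\<Sum>k<n. f k x) - g x) powr p) \<longlonglongrightarrow> 0 powr p"
        using p by (intro tendsto_powr2 tendsto_const tendsto_norm_zero) auto
      then show ?case using p by simp
    qed
  qed measurable
  then have "(\<lambda>n. (LINT x|M. norm ((\<Sum>k<n. f k x) - g x) powr p) powr (1 / p)) \<longlonglongrightarrow> 0 powr (1 / p)"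
    using p by (intro tendsto_powr2 tendsto_const) auto
  then show "(\<lambda>n. Lp_norm M p (\<lambda>x. (\<Sum>k<n. f k x) - g x)) \<longlonglongrightarrow> 0"
    unfolding Lp_norm_def using p by simp
qed

section \<open>Functions as the ambient real vector space, with a linear choice of
  representatives\<close>

instantiation "fun" :: (type, real_vector) real_vector
begin
definition scaleR_fun_def: "c *\<^sub>R f = (\<lambda>x. c *\<^sub>R f x)"
instance
  by standard (auto simp: scaleR_fun_def fun_eq_iff scaleR_add_right scaleR_add_left)
end

lemma scaleR_fun_apply [simp]: "(c *\<^sub>R f) x = c *\<^sub>R f x"
  by (simp add: scaleR_fun_def)

lemma sum_fun_apply: "(\<Sum>i\<in>I. f i) x = (\<Sum>i\<in>I. f i x)"
  by (induction I rule: infinite_finite_induct) auto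

lemma lp_fun_subspace: "0 \<le> p \<Longrightarrow> subspace (lp_fun M p)"
proof (rule subspaceI)
  show "0 \<in> lp_fun M p" using lp_fun_0[of M p] by (simp add: zero_fun_def)
  fix f g assume p: "0 \<le> p" and f: "f \<in> lp_fun M p" and g: "g \<in> lp_fun M p"
  show "f + g \<in> lp_fun M p" using lp_fun_add[OF p f g] by (simp add: plus_fun_def)
next
  fix c f assume f: "f \<in> lp_fun M p"
  show "c *\<^sub>R f \<in> lp_fun M p"
    using lp_fun_scale[OF f, of "of_real c"] by (simp add: scaleR_fun_def scaleR_conv_of_real)
qed

text \<open>Through \<open>\<pi>\<close>, operators on equivalence classes become linear maps on functions.\<close>
lemma linear_representatives:
  fixes M :: "'a measure"
  assumes p: "0 \<le> p"
  obtains \<pi> :: "('a \<Rightarrow> complex) \<Rightarrow> 'a \<Rightarrow> complex" where "linear \<pi>" "\<And>f. \<pi> f \<in> lp_fun M p" "\<And>f. \<pi> (\<pi> f) = \<pi> f"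
    "\<And>f. f \<in> lp_fun M p \<Longrightarrow> AE x in M. \<pi> f x = f x"
    "\<And>f g. f \<in> lp_fun M p \<Longrightarrow> g \<in> lp_fun M p \<Longrightarrow> AE x in M. f x = g x \<Longrightarrow> \<pi> f = \<pi> g"
proof -
  let ?U = "lp_fun M p"
  define Z where "Z = {f \<in> ?U. AE x in M. f x = 0}"
  have U: "subspace ?U" using p by (rule lp_fun_subspace)
  have Z: "subspace Z"
  proof (rule subspaceI)
    show "0 \<in> Z" using subspace_0[OF U] by (simp add: Z_def)
    fix f g assume fg: "f \<in> Z" "g \<in> Z"
    then have "AE x in M. f x = 0" "AE x in M. g x = 0" by (auto simp: Z_def)
    then have "AE x in M. (f + g) x = 0" by eventually_elim simp
    then show "f + g \<in> Z" using fg U by (simp add: Z_def subspace_add)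
  next
    fix c f assume f: "f \<in> Z"
    then have "AE x in M. f x = 0" by (auto simp: Z_def)
    then have "AE x in M. (c *\<^sub>R f) x = 0" by eventually_elim simp
    then show "c *\<^sub>R f \<in> Z" using f U by (simp add: Z_def subspace_scale)
  qed
  \<comment> \<open>A basis of the null functions is extended to a basis \<open>C\<close> of the
    whole function space. Killing the former and fixing the rest of \<open>C\<close> defines a
    linear projection along \<open>Z\<close>.\<close>
  obtain B where B: "B \<subseteq> Z" "independent B" "Z \<subseteq> span B"
    using maximal_independent_subset[of Z] by blast
  have "B \<subseteq> ?U" using B by (auto simp: Z_def)
  then obtain C where C: "B \<subseteq> C" "C \<subseteq> ?U" "independent C" "?U \<subseteq> span C"
    using maximal_independent_subset_extend[OF _ B(2)] by blast
  define f where "f c = (if c \<in> B then 0 else c)" for c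
  obtain \<pi> where \<pi>: "linear \<pi>" "\<And>c. c \<in> C \<Longrightarrow> \<pi> c = f c" "range \<pi> = span (f ` C)"
    using linear_independent_extend_subspace[OF C(3), of f] by blast
  have "f ` C \<subseteq> ?U" using C subspace_0[OF U] by (auto simp: f_def)
  then have range: "\<pi> g \<in> ?U" for g
    using span_minimal[OF _ U, of "f ` C"] \<pi>(3) rangeI[of \<pi> g] by auto
  have idem: "\<pi> (\<pi> g) = \<pi> g" for g
  proof (rule linear_eq_on[OF \<pi>(1) linear_ident])
    show "\<pi> g \<in> span (f ` C)" using \<pi>(3) rangeI[of \<pi> g] by simp
    fix b assume "b \<in> f ` C"
    then obtain c where c: "c \<in> C" "b = f c" by blast
    then show "\<pi> b = b" using \<pi>(2) linear_0[OF \<pi>(1)] by (auto simp: f_def)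
  qed
  have B0: "\<pi> b = 0" if "b \<in> B" for b using that C(1) \<pi>(2) by (auto simp: f_def)
  have Z0: "\<pi> g = 0" if "g \<in> Z" for g
    by (rule linear_eq_0_on_span[OF \<pi>(1) B0 subsetD[OF B(3) that]])
  have "g \<in> span C \<Longrightarrow> \<pi> g - g \<in> Z" for g
  proof (induction rule: span_induct_alt)
    case base
    then show ?case using subspace_0[OF Z] by (simp only: linear_0[OF \<pi>(1)] diff_self)
  next
    case (step c x y)
    have "\<pi> x - x \<in> Z"
      using step \<pi>(2) B(1) subspace_0[OF Z] subspace_neg[OF Z] by (auto simp: f_def)
    from subspace_add[OF Z subspace_scale[OF Z this] step(2)]
    have "c *\<^sub>R (\<pi> x - x) + (\<pi> y - y) \<in> Z" .
    moreover have "\<pi> (c *\<^sub>R x + y) - (c *\<^sub>R x + y) = c *\<^sub>R (\<pi> x - x) + (\<pi> y - y)"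
      by (simp add: linear_add[OF \<pi>(1)] linear_scale[OF \<pi>(1)] scaleR_diff_right)
    ultimately show ?case by (simp only:)
  qed
  then have near: "\<pi> g - g \<in> Z" if "g \<in> ?U" for g using that C(4) by blast
  show ?thesis
  proof (rule that[OF \<pi>(1) range idem])
    fix g assume "g \<in> ?U"
    then have "AE x in M. (\<pi> g - g) x = 0" using near by (simp add: Z_def)
    then show "AE x in M. \<pi> g x = g x" by eventually_elim simp
  next
    fix g h assume gh: "g \<in> ?U" "h \<in> ?U" "AE x in M. g x = h x"
    have "AE x in M. (g - h) x = 0" using gh(3) by eventually_elim simp
    then have "g - h \<in> Z" using gh U by (simp add: Z_def subspace_diff)
    then show "\<pi> g = \<pi> h" using Z0[of "g - h"] by (simp add: linear_diff[OF \<pi>(1)])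
  qed
qed

section \<open>Pointwise norms of finite families and the positive cone\<close>

lemma nonneg_Reals_norm: "z \<in> \<real>\<^sub>\<ge>\<^sub>0 \<Longrightarrow> z = complex_of_real (norm z)"
  by (auto elim!: nonneg_Reals_cases)

lemma of_real_nonneg_Reals: "0 \<le> r \<Longrightarrow> complex_of_real r \<in> \<real>\<^sub>\<ge>\<^sub>0"
  by simp

text \<open>The pointwise \<open>\<ell>\<^sup>p\<close> norm of the family: its \<open>p\<close>-th
  power integrates to the sum of the \<open>p\<close>-th powers of the norms, and the Holder
  inequality at each point gives the domination.\<close>

lemma Lp_lattice_upper:
  assumes pq: "1 < p" "1 < q" "1 / p + 1 / q = 1" and I: "finite I"
    and z: "\<And>i. i \<in> I \<Longrightarrow> z i \<in> lp_fun M p" "\<And>i. i \<in> I \<Longrightarrow> AE x in M. z i x \<in> \<real>\<^sub>\<ge>\<^sub>0"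
  defines "F \<equiv> \<lambda>x. complex_of_real ((\<Sum>i\<in>I. norm (z i x) powr p) powr (1 / p))"
  shows "F \<in> lp_fun M p" and "Lp_norm M p F powr p = (\<Sum>i\<in>I. Lp_norm M p (z i) powr p)"
    and "\<And>c. (\<And>i. i \<in> I \<Longrightarrow> 0 \<le> c i) \<Longrightarrow> (\<Sum>i\<in>I. c i powr q) \<le> 1 \<Longrightarrow>
      AE x in M. F x - (\<Sum>i\<in>I. of_real (c i) * z i x) \<in> \<real>\<^sub>\<ge>\<^sub>0"
proof -
  have F: "norm (F x) powr p = (\<Sum>i\<in>I. norm (z i x) powr p)" for x
    using pq by (simp add: F_def powr_powr sum_nonneg)
  have [measurable]: "z i \<in> borel_measurable M" if "i \<in> I" for i
    using z(1)[OF that] by (rule lp_fun_measurable)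
  have "integrable M (\<lambda>x. norm (F x) powr p)"
    unfolding F using z(1) by (intro Bochner_Integration.integrable_sum lp_fun_integrable)
  moreover have "F \<in> borel_measurable M" unfolding F_def by measurable
  ultimately show "F \<in> lp_fun M p" by (simp add: lp_fun_def)
  show "Lp_norm M p F powr p = (\<Sum>i\<in>I. Lp_norm M p (z i) powr p)"
    using pq z(1) by (simp add: Lp_norm_powr F lp_fun_integrable)
  fix c :: "_ \<Rightarrow> real" assume c: "\<And>i. i \<in> I \<Longrightarrow> 0 \<le> c i" "(\<Sum>i\<in>I. c i powr q) \<le> 1"
  have "AE x in M. \<forall>i\<in>I. z i x \<in> \<real>\<^sub>\<ge>\<^sub>0" using I z(2) by (intro AE_finite_allI) auto
  then show "AE x in M. F x - (\<Sum>i\<in>I. of_real (c i) * z i x) \<in> \<real>\<^sub>\<ge>\<^sub>0"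
  proof eventually_elim
    case (elim x)
    have "(\<Sum>i\<in>I. norm (z i x) * c i) \<le>
        (\<Sum>i\<in>I. norm (z i x) powr p) powr (1 / p) * (\<Sum>i\<in>I. c i powr q) powr (1 / q)"
      using pq c by (intro Holder_sum) auto
    also have "\<dots> \<le> (\<Sum>i\<in>I. norm (z i x) powr p) powr (1 / p) * 1"
      using c pq powr_mono2[of "1 / q" "\<Sum>i\<in>I. c i powr q" 1] by (intro mult_left_mono) (auto simp: sum_nonneg)
    finally have "complex_of_real ((\<Sum>i\<in>I. norm (z i x) powr p) powr (1 / p) - (\<Sum>i\<in>I. norm (z i x) * c i)) \<in> \<real>\<^sub>\<ge>\<^sub>0"
      by (intro of_real_nonneg_Reals) simp
    moreover have "(\<Sum>i\<in>I. of_real (c i) * z i x) = complex_of_real (\<Sum>i\<in>I. norm (z i x) * c i)"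
      unfolding of_real_sum of_real_mult mult.commute[of "complex_of_real (norm _)"]
      using elim by (intro sum.cong refl arg_cong2[of _ _ _ _ "(*)"] nonneg_Reals_norm) auto
    ultimately show ?case by (simp only: F_def of_real_diff)
  qed
qed

text \<open>Duality of \<open>\<ell>\<^sup>p\<close> and \<open>\<ell>\<^sup>q\<close> tested only
  on nonnegative rational coefficients with a common denominator. Such tests form a countable
  family, which is what an almost-everywhere argument can afford.\<close>

lemma sum_powr_le_of_dual:
  fixes a :: "'j \<Rightarrow> real"
  assumes pq: "1 < p" "1 / p + 1 / q = 1" and J: "finite J" and a: "\<And>j. j \<in> J \<Longrightarrow> 0 \<le> a j" and G: "0 \<le> G"
    and dual: "\<And>k (n::nat). k \<in> PiE J (\<lambda>_. UNIV :: nat set) \<Longrightarrow>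
      (\<Sum>j\<in>J. (real (k j) / real (Suc n)) powr q) \<le> 1 \<Longrightarrow> (\<Sum>j\<in>J. real (k j) / real (Suc n) * a j) \<le> G"
  shows "(\<Sum>j\<in>J. a j powr p) \<le> G powr p"
proof (cases "(\<Sum>j\<in>J. a j powr p) = 0")
  case False
  define A where "A = (\<Sum>j\<in>J. a j powr p)"
  have A: "0 < A" using False by (auto simp: A_def less_le intro!: sum_nonneg)
  have q: "1 / q = 1 - 1 / p" "0 < q" "(p - 1) * q = p"
  proof -
    show *: "1 / q = 1 - 1 / p" using pq by simp
    have "0 < 1 - 1 / p" using pq by simp
    then have "0 < 1 / q" using * by linarith
    then show "0 < q" by simp
    show "(p - 1) * q = p" using * \<open>0 < q\<close> pq by (simp add: field_simps)
  qed
  \<comment> \<open>The extremal coefficients of the Holder inequality, of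
    \<open>\<ell>\<^sup>q\<close> norm 1. Rounding them down to multiples of
    \<open>1 / Suc n\<close> preserves the constraint, so \<open>dual\<close> applies to the
    approximations.\<close>
  define c where "c j = a j powr (p - 1) / A powr (1 / q)" for j
  have c0: "0 \<le> c j" for j by (simp add: c_def)
  have cq: "(\<Sum>j\<in>J. c j powr q) = 1"
    using A q(2,3) by (simp add: c_def powr_divide powr_powr A_def[symmetric] flip: sum_divide_distrib)
  define k where "k n = restrict (\<lambda>j. nat \<lfloor>c j * real (Suc n)\<rfloor>) J" for n
  have kle: "real (k n j) / real (Suc n) \<le> c j" if "j \<in> J" for n j
    using that c0[of j] of_int_floor_le[of "c j * real (Suc n)"] by (simp add: k_def divide_le_eq)
  have kge: "c j - 1 / real (Suc n) \<le> real (k n j) / real (Suc n)" if "j \<in> J" for n j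
  proof -
    have "c j * real (Suc n) - 1 \<le> real (k n j)"
      using that c0[of j] by (simp add: k_def)
    then have "(c j * real (Suc n) - 1) / real (Suc n) \<le> real (k n j) / real (Suc n)"
      by (rule divide_right_mono) simp
    then show ?thesis by (simp add: diff_divide_distrib del: of_nat_Suc)
  qed
  have lim: "(\<lambda>n. real (k n j) / real (Suc n)) \<longlonglongrightarrow> c j" if "j \<in> J" for j
  proof (rule tendsto_sandwich[of "\<lambda>n. c j - 1 / real (Suc n)" _ _ "\<lambda>_. c j"])
    have "(\<lambda>n. c j - 1 / real (Suc n)) \<longlonglongrightarrow> c j - 0"
      using LIMSEQ_inverse_real_of_nat by (intro tendsto_intros) (simp add: inverse_eq_divide)
    then show "(\<lambda>n. c j - 1 / real (Suc n)) \<longlonglongrightarrow> c j" by simp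
  qed (use kle kge that in auto)
  have "(\<lambda>n. \<Sum>j\<in>J. real (k n j) / real (Suc n) * a j) \<longlonglongrightarrow> (\<Sum>j\<in>J. c j * a j)"
    by (intro tendsto_sum tendsto_mult_right lim)
  moreover have "(\<Sum>j\<in>J. real (k n j) / real (Suc n) * a j) \<le> G" for n
  proof (rule dual)
    show "k n \<in> PiE J (\<lambda>_. UNIV)" by (simp add: k_def)
    have "(\<Sum>j\<in>J. (real (k n j) / real (Suc n)) powr q) \<le> (\<Sum>j\<in>J. c j powr q)"
      using kle q by (intro sum_mono powr_mono2) auto
    then show "(\<Sum>j\<in>J. (real (k n j) / real (Suc n)) powr q) \<le> 1" using cq by simp
  qed
  ultimately have "(\<Sum>j\<in>J. c j * a j) \<le> G" by (intro LIMSEQ_le_const2) auto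
  also have "(\<Sum>j\<in>J. c j * a j) = A / A powr (1 / q)"
  proof -
    have "c j * a j = a j powr p / A powr (1 / q)" if "j \<in> J" for j
      using a[OF that] pq by (cases "a j = 0") (auto simp: c_def powr_diff)
    then have "(\<Sum>j\<in>J. c j * a j) = (\<Sum>j\<in>J. a j powr p / A powr (1 / q))" by (rule sum.cong[OF refl])
    then show ?thesis by (simp add: A_def sum_divide_distrib)
  qed
  also have "\<dots> = A powr (1 / p)" using A by (simp add: q(1) powr_diff)
  finally have "(A powr (1 / p)) powr p \<le> G powr p" using pq by (intro powr_mono2) auto
  then show ?thesis using A pq by (simp add: powr_powr A_def)
qed (use G in simp)

text \<open>Each coefficient family has its own exceptional null set. Restriction to the countably
  many rational families gives one common null set, off which \<open>sum_powr_le_of_dual\<close>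
  holds pointwise and can be integrated.\<close>

lemma Lp_lattice_lower:
  assumes pq: "1 < p" "1 / p + 1 / q = 1" and J: "finite J"
    and g: "\<And>j. j \<in> J \<Longrightarrow> g j \<in> lp_fun M p" "\<And>j. j \<in> J \<Longrightarrow> AE x in M. g j x \<in> \<real>\<^sub>\<ge>\<^sub>0"
    and G: "G \<in> lp_fun M p" "AE x in M. G x \<in> \<real>\<^sub>\<ge>\<^sub>0"
    and dual: "\<And>c. (\<And>j. j \<in> J \<Longrightarrow> 0 \<le> c j) \<Longrightarrow> (\<Sum>j\<in>J. c j powr q) \<le> 1 \<Longrightarrow>
      AE x in M. G x - (\<Sum>j\<in>J. of_real (c j) * g j x) \<in> \<real>\<^sub>\<ge>\<^sub>0"
  shows "(\<Sum>j\<in>J. Lp_norm M p (g j) powr p) \<le> Lp_norm M p G powr p"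
proof -
  let ?P = "PiE J (\<lambda>_. UNIV :: nat set)"
  have "countable ?P" using J by (intro countable_PiE) auto
  have "AE x in M. \<forall>n. \<forall>k\<in>?P. (\<Sum>j\<in>J. (real (k j) / real (Suc n)) powr q) \<le> 1 \<longrightarrow>
      G x - (\<Sum>j\<in>J. of_real (real (k j) / real (Suc n)) * g j x) \<in> \<real>\<^sub>\<ge>\<^sub>0"
    unfolding AE_all_countable AE_ball_countable[OF \<open>countable ?P\<close>]
  proof (intro allI ballI)
    fix n k
    show "AE x in M. (\<Sum>j\<in>J. (real (k j) / real (Suc n)) powr q) \<le> 1 \<longrightarrow>
      G x - (\<Sum>j\<in>J. of_real (real (k j) / real (Suc n)) * g j x) \<in> \<real>\<^sub>\<ge>\<^sub>0"
      using dual[of "\<lambda>j. real (k j) / real (Suc n)"]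
      by (cases "(\<Sum>j\<in>J. (real (k j) / real (Suc n)) powr q) \<le> 1") auto
  qed
  moreover have "AE x in M. \<forall>j\<in>J. g j x \<in> \<real>\<^sub>\<ge>\<^sub>0" using J g(2) by (intro AE_finite_allI) auto
  ultimately have ae: "AE x in M. (\<Sum>j\<in>J. norm (g j x) powr p) \<le> norm (G x) powr p"
    using G(2)
  proof eventually_elim
    case (elim x)
    show ?case
    proof (rule sum_powr_le_of_dual[OF pq J])
      fix k n assume k: "k \<in> ?P" "(\<Sum>j\<in>J. (real (k j) / real (Suc n)) powr q) \<le> 1"
      let ?s = "\<Sum>j\<in>J. real (k j) / real (Suc n) * norm (g j x)"
      have "(\<Sum>j\<in>J. of_real (real (k j) / real (Suc n)) * g j x) = complex_of_real ?s"
        unfolding of_real_sum of_real_mult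
        using elim(2) by (intro sum.cong refl arg_cong2[of _ _ _ _ "(*)"] nonneg_Reals_norm) auto
      moreover have "G x - (\<Sum>j\<in>J. of_real (real (k j) / real (Suc n)) * g j x) \<in> \<real>\<^sub>\<ge>\<^sub>0"
        using elim(1) k by blast
      ultimately have "complex_of_real (norm (G x) - ?s) \<in> \<real>\<^sub>\<ge>\<^sub>0"
        using nonneg_Reals_norm[OF elim(3)] by (simp only: of_real_diff)
      then show "?s \<le> norm (G x)"
        unfolding complex_nonneg_Reals_iff by simp
    qed auto
  qed
  have "(\<Sum>j\<in>J. Lp_norm M p (g j) powr p) = (LINT x|M. (\<Sum>j\<in>J. norm (g j x) powr p))"
    using pq g(1) by (simp add: Lp_norm_powr lp_fun_integrable)
  also have "\<dots> \<le> (LINT x|M. norm (G x) powr p)"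
    using g(1) G(1) ae by (intro integral_mono_AE Bochner_Integration.integrable_sum lp_fun_integrable)
  finally show ?thesis using pq by (simp add: Lp_norm_powr)
qed

text \<open>The pointwise distance of \<open>g\<close> to the closed half-line of nonnegative reals
  is at most the modulus of \<open>f n - g\<close>. Its norm is therefore 0, without passing to a
  subsequence.\<close>

lemma Lp_cone_closed:
  assumes p: "1 \<le> p" and f: "\<And>n::nat. f n \<in> lp_fun M p" "\<And>n. AE x in M. f n x \<in> \<real>\<^sub>\<ge>\<^sub>0"
    and g: "g \<in> lp_fun M p" and lim: "(\<lambda>n. Lp_norm M p (\<lambda>x. f n x - g x)) \<longlonglongrightarrow> 0"
  shows "AE x in M. g x \<in> \<real>\<^sub>\<ge>\<^sub>0"
proof -
  let ?d = "\<lambda>x. complex_of_real (infdist (g x) \<real>\<^sub>\<ge>\<^sub>0)"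
  have [measurable]: "g \<in> borel_measurable M" using g by (rule lp_fun_measurable)
  have "(\<lambda>z::complex. infdist z \<real>\<^sub>\<ge>\<^sub>0) \<in> borel_measurable borel"
    by (intro borel_measurable_continuous_onI continuous_intros)
  then have dm: "?d \<in> borel_measurable M" by measurable
  have "infdist (g x) \<real>\<^sub>\<ge>\<^sub>0 \<le> norm (g x)" for x
    using infdist_le[of 0 "\<real>\<^sub>\<ge>\<^sub>0" "g x"] by (simp add: dist_norm)
  then have le: "AE x in M. norm (norm (?d x) powr p) \<le> norm (norm (g x) powr p)"
    using p by (intro AE_I2) (simp add: powr_mono2 infdist_nonneg)
  have "integrable M (\<lambda>x. norm (?d x) powr p)"
    by (rule Bochner_Integration.integrable_bound[OF lp_fun_integrable[OF g] _ le])
      (use dm in measurable)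
  then have d: "?d \<in> lp_fun M p" unfolding lp_fun_def using dm by blast
  have "Lp_norm M p ?d \<le> Lp_norm M p (\<lambda>x. f n x - g x)" for n
  proof (rule Lp_norm_mono_AE[OF _ d])
    show "(\<lambda>x. f n x - g x) \<in> lp_fun M p"
      using lp_fun_add[OF _ f(1)[of n] lp_fun_scale[OF g, of "-1"]] p by simp
    show "AE x in M. norm (?d x) \<le> norm (f n x - g x)"
      using f(2)[of n]
    proof eventually_elim
      case (elim x)
      then show ?case using infdist_le[OF elim, of "g x"] by (simp add: dist_norm norm_minus_commute infdist_nonneg)
    qed
  qed (use p in simp)
  then have "Lp_norm M p ?d \<le> 0" using lim by (intro LIMSEQ_le_const) auto
  then have "Lp_norm M p ?d = 0" using Lp_norm_nonneg[of M p ?d] by simp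
  from Lp_norm_eq_0[OF d this] show ?thesis
  proof eventually_elim
    case (elim x)
    have "(0 :: complex) \<in> \<real>\<^sub>\<ge>\<^sub>0" by simp
    then have "(\<real>\<^sub>\<ge>\<^sub>0 :: complex set) \<noteq> {}" by blast
    from in_closed_iff_infdist_zero[OF closed_nonneg_Reals_complex this, of "g x"]
    show ?case using elim by simp
  qed
qed

section \<open>Transfer to the Lebesgue space\<close>

locale lp_representation =
  fixes M :: "'a measure" and p :: real and \<pi> :: "('a \<Rightarrow> complex) \<Rightarrow> 'a \<Rightarrow> complex"
  assumes p: "1 < p"
    and pi_linear: "linear \<pi>"
    and pi_lp: "\<pi> f \<in> lp_fun M p"
    and pi_idem: "\<pi> (\<pi> f) = \<pi> f"
    and pi_AE: "f \<in> lp_fun M p \<Longrightarrow> AE x in M. \<pi> f x = f x"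
    and pi_cong: "f \<in> lp_fun M p \<Longrightarrow> g \<in> lp_fun M p \<Longrightarrow> AE x in M. f x = g x \<Longrightarrow> \<pi> f = \<pi> g"
begin

abbreviation X where "X \<equiv> Lp M p"
abbreviation cls where "cls \<equiv> lp_class M p"
abbreviation N where "N \<equiv> Lp_norm M p"

definition V :: "('a \<Rightarrow> complex) set" where "V = range \<pi>"

lemma V_lp: "v \<in> V \<Longrightarrow> v \<in> lp_fun M p"
  using pi_lp by (auto simp: V_def)

lemma pi_V: "v \<in> V \<Longrightarrow> \<pi> v = v"
  using pi_idem by (auto simp: V_def)

lemma pi_in_V: "\<pi> f \<in> V"
  by (simp add: V_def)

lemma cls_pi: "f \<in> lp_fun M p \<Longrightarrow> cls (\<pi> f) = cls f"
  using lp_class_eq_iff[OF pi_lp] pi_AE by blast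

lemma cls_inj: "v \<in> V \<Longrightarrow> w \<in> V \<Longrightarrow> cls v = cls w \<Longrightarrow> v = w"
  using lp_class_eq_iff[OF V_lp V_lp] pi_cong[OF V_lp V_lp] pi_V by metis

lemma cls_carrier: "v \<in> V \<Longrightarrow> cls v \<in> carrier X"
  by (intro lp_class_in_carrier V_lp)

lemma N_pi: "f \<in> lp_fun M p \<Longrightarrow> N (\<pi> f) = N f"
  by (intro Lp_norm_cong_AE lp_fun_measurable[where p = p] pi_lp pi_AE)

lemma vnorm_cls_lp: "f \<in> lp_fun M p \<Longrightarrow> vnorm X (cls f) = N f"
  by (simp add: vnorm_Lp Lp_norm_def)

lemma vnorm_cls: "v \<in> V \<Longrightarrow> vnorm X (cls v) = N v"
  by (intro vnorm_cls_lp V_lp)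

lemma vadd_cls: "v \<in> V \<Longrightarrow> w \<in> V \<Longrightarrow> vadd X (cls v) (cls w) = cls (v + w)"
  using p by (simp add: vadd_Lp V_lp plus_fun_def)

lemma vscale_cls: "v \<in> V \<Longrightarrow> vscale X (of_real c) (cls v) = cls (c *\<^sub>R v)"
  by (simp add: vscale_Lp V_lp scaleR_fun_def scaleR_conv_of_real)

lemma subspace_V: "subspace V"
  unfolding V_def by (intro linear_subspace_image pi_linear subspace_UNIV)

sublocale normed_subspace V N
proof
  show "subspace V" by (rule subspace_V)
  show "0 \<le> N x" for x by (rule Lp_norm_nonneg)
  show "N (c *\<^sub>R x) = \<bar>c\<bar> * N x" for c x
    using Lp_norm_scale[of p M "of_real c" x] p by (simp add: scaleR_fun_def scaleR_conv_of_real)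
  show "N (x + y) \<le> N x + N y" if "x \<in> V" "y \<in> V" for x y
    using Lp_norm_triangle[of p x M y] V_lp that p by (simp add: plus_fun_def)
qed

lemma N_eq_0: "v \<in> V \<Longrightarrow> N v = 0 \<Longrightarrow> v = 0"
proof -
  assume v: "v \<in> V" "N v = 0"
  have "AE x in M. v x = (0 :: 'a \<Rightarrow> complex) x" using Lp_norm_eq_0[OF V_lp[OF v(1)] v(2)] by simp
  then have "\<pi> v = \<pi> 0" using V_lp v subspace_0[OF subspace_V] by (intro pi_cong) auto
  then show "v = 0" using v pi_V linear_0[OF pi_linear] by simp
qed

lemma vdiff_cls: "v \<in> V \<Longrightarrow> w \<in> V \<Longrightarrow> vdiff X (cls v) (cls w) = cls (v - w)"
proof -
  assume v: "v \<in> V" "w \<in> V"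
  have "vdiff X (cls v) (cls w) = cls (v + (- 1) *\<^sub>R w)"
    unfolding vdiff_def using v vscale_cls[of w "-1"] vadd_cls[of v "(-1) *\<^sub>R w"] V_closed(4)[of w "-1"] by simp
  then show ?thesis by simp
qed

lemma some_representative:
  assumes "F \<in> carrier X"
  shows "(SOME g. g \<in> F) \<in> lp_fun M p" "cls (SOME g. g \<in> F) = F"
proof -
  obtain f where f: "f \<in> lp_fun M p" "F = cls f" using assms by (rule Lp_carrier_cases)
  have "f \<in> F" using f by (simp add: lp_class_def lp_rel_def)
  then have "(SOME g. g \<in> F) \<in> F" by (rule someI[of "\<lambda>g. g \<in> F"])
  then have g: "(SOME g. g \<in> F) \<in> lp_fun M p" "AE x in M. f x = (SOME g. g \<in> F) x"
    using f by (auto simp: lp_class_def lp_rel_def)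
  then show "(SOME g. g \<in> F) \<in> lp_fun M p" by simp
  show "cls (SOME g. g \<in> F) = F" using lp_class_eq_iff[OF f(1) g(1)] g(2) f(2) by simp
qed

lemma carrier_V_cases:
  assumes "F \<in> carrier X"
  obtains v where "v \<in> V" "F = cls v"
  using some_representative[OF assms] cls_pi pi_in_V by metis

text \<open>The inner \<open>\<pi>\<close> makes the map linear on all functions, as the abstract
  locales require; the outer one makes the arbitrary representative chosen by \<open>SOME\<close>
  canonical.\<close>

definition lift :: "(('a \<Rightarrow> complex) set \<Rightarrow> ('a \<Rightarrow> complex) set) \<Rightarrow> ('a \<Rightarrow> complex) \<Rightarrow> 'a \<Rightarrow> complex" where
  "lift S f = \<pi> (SOME g. g \<in> S (cls (\<pi> f)))"

lemma lift_V [simp]: "lift S f \<in> V"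
  by (simp add: lift_def pi_in_V)

lemma bounded_operatorD:
  assumes "bounded_operator X S"
  shows "F \<in> carrier X \<Longrightarrow> S F \<in> carrier X"
    and "F \<in> carrier X \<Longrightarrow> G \<in> carrier X \<Longrightarrow> S (vadd X F G) = vadd X (S F) (S G)"
    and "F \<in> carrier X \<Longrightarrow> S (vscale X c F) = vscale X c (S F)"
    and "\<exists>C. \<forall>F\<in>carrier X. vnorm X (S F) \<le> C * vnorm X F"
  using assms unfolding bounded_operator_def by auto

lemma cls_lift_pi: "bounded_operator X S \<Longrightarrow> cls (lift S f) = S (cls (\<pi> f))"
  using some_representative[OF bounded_operatorD(1)[OF _ cls_carrier[OF pi_in_V]]] cls_pi
  by (simp add: lift_def)

lemma cls_lift: "bounded_operator X S \<Longrightarrow> v \<in> V \<Longrightarrow> cls (lift S v) = S (cls v)"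
  by (simp add: cls_lift_pi pi_V)

lemma lift_linear:
  assumes S: "bounded_operator X S"
  shows "linear (lift S)"
proof (rule linearI)
  fix f g
  show "lift S (f + g) = lift S f + lift S g"
  proof (rule cls_inj)
    have "cls (lift S (f + g)) = S (vadd X (cls (\<pi> f)) (cls (\<pi> g)))"
      using S pi_in_V by (simp add: cls_lift_pi linear_add[OF pi_linear] vadd_cls)
    also have "\<dots> = vadd X (cls (lift S f)) (cls (lift S g))"
      using S by (simp add: bounded_operatorD(2) cls_carrier pi_in_V cls_lift_pi)
    also have "\<dots> = cls (lift S f + lift S g)" by (simp add: vadd_cls)
    finally show "cls (lift S (f + g)) = cls (lift S f + lift S g)" .
  qed auto
next
  fix c f
  show "lift S (c *\<^sub>R f) = c *\<^sub>R lift S f"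
  proof (rule cls_inj)
    have "cls (lift S (c *\<^sub>R f)) = S (vscale X (of_real c) (cls (\<pi> f)))"
      using S pi_in_V by (simp add: cls_lift_pi linear_scale[OF pi_linear] vscale_cls)
    also have "\<dots> = vscale X (of_real c) (cls (lift S f))"
      using S by (simp add: bounded_operatorD(3) cls_carrier pi_in_V cls_lift_pi)
    also have "\<dots> = cls (c *\<^sub>R lift S f)" by (simp add: vscale_cls)
    finally show "cls (lift S (c *\<^sub>R f)) = cls (c *\<^sub>R lift S f)" .
  qed auto
qed

lemma N_lift: "bounded_operator X S \<Longrightarrow> v \<in> V \<Longrightarrow> N (lift S v) = vnorm X (S (cls v))"
  by (simp add: cls_lift[symmetric] vnorm_cls)

lemma lift_bounded: "bounded_operator X S \<Longrightarrow> \<exists>C. \<forall>v\<in>V. N (lift S v) \<le> C * N v"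
  using bounded_operatorD(4) cls_carrier vnorm_cls by (metis N_lift)

lemma op_norm_upper:
  assumes S: "bounded_operator X S" and F: "F \<in> carrier X" "vnorm X F \<le> 1"
  shows "vnorm X (S F) \<le> op_norm X S"
proof -
  obtain C where C: "\<And>F. F \<in> carrier X \<Longrightarrow> vnorm X (S F) \<le> C * vnorm X F"
    using bounded_operatorD(4)[OF S] by blast
  have "bdd_above ((\<lambda>F. vnorm X (S F)) ` {F \<in> carrier X. vnorm X F \<le> 1})"
  proof (rule bdd_aboveI2)
    fix G assume G: "G \<in> {F \<in> carrier X. vnorm X F \<le> 1}"
    then obtain u where u: "u \<in> V" "G = cls u" using carrier_V_cases by blast
    have "C * N u \<le> \<bar>C\<bar> * 1" using G u N_nonneg[of u] by (intro mult_mono) (auto simp: vnorm_cls)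
    then show "vnorm X (S G) \<le> \<bar>C\<bar>" using C[OF cls_carrier[OF u(1)]] u by (simp add: vnorm_cls)
  qed
  then show ?thesis unfolding op_norm_def using F by (intro cSUP_upper) auto
qed

lemma lift_op_norm:
  assumes S: "bounded_operator X S" and v: "v \<in> V"
  shows "N (lift S v) \<le> op_norm X S * N v"
proof (cases "N v = 0")
  case True
  then show ?thesis using lift_bounded[OF S] v by fastforce
next
  case False
  then have pos: "0 < N v" using N_nonneg[of v] by simp
  let ?w = "(1 / N v) *\<^sub>R v"
  have w: "?w \<in> V" "N ?w \<le> 1" using v pos by (auto simp: N_scale)
  then have "N (lift S ?w) \<le> op_norm X S"
    using op_norm_upper[OF S cls_carrier[OF w(1)]] by (simp add: N_lift[OF S] vnorm_cls)
  moreover have "N (lift S ?w) = N (lift S v) / N v"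
    using pos by (simp add: linear_scale[OF lift_linear[OF S]] N_scale)
  ultimately show ?thesis using pos by (simp add: field_simps)
qed

lemma op_norm_le:
  assumes S: "bounded_operator X S" and b: "0 \<le> b" "\<And>v. v \<in> V \<Longrightarrow> vnorm X (S (cls v)) \<le> b * N v"
  shows "op_norm X S \<le> b"
  unfolding op_norm_def
proof (rule cSUP_least)
  have "cls 0 \<in> {F \<in> carrier X. vnorm X F \<le> 1}"
    using V_closed(1) by (simp add: cls_carrier vnorm_cls)
  then show "{F \<in> carrier X. vnorm X F \<le> 1} \<noteq> {}" by blast
  fix F assume F: "F \<in> {F \<in> carrier X. vnorm X F \<le> 1}"
  then obtain v where v: "v \<in> V" "F = cls v" using carrier_V_cases by blast
  then have "N v \<le> 1" using F vnorm_cls by simp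
  then have "b * N v \<le> b" using b(1) by (simp add: mult_left_le)
  then show "vnorm X (S F) \<le> b" using b(2)[OF v(1)] v by simp
qed

lemma complete:
  assumes "\<And>k::nat. f k \<in> V" "summable (\<lambda>k. N (f k))"
  shows "\<exists>x\<in>V. (\<lambda>n. N ((\<Sum>k<n. f k) - x)) \<longlonglongrightarrow> 0"
proof -
  obtain g where g: "g \<in> lp_fun M p" "(\<lambda>n. N (\<lambda>x. (\<Sum>k<n. f k x) - g x)) \<longlonglongrightarrow> 0"
    using Lp_complete[of p f M] assms p V_lp by auto
  have eq: "N ((\<Sum>k<n. f k) - \<pi> g) = N (\<lambda>x. (\<Sum>k<n. f k x) - g x)" for n
  proof (rule Lp_norm_cong_AE)
    have "(\<lambda>x. (\<Sum>k<n. f k x)) \<in> lp_fun M p" using assms p V_lp by (intro lp_fun_sum) auto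
    then show "(\<lambda>x. (\<Sum>k<n. f k x) - g x) \<in> borel_measurable M"
      using g(1) by (intro borel_measurable_diff lp_fun_measurable)
    show "(\<Sum>k<n. f k) - \<pi> g \<in> borel_measurable M"
      using assms by (intro lp_fun_measurable[where p = p] V_lp V_closed pi_in_V)
    show "AE x in M. ((\<Sum>k<n. f k) - \<pi> g) x = (\<Sum>k<n. f k x) - g x"
      using pi_AE[OF g(1)] by eventually_elim (simp add: sum_fun_apply)
  qed
  show ?thesis using g(2) by (intro bexI[of _ "\<pi> g"] pi_in_V) (simp add: eq)
qed

section \<open>The order structure on representatives\<close>

definition K :: "('a \<Rightarrow> complex) set" where "K = {v \<in> V. AE x in M. v x \<in> \<real>\<^sub>\<ge>\<^sub>0}"

lemma cls_cone_iff: "v \<in> V \<Longrightarrow> cls v \<in> Lp_cone M p \<longleftrightarrow> v \<in> K"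
  by (simp add: K_def lp_class_in_cone_iff V_lp)

lemma K_upper:
  assumes pq: "1 / p + 1 / q = 1" "1 < q" and I: "finite I" and z: "\<And>i. i \<in> I \<Longrightarrow> z i \<in> K"
  shows "\<exists>F\<in>K. N F powr p \<le> (\<Sum>i\<in>I. N (z i) powr p) \<and>
     (\<forall>c. (\<forall>i\<in>I. 0 \<le> c i) \<and> (\<Sum>i\<in>I. c i powr q) \<le> 1 \<longrightarrow> F - (\<Sum>i\<in>I. c i *\<^sub>R z i) \<in> K)"
proof -
  define F where "F x = complex_of_real ((\<Sum>i\<in>I. norm (z i x) powr p) powr (1 / p))" for x
  have zV: "z i \<in> V" "AE x in M. z i x \<in> \<real>\<^sub>\<ge>\<^sub>0" if "i \<in> I" for i using z[OF that] by (auto simp: K_def)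
  note L = Lp_lattice_upper[of p q I z M, folded F_def, OF p pq(2,1) I]
  have F: "F \<in> lp_fun M p" "N F powr p = (\<Sum>i\<in>I. N (z i) powr p)"
    using zV V_lp by (auto intro!: L(1,2))
  have "AE x in M. F x \<in> \<real>\<^sub>\<ge>\<^sub>0" by (rule AE_I2) (simp add: F_def)
  with pi_AE[OF F(1)] have "AE x in M. \<pi> F x \<in> \<real>\<^sub>\<ge>\<^sub>0" by eventually_elim simp
  then have "\<pi> F \<in> K" by (simp add: K_def pi_in_V)
  moreover have "N (\<pi> F) powr p \<le> (\<Sum>i\<in>I. N (z i) powr p)" using F by (simp add: N_pi)
  moreover have "\<pi> F - (\<Sum>i\<in>I. c i *\<^sub>R z i) \<in> K" if c: "\<forall>i\<in>I. 0 \<le> c i" "(\<Sum>i\<in>I. c i powr q) \<le> 1" for c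
  proof -
    have "AE x in M. F x - (\<Sum>i\<in>I. of_real (c i) * z i x) \<in> \<real>\<^sub>\<ge>\<^sub>0" using c zV V_lp by (intro L(3)) auto
    with pi_AE[OF F(1)] have "AE x in M. (\<pi> F - (\<Sum>i\<in>I. c i *\<^sub>R z i)) x \<in> \<real>\<^sub>\<ge>\<^sub>0"
      by eventually_elim (simp add: sum_fun_apply scaleR_conv_of_real)
    then show ?thesis using zV(1) by (simp add: K_def pi_in_V V_closed)
  qed
  ultimately show ?thesis by blast
qed

lemma K_lower:
  assumes pq: "1 / p + 1 / q = 1" and J: "finite J" and g: "\<And>j. j \<in> J \<Longrightarrow> g j \<in> K" and G: "G \<in> K"
    and dual: "\<And>c. (\<And>j. j \<in> J \<Longrightarrow> 0 \<le> c j) \<Longrightarrow> (\<Sum>j\<in>J. c j powr q) \<le> 1 \<Longrightarrow> G - (\<Sum>j\<in>J. c j *\<^sub>R g j) \<in> K"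
  shows "(\<Sum>j\<in>J. N (g j) powr p) \<le> N G powr p"
proof (rule Lp_lattice_lower[OF p pq J])
  show "g j \<in> lp_fun M p" "AE x in M. g j x \<in> \<real>\<^sub>\<ge>\<^sub>0" if "j \<in> J" for j
    using g[OF that] V_lp by (auto simp: K_def)
  show "G \<in> lp_fun M p" "AE x in M. G x \<in> \<real>\<^sub>\<ge>\<^sub>0" using G V_lp by (auto simp: K_def)
  fix c :: "_ \<Rightarrow> real" assume c: "\<And>j. j \<in> J \<Longrightarrow> 0 \<le> c j" "(\<Sum>j\<in>J. c j powr q) \<le> 1"
  have "AE x in M. (G - (\<Sum>j\<in>J. c j *\<^sub>R g j)) x \<in> \<real>\<^sub>\<ge>\<^sub>0" using dual[OF c] by (simp add: K_def)
  then show "AE x in M. G x - (\<Sum>j\<in>J. of_real (c j) * g j x) \<in> \<real>\<^sub>\<ge>\<^sub>0"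
    by eventually_elim (simp add: sum_fun_apply scaleR_conv_of_real)
qed

lemma K_props:
  shows "v \<in> K \<Longrightarrow> v \<in> V" and "0 \<in> K" and "v \<in> K \<Longrightarrow> w \<in> K \<Longrightarrow> v + w \<in> K"
    and "v \<in> K \<Longrightarrow> 0 \<le> c \<Longrightarrow> c *\<^sub>R v \<in> K"
    and "(\<And>i::nat. f i \<in> K) \<Longrightarrow> x \<in> V \<Longrightarrow> (\<lambda>i. N (f i - x)) \<longlonglongrightarrow> 0 \<Longrightarrow> x \<in> K"
proof -
  show "v \<in> K \<Longrightarrow> v \<in> V" by (simp add: K_def)
  show "0 \<in> K" by (simp add: K_def)
  show "v + w \<in> K" if "v \<in> K" "w \<in> K"
  proof -
    have "AE x in M. v x \<in> \<real>\<^sub>\<ge>\<^sub>0" "AE x in M. w x \<in> \<real>\<^sub>\<ge>\<^sub>0" using that by (auto simp: K_def)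
    then have "AE x in M. (v + w) x \<in> \<real>\<^sub>\<ge>\<^sub>0" by eventually_elim (simp add: nonneg_Reals_add_I)
    then show ?thesis using that by (simp add: K_def)
  qed
  show "c *\<^sub>R v \<in> K" if "v \<in> K" "0 \<le> c"
  proof -
    have "AE x in M. v x \<in> \<real>\<^sub>\<ge>\<^sub>0" using that by (auto simp: K_def)
    then have "AE x in M. (c *\<^sub>R v) x \<in> \<real>\<^sub>\<ge>\<^sub>0"
      by eventually_elim (use that in \<open>simp add: scaleR_conv_of_real nonneg_Reals_mult_I\<close>)
    then show ?thesis using that by (simp add: K_def)
  qed
  show "x \<in> K" if "\<And>i::nat. f i \<in> K" "x \<in> V" "(\<lambda>i. N (f i - x)) \<longlonglongrightarrow> 0"
  proof -
    have "AE y in M. x y \<in> \<real>\<^sub>\<ge>\<^sub>0"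
      using that p by (intro Lp_cone_closed[of p f M x] V_lp) (auto simp: K_def fun_diff_def)
    then show ?thesis using that by (simp add: K_def)
  qed
qed

section \<open>Generator and resolvent on representatives\<close>

lemma generator_value_iff:
  assumes T: "\<And>s. 0 \<le> s \<Longrightarrow> bounded_operator X (T s)" and v: "u \<in> V" "y \<in> V"
  shows "is_generator_value X T (cls u) (cls y) \<longleftrightarrow>
    ((\<lambda>t. N ((1 / t) *\<^sub>R (lift (T t) u - u) - y)) \<longlongrightarrow> 0) (at_right 0)"
proof -
  have "vnorm X (vdiff X (vscale X (of_real (1 / t)) (vdiff X (T t (cls u)) (cls u))) (cls y)) =
      N ((1 / t) *\<^sub>R (lift (T t) u - u) - y)" if "0 < t" for t
  proof -
    have "vdiff X (T t (cls u)) (cls u) = cls (lift (T t) u - u)"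
      using T[of t] v that by (simp add: cls_lift[symmetric] vdiff_cls)
    then show ?thesis using v by (simp only: vscale_cls vdiff_cls vnorm_cls V_closed lift_V)
  qed
  then have "((\<lambda>t. vnorm X (vdiff X (vscale X (of_real (1 / t)) (vdiff X (T t (cls u)) (cls u))) (cls y))) \<longlongrightarrow> 0) (at_right 0)
     \<longleftrightarrow> ((\<lambda>t. N ((1 / t) *\<^sub>R (lift (T t) u - u) - y)) \<longlongrightarrow> 0) (at_right 0)"
    by (intro tendsto_cong eventually_at_rightI[of 0 1]) auto
  then show ?thesis unfolding is_generator_value_def using v cls_carrier by blast
qed

text \<open>Limits are unique because \<open>N\<close> is definite on \<open>V\<close>; this is what
  evaluates the \<open>THE\<close> in the definition of the generator.\<close>

lemma generator_eq:
  assumes T: "\<And>s. 0 \<le> s \<Longrightarrow> bounded_operator X (T s)" and v: "u \<in> V" "y \<in> V"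
    and gen: "is_generator_value X T (cls u) (cls y)"
  shows "generator X T (cls u) = cls y"
  unfolding generator_def
proof (rule the_equality)
  fix Y assume Y: "is_generator_value X T (cls u) Y"
  then have "Y \<in> carrier X" by (simp add: is_generator_value_def)
  then obtain y' where y': "y' \<in> V" "Y = cls y'" by (rule carrier_V_cases)
  let ?q = "\<lambda>t. (1 / t) *\<^sub>R (lift (T t) u - u)"
  have "((\<lambda>t. N (?q t - y') + N (?q t - y)) \<longlongrightarrow> 0 + 0) (at_right 0)"
    using Y gen y' v generator_value_iff[OF T] by (intro tendsto_add) auto
  moreover have "N (y' - y) \<le> N (?q t - y') + N (?q t - y)" for t
    using N_diff[of "?q t - y" "?q t - y'"] v y' by (simp add: add.commute)
  ultimately have "N (y' - y) \<le> 0"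
    using tendsto_lowerbound[of "\<lambda>t. N (?q t - y') + N (?q t - y)" 0 "at_right 0" "N (y' - y)"] by simp
  then have "N (y' - y) = 0" using N_nonneg[of "y' - y"] by simp
  then have "y' - y = 0" using v y' by (intro N_eq_0) auto
  then show "Y = cls y" using y' by simp
qed fact

context
  fixes T :: "real \<Rightarrow> ('a \<Rightarrow> complex) set \<Rightarrow> ('a \<Rightarrow> complex) set"
  assumes C0: "C0_semigroup X T" and Kreiss: "Kreiss_bounded X T"
begin

abbreviation "res l \<equiv> resolvent X (generator_domain X T) (neg_generator X T) (- complex_of_real l)"

lemma T_operator: "0 \<le> s \<Longrightarrow> bounded_operator X (T s)"
  using C0 by (simp add: C0_semigroup_def)

text \<open>For \<open>A = -G\<close> with generator \<open>G\<close>, the operator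
  \<open>- l - A\<close> is \<open>G - l\<close>. Consequently \<open>res l\<close> is the negative
  of the resolvent of \<open>G\<close>.\<close>

lemma shifted_cls:
  assumes "u \<in> V" "y \<in> V" "is_generator_value X T (cls u) (cls y)"
  shows "shifted X (neg_generator X T) (- complex_of_real l) (cls u) = cls (y - l *\<^sub>R u)"
proof -
  have "generator X T (cls u) = cls y"
    by (rule generator_eq[OF _ assms]) (rule T_operator)
  then have "neg_generator X T (cls u) = cls ((- 1) *\<^sub>R y)"
    unfolding neg_generator_def using vscale_cls[OF assms(2), of "-1"] by simp
  moreover have "vscale X (- complex_of_real l) (cls u) = cls ((- l) *\<^sub>R u)"
    using vscale_cls[OF assms(1), of "- l"] by simp
  ultimately have "shifted X (neg_generator X T) (- complex_of_real l) (cls u) = cls ((- l) *\<^sub>R u - (- 1) *\<^sub>R y)"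
    unfolding shifted_def using assms by (simp only: vdiff_cls V_closed)
  then show ?thesis by simp
qed

lemma res_operator:
  assumes "0 < l"
  shows "bounded_operator X (res l)"
    and "bij_betw (shifted X (neg_generator X T) (- complex_of_real l)) (generator_domain X T) (carrier X)"
proof -
  have "- complex_of_real l \<in> {\<mu>. Re \<mu> < 0}" using assms by simp
  then have "- complex_of_real l \<in> resolvent_set X (generator_domain X T) (neg_generator X T)"
    using Kreiss unfolding Kreiss_bounded_def by blast
  then show "bounded_operator X (res l)"
    and "bij_betw (shifted X (neg_generator X T) (- complex_of_real l)) (generator_domain X T) (carrier X)"
    by (simp_all add: resolvent_set_def)
qed

lemma res_generator:
  assumes l: "0 < l" and x: "x \<in> V"
  shows "is_generator_value X T (cls (lift (res l) x)) (cls (x + l *\<^sub>R lift (res l) x))"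
proof -
  let ?u = "lift (res l) x"
  have surj: "cls x \<in> shifted X (neg_generator X T) (- complex_of_real l) ` generator_domain X T"
    using res_operator(2)[OF l] cls_carrier[OF x] by (simp add: bij_betw_def)
  have u: "cls ?u = res l (cls x)" using cls_lift[OF res_operator(1)[OF l] x] .
  then have "cls ?u \<in> generator_domain X T"
    using inv_into_into[OF surj] by (simp add: resolvent_def)
  then obtain Y where Y: "is_generator_value X T (cls ?u) Y" by (auto simp: generator_domain_def)
  then have "Y \<in> carrier X" by (simp add: is_generator_value_def)
  then obtain y where y: "y \<in> V" "Y = cls y" by (rule carrier_V_cases)
  have "shifted X (neg_generator X T) (- complex_of_real l) (res l (cls x)) = cls x"
    unfolding resolvent_def by (rule f_inv_into_f[OF surj])
  then have "cls x = shifted X (neg_generator X T) (- complex_of_real l) (cls ?u)"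
    unfolding u by simp
  also have "\<dots> = cls (y - l *\<^sub>R ?u)" using shifted_cls y Y by simp
  finally have "x = y - l *\<^sub>R ?u" using x y by (intro cls_inj) auto
  then have "x + l *\<^sub>R ?u = y" by (simp only: eq_diff_eq)
  then show ?thesis using Y y(2) by (simp only:)
qed

lemma res_inverse:
  assumes l: "0 < l" and u: "u \<in> V" "y \<in> V" and gen: "is_generator_value X T (cls u) (cls y)"
  shows "lift (res l) (y - l *\<^sub>R u) = u"
proof (rule cls_inj)
  have dom: "cls u \<in> generator_domain X T"
    using gen cls_carrier[OF u(1)] by (auto simp: generator_domain_def)
  have "inj_on (shifted X (neg_generator X T) (- complex_of_real l)) (generator_domain X T)"
    using res_operator(2)[OF l] by (simp add: bij_betw_def)
  then have "res l (shifted X (neg_generator X T) (- complex_of_real l) (cls u)) = cls u"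
    unfolding resolvent_def using dom by (rule inv_into_f_f)
  then show "cls (lift (res l) (y - l *\<^sub>R u)) = cls u"
    unfolding shifted_cls[OF u gen] using u by (subst cls_lift[OF res_operator(1)[OF l]]) auto
qed (use u in auto)

lemma lift_limit_minus:
  assumes "u \<in> V" "y \<in> V" "((\<lambda>t. N ((1 / t) *\<^sub>R (lift (T t) u - u) - y)) \<longlongrightarrow> 0) (at_right 0)"
  shows "((\<lambda>t. N ((1 / t) *\<^sub>R (lift (T t) (- u) - (- u)) - (- y))) \<longlongrightarrow> 0) (at_right 0)"
proof (rule Lim_transform_eventually[OF assms(3)])
  show "\<forall>\<^sub>F t in at_right 0. N ((1 / t) *\<^sub>R (lift (T t) u - u) - y) =
      N ((1 / t) *\<^sub>R (lift (T t) (- u) - (- u)) - (- y))"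
  proof (rule eventually_at_rightI[of 0 1])
    fix t :: real assume t: "t \<in> {0<..<1}"
    have "(1 / t) *\<^sub>R (lift (T t) (- u) - (- u)) - (- y) = (- 1) *\<^sub>R ((1 / t) *\<^sub>R (lift (T t) u - u) - y)"
      using linear_neg[OF lift_linear[OF T_operator]] t by (simp add: algebra_simps)
    then show "N ((1 / t) *\<^sub>R (lift (T t) u - u) - y) = N ((1 / t) *\<^sub>R (lift (T t) (- u) - (- u)) - (- y))"
      using N_scale[of "(1 / t) *\<^sub>R (lift (T t) u - u) - y" "- 1"] assms by simp
  qed simp
qed

text \<open>Carries the abstract bound over: the locale assumptions are checked for the lifted
  operators, local boundedness coming from completeness of the space.\<close>

lemma eventually_positive_growth:
  assumes pos: "uniformly_eventually_positive (Lp_cone M p) T" and q: "1 / p + 1 / q = 1"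
  obtains s b r where "0 \<le> s" "0 \<le> b" "0 \<le> r" "\<And>t v. 0 \<le> t \<Longrightarrow> t \<le> 1 \<Longrightarrow> v \<in> V \<Longrightarrow> N (lift (T t) v) \<le> r * N v"
    "\<And>v g n. v \<in> K \<Longrightarrow> 1 \<le> g \<Longrightarrow> 2 ^ g \<le> n \<Longrightarrow>
       N (lift (T (real n + s)) v) \<le> b * n / g powr (max (1 / p) (1 / q)) * N v"
proof -
  obtain \<tau> where tau: "0 \<le> \<tau>" "\<And>t. \<tau> \<le> t \<Longrightarrow> positive_operator (Lp_cone M p) (T t)"
    using pos by (auto simp: uniformly_eventually_positive_def)
  obtain C' where C': "\<And>\<mu>. Re \<mu> > 0 \<Longrightarrow>
      op_norm X (resolvent X (generator_domain X T) (neg_generator X T) (- \<mu>)) \<le> C' / Re \<mu>"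
    using Kreiss by (auto simp: Kreiss_bounded_def)
  \<comment> \<open>The locale asks for a strictly positive constant, which \<open>C'\<close> alone
    does not guarantee.\<close>
  define C where "C = max C' 1"
  have q1: "1 < q"
  proof -
    have "1 / q = 1 - 1 / p" "0 < 1 / p" "1 / p < 1" using p q by auto
    then have "0 < 1 / q" "1 / q < 1" by linarith+
    then show ?thesis by (simp add: divide_less_eq split: if_splits)
  qed
  define T' where "T' t = lift (T t)" for t
  \<comment> \<open>The sign passes from the inverse of \<open>G - l\<close> to that of
    \<open>l - G\<close>, which is the operator that preserves positivity.\<close>
  define R where "R l v = - lift (res l) v" for l v
  have T'_linear: "linear (T' s)" if "0 \<le> s" for s
    unfolding T'_def using T_operator[OF that] by (rule lift_linear)
  have T'_0: "T' 0 v = v" if "v \<in> V" for v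
  proof (rule cls_inj)
    show "cls (T' 0 v) = cls v"
      using C0 cls_carrier[OF that] that by (simp add: T'_def cls_lift[OF T_operator] C0_semigroup_def)
  qed (use that in \<open>auto simp: T'_def\<close>)
  have T'_add: "T' (s + t) v = T' s (T' t v)" if st: "0 \<le> s" "0 \<le> t" and v: "v \<in> V" for s t v
  proof (rule cls_inj)
    have "cls (T' (s + t) v) = T s (T t (cls v))"
      using C0 cls_carrier[OF v] v st by (simp add: T'_def cls_lift[OF T_operator] C0_semigroup_def)
    also have "\<dots> = cls (T' s (T' t v))"
      using v st by (simp add: T'_def cls_lift[OF T_operator])
    finally show "cls (T' (s + t) v) = cls (T' s (T' t v))" .
  qed (auto simp: T'_def)
  have T'_cont: "((\<lambda>t. N (T' t v - v)) \<longlongrightarrow> 0) (at_right 0)" if v: "v \<in> V" for v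
  proof (rule Lim_transform_eventually)
    show "((\<lambda>t. vnorm X (vdiff X (T t (cls v)) (cls v))) \<longlongrightarrow> 0) (at_right 0)"
      using C0 cls_carrier[OF v] by (simp add: C0_semigroup_def)
    show "\<forall>\<^sub>F t in at_right 0. vnorm X (vdiff X (T t (cls v)) (cls v)) = N (T' t v - v)"
      using v by (intro eventually_at_rightI[of 0 1])
        (simp_all add: T'_def cls_lift[OF T_operator, symmetric] vdiff_cls vnorm_cls)
  qed
  obtain r where r: "1 \<le> r" "\<And>s x. 0 \<le> s \<Longrightarrow> s \<le> 1 \<Longrightarrow> x \<in> V \<Longrightarrow> N (T' s x) \<le> r * N x"
  proof (rule semigroup_locally_bounded[OF complete T'_linear _ T'_0 T'_add _ T'_cont])
    show "T' s x \<in> V" for s x by (simp add: T'_def)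
    show "\<exists>C. \<forall>x\<in>V. N (T' s x) \<le> C * N x" if "0 \<le> s" for s
      unfolding T'_def by (rule lift_bounded[OF T_operator[OF that]])
  qed auto
  have R_linear: "linear (R l)" if "0 < l" for l
    unfolding R_def using lift_linear[OF res_operator(1)[OF that]] by (rule linear_compose_neg)
  interpret lattice_semigroup V N T' R r C K \<tau> p q
  proof (intro lattice_semigroup.intro resolvent_semigroup.intro resolvent_semigroup_axioms.intro
      lattice_semigroup_axioms.intro normed_subspace_axioms)
    show "linear (T' s)" if "0 \<le> s" for s using that by (rule T'_linear)
    show "T' s x \<in> V" for s x by (simp add: T'_def)
    show "T' 0 x = x" if "x \<in> V" for x using that by (rule T'_0)
    show "T' (s + t) x = T' s (T' t x)" if "0 \<le> s" "0 \<le> t" "x \<in> V" for s t x using that by (rule T'_add)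
    show "1 \<le> r" by (rule r(1))
    show "N (T' s x) \<le> r * N x" if "0 \<le> s" "s \<le> 1" "x \<in> V" for s x using that by (rule r(2))
    show "((\<lambda>t. N (T' t x - x)) \<longlongrightarrow> 0) (at_right 0)" if "x \<in> V" for x using that by (rule T'_cont)
    show "0 < C" by (simp add: C_def)
    show "linear (R l)" if "0 < l" for l using that by (rule R_linear)
    show "R l x \<in> V" for l x using V_closed(4)[of "lift (res l) x" "- 1"] by (simp add: R_def)
    show "N (R l x) \<le> C / l * N x" if l: "0 < l" and x: "x \<in> V" for l x
    proof -
      have "N (R l x) = N (lift (res l) x)"
        using N_scale[of "lift (res l) x" "- 1"] by (simp add: R_def)
      also have "\<dots> \<le> op_norm X (res l) * N x" by (rule lift_op_norm[OF res_operator(1)[OF l] x])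
      also have "op_norm X (res l) \<le> C' / l" using C'[of "complex_of_real l"] l by simp
      also have "C' / l \<le> C / l" using l by (simp add: C_def divide_right_mono)
      finally show ?thesis by (simp add: N_nonneg mult_right_mono)
    qed
    show "((\<lambda>t. N ((1 / t) *\<^sub>R (T' t (R l x) - R l x) - (l *\<^sub>R R l x - x))) \<longlongrightarrow> 0) (at_right 0)"
      if l: "0 < l" and x: "x \<in> V" for l x
    proof -
      have "((\<lambda>t. N ((1 / t) *\<^sub>R (lift (T t) (lift (res l) x) - lift (res l) x) - (x + l *\<^sub>R lift (res l) x))) \<longlongrightarrow> 0) (at_right 0)"
        using res_generator[OF l x] x by (subst (asm) generator_value_iff[OF T_operator]) auto
      from lift_limit_minus[OF _ _ this] show ?thesis
        using x by (simp add: R_def T'_def algebra_simps)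
    qed
    show "R l (l *\<^sub>R u - y) = u"
      if l: "0 < l" and u: "u \<in> V" "y \<in> V"
        and lim: "((\<lambda>t. N ((1 / t) *\<^sub>R (T' t u - u) - y)) \<longlongrightarrow> 0) (at_right 0)" for l u y
    proof -
      have "is_generator_value X T (cls u) (cls y)"
        using lim u by (simp add: generator_value_iff[OF T_operator] T'_def)
      from res_inverse[OF l u this] have "lift (res l) (y - l *\<^sub>R u) = u" .
      moreover have "R l (l *\<^sub>R u - y) = lift (res l) (- (l *\<^sub>R u - y))"
        unfolding R_def by (rule linear_neg[OF lift_linear[OF res_operator(1)[OF l]], symmetric])
      ultimately show ?thesis by simp
    qed
    show "x \<in> V" if "x \<in> K" for x using that by (rule K_props(1))
    show "0 \<in> K" by (rule K_props(2))
    show "x + y \<in> K" if "x \<in> K" "y \<in> K" for x y using that by (rule K_props(3))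
    show "c *\<^sub>R x \<in> K" if "x \<in> K" "0 \<le> c" for c x using that by (rule K_props(4))
    show "x \<in> K" if "\<And>i. f i \<in> K" "x \<in> V" "(\<lambda>i::nat. N (f i - x)) \<longlonglongrightarrow> 0" for f x
      using that by (rule K_props(5))
    show "0 \<le> \<tau>" by (rule tau(1))
    show "T' s x \<in> K" if s: "\<tau> \<le> s" and x: "x \<in> K" for s x
    proof -
      have "0 \<le> s" using s tau by simp
      have "T s (cls x) \<in> Lp_cone M p"
        using tau(2)[OF s] x cls_cone_iff[OF K_props(1)[OF x]] by (simp add: positive_operator_def)
      then show ?thesis
        unfolding T'_def cls_lift[OF T_operator[OF \<open>0 \<le> s\<close>] K_props(1)[OF x], symmetric]
        by (simp only: cls_cone_iff[OF lift_V])
    qed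
    show "1 < p" by (rule p)
    show "1 / p + 1 / q = 1" by (rule q)
    show "\<exists>F\<in>K. N F powr p \<le> (\<Sum>i\<in>I. N (z i) powr p) \<and>
       (\<forall>c. (\<forall>i\<in>I. 0 \<le> c i) \<and> (\<Sum>i\<in>I. c i powr q) \<le> 1 \<longrightarrow> F - (\<Sum>i\<in>I. c i *\<^sub>R z i) \<in> K)"
      if "finite I" "\<And>i. i \<in> I \<Longrightarrow> z i \<in> K" for I :: "int set" and z
      using that by (intro K_upper q q1)
    show "(\<Sum>j\<in>J. N (g j) powr p) \<le> N G powr p"
      if "finite J" "\<And>j::int. j \<in> J \<Longrightarrow> g j \<in> K" "G \<in> K"
        "\<And>c. (\<And>j. j \<in> J \<Longrightarrow> 0 \<le> c j) \<Longrightarrow> (\<Sum>j\<in>J. c j powr q) \<le> 1 \<Longrightarrow> G - (\<Sum>j\<in>J. c j *\<^sub>R g j) \<in> K" for J g G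
      using that by (rule K_lower[OF q])
  qed
  show ?thesis
  proof (rule that[of "2 + 4 * \<tau>" "4 * c2\<^sup>2" r])
    show "N (lift (T t) v) \<le> r * N v" if "0 \<le> t" "t \<le> 1" "v \<in> V" for t v
      using r(2)[OF that] by (simp add: T'_def)
    show "N (lift (T (real n + (2 + 4 * \<tau>))) v) \<le> 4 * c2\<^sup>2 * n / g powr (max (1 / p) (1 / q)) * N v"
      if "v \<in> K" "1 \<le> g" "2 ^ g \<le> n" for v g n
      using growth[OF that] by (simp add: T'_def add.assoc)
  qed (use tau r in auto)
qed

text \<open>A complex function is a combination of four positive functions that it dominates.\<close>
lemma vnorm_le_of_positive:
  assumes S: "bounded_operator X S" and b: "0 \<le> b" "\<And>w. w \<in> K \<Longrightarrow> N (lift S w) \<le> b * N w" and v: "v \<in> V"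
  shows "vnorm X (S (cls v)) \<le> 4 * b * N v"
proof -
  have vlp: "v \<in> lp_fun M p" using v by (rule V_lp)
  have [measurable]: "v \<in> borel_measurable M" using vlp by (rule lp_fun_measurable)
  have part: "(\<lambda>x. complex_of_real (f (v x))) \<in> lp_fun M p"
      "vnorm X (S (cls (\<lambda>x. complex_of_real (f (v x))))) \<le> b * N v"
    if f: "f \<in> borel_measurable borel" "\<And>z. 0 \<le> f z" "\<And>z. f z \<le> norm z" for f :: "complex \<Rightarrow> real"
  proof -
    let ?f = "\<lambda>x. complex_of_real (f (v x))"
    have m: "?f \<in> borel_measurable M" using f(1) by measurable
    have le: "AE x in M. norm (norm (?f x) powr p) \<le> norm (norm (v x) powr p)"
      using p f by (intro AE_I2) (simp add: powr_mono2)
    have "integrable M (\<lambda>x. norm (?f x) powr p)"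
      by (rule Bochner_Integration.integrable_bound[OF lp_fun_integrable[OF vlp] _ le]) (use m in measurable)
    then show lp: "?f \<in> lp_fun M p" unfolding lp_fun_def using m by blast
    have "AE x in M. \<pi> ?f x \<in> \<real>\<^sub>\<ge>\<^sub>0" using pi_AE[OF lp] by eventually_elim (simp add: f(2))
    then have "\<pi> ?f \<in> K" by (simp add: K_def pi_in_V)
    from b(2)[OF this] have "vnorm X (S (cls ?f)) \<le> b * N ?f"
      by (simp add: N_lift[OF S pi_in_V] cls_pi[OF lp] N_pi[OF lp])
    also have "N ?f \<le> N v"
      using p f by (intro Lp_norm_mono_AE lp vlp AE_I2) auto
    finally show "vnorm X (S (cls ?f)) \<le> b * N v" using b(1) by (simp add: mult_left_mono)
  qed
  have tri: "vnorm X (vadd X F G) \<le> vnorm X F + vnorm X G" if FG: "F \<in> carrier X" "G \<in> carrier X" for F G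
  proof -
    obtain f g where "f \<in> V" "F = cls f" "g \<in> V" "G = cls g" using carrier_V_cases FG by metis
    then show ?thesis using N_add[of f g] by (simp add: vadd_cls vnorm_cls)
  qed
  have scale: "vnorm X (vscale X c F) = norm c * vnorm X F" "vscale X c F \<in> carrier X" if F: "F \<in> carrier X" for c F
  proof -
    obtain f where "f \<in> V" "F = cls f" using carrier_V_cases F by metis
    then show "vnorm X (vscale X c F) = norm c * vnorm X F" "vscale X c F \<in> carrier X"
      using Lp_norm_scale[of p M c f] p
      by (simp_all add: vscale_Lp V_lp vnorm_cls_lp lp_fun_scale lp_class_in_carrier)
  qed
  have add: "vadd X F G \<in> carrier X" if FG: "F \<in> carrier X" "G \<in> carrier X" for F G
  proof -
    obtain f g where "f \<in> V" "F = cls f" "g \<in> V" "G = cls g" using carrier_V_cases FG by metis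
    then show ?thesis by (simp add: vadd_cls cls_carrier V_closed)
  qed
  define f1 f2 f3 f4 :: "complex \<Rightarrow> real" where "f1 z = max 0 (Re z)" and "f2 z = max 0 (- Re z)"
    and "f3 z = max 0 (Im z)" and "f4 z = max 0 (- Im z)" for z
  have f: "f1 \<in> borel_measurable borel" "f2 \<in> borel_measurable borel" "f3 \<in> borel_measurable borel" "f4 \<in> borel_measurable borel"
    unfolding f1_def f2_def f3_def f4_def by measurable
  have nn: "0 \<le> f1 z" "0 \<le> f2 z" "0 \<le> f3 z" "0 \<le> f4 z" for z by (simp_all add: f1_def f2_def f3_def f4_def)
  have le: "f1 z \<le> norm z" "f2 z \<le> norm z" "f3 z \<le> norm z" "f4 z \<le> norm z" for z
    using abs_Re_le_cmod[of z] abs_Im_le_cmod[of z] by (auto simp: f1_def f2_def f3_def f4_def)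
  define F where "F f = cls (\<lambda>x. complex_of_real (f (v x)))" for f
  note parts = part[OF f(1) nn(1) le(1)] part[OF f(2) nn(2) le(2)] part[OF f(3) nn(3) le(3)] part[OF f(4) nn(4) le(4)]
  have c: "F f1 \<in> carrier X" "F f2 \<in> carrier X" "F f3 \<in> carrier X" "F f4 \<in> carrier X"
    unfolding F_def using parts by (simp_all only: lp_class_in_carrier)
  have "v x = (of_real (f1 (v x)) + (- 1) * of_real (f2 (v x))) + \<i> * (of_real (f3 (v x)) + (- 1) * of_real (f4 (v x)))" for x
    by (auto simp: f1_def f2_def f3_def f4_def complex_eq_iff max_def)
  then have "v = (\<lambda>x. (of_real (f1 (v x)) + (- 1) * of_real (f2 (v x))) + \<i> * (of_real (f3 (v x)) + (- 1) * of_real (f4 (v x))))"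
    by (rule ext)
  then have "cls v = cls (\<lambda>x. (of_real (f1 (v x)) + (- 1) * of_real (f2 (v x))) + \<i> * (of_real (f3 (v x)) + (- 1) * of_real (f4 (v x))))"
    by (rule arg_cong)
  also have "\<dots> = vadd X (vadd X (F f1) (vscale X (- 1) (F f2))) (vscale X \<i> (vadd X (F f3) (vscale X (- 1) (F f4))))"
    unfolding F_def using parts p by (simp only: vadd_Lp vscale_Lp lp_fun_add lp_fun_scale less_imp_le order_trans[OF zero_le_one])
  finally have "S (cls v) = vadd X (vadd X (S (F f1)) (vscale X (- 1) (S (F f2)))) (vscale X \<i> (vadd X (S (F f3)) (vscale X (- 1) (S (F f4)))))"
    using c by (simp only: bounded_operatorD[OF S] add scale)
  also have "vnorm X \<dots> \<le> (vnorm X (S (F f1)) + vnorm X (S (F f2))) + (vnorm X (S (F f3)) + vnorm X (S (F f4)))"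
  proof -
    have 1: "vnorm X (vadd X G (vscale X (- 1) H)) \<le> vnorm X G + vnorm X H" if "G \<in> carrier X" "H \<in> carrier X" for G H
      using tri[OF that(1) scale(2)[OF that(2)], of "- 1"] scale(1)[OF that(2), of "- 1"] by simp
    have S': "S (F f1) \<in> carrier X" "S (F f2) \<in> carrier X" "S (F f3) \<in> carrier X" "S (F f4) \<in> carrier X"
      using c bounded_operatorD(1)[OF S] by auto
    let ?A = "vadd X (S (F f1)) (vscale X (- 1) (S (F f2)))" and ?B = "vadd X (S (F f3)) (vscale X (- 1) (S (F f4)))"
    have AB: "?A \<in> carrier X" "?B \<in> carrier X" using S' by (auto intro!: add scale(2))
    have "vnorm X (vadd X ?A (vscale X \<i> ?B)) \<le> vnorm X ?A + vnorm X ?B"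
      using tri[OF AB(1) scale(2)[OF AB(2)], of \<i>] scale(1)[OF AB(2), of \<i>] by simp
    then show ?thesis using 1[OF S'(1,2)] 1[OF S'(3,4)] by linarith
  qed
  also have "\<dots> \<le> (b * N v + b * N v) + (b * N v + b * N v)"
    unfolding F_def by (intro add_mono parts)
  finally show ?thesis by simp
qed

text \<open>The time \<open>t\<close> is written as \<open>n + s\<close> plus a remainder in the
  unit interval, where \<open>r\<close> bounds the operators; \<open>g\<close> is the number of full
  dyadic blocks below \<open>n\<close>. The bound is first proved on positive vectors.\<close>

lemma op_norm_bigo:
  assumes pos: "uniformly_eventually_positive (Lp_cone M p) T" and q: "1 / p + 1 / q = 1"
  shows "(\<lambda>t. op_norm X (T t)) \<in> O[at_top](\<lambda>t. t / ln t powr max (1 / p) (1 / q))"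
proof -
  let ?a = "max (1 / p) (1 / q)"
  obtain s b r where sbr: "0 \<le> s" "0 \<le> b" "0 \<le> r"
    and r: "\<And>t v. 0 \<le> t \<Longrightarrow> t \<le> 1 \<Longrightarrow> v \<in> V \<Longrightarrow> N (lift (T t) v) \<le> r * N v"
    and growth: "\<And>v g n. v \<in> K \<Longrightarrow> 1 \<le> g \<Longrightarrow> 2 ^ g \<le> n \<Longrightarrow>
       N (lift (T (real n + s)) v) \<le> b * n / g powr ?a * N v"
    using eventually_positive_growth[OF pos q] by blast
  have a: "0 < ?a" using p by (simp add: less_max_iff_disj)
  \<comment> \<open>The 4 counts the positive parts of a complex function, \<open>r\<close> pays for
    the remainder of the time, and \<open>2 powr ?a\<close> comes from
    \<open>ln t / 2 \<le> g\<close>.\<close>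
  let ?c = "4 * (r * b * 2 powr ?a)"
  \<comment> \<open>The first threshold gives \<open>t / 2 \<le> n\<close>. The second gives
    \<open>4 \<le> ln t\<close>, so that \<open>g\<close>, which is at least \<open>ln t - 2\<close>
    after halving \<open>t\<close> and rounding, is still at least \<open>ln t / 2\<close>.\<close>
  have bound: "op_norm X (T t) \<le> ?c * (t / ln t powr ?a)" if t: "2 * s + 4 \<le> t" "exp 4 \<le> t" for t
  proof -
    have t0: "0 < t" using t sbr by simp
    moreover have "4 \<le> ln t" using t(2) t0 by (simp add: ln_ge_iff)
    ultimately have t0: "0 < t" "4 \<le> ln t" .
    define n where "n = nat \<lfloor>t - s\<rfloor>"
    have n: "real n \<le> t - s" "t - s < real n + 1" using t sbr by (auto simp: n_def)
    have n2: "t / 2 \<le> real n" using n(2) t by linarith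
    then have npos: "0 < real n" using t0 by linarith
    define g where "g = nat \<lfloor>log 2 (real n)\<rfloor>"
    have lg: "ln t - 1 \<le> log 2 (real n)"
    proof -
      have "ln t * ln 2 \<le> ln t * 1" using t0 ln_2_less_1 by (intro mult_left_mono; linarith)
      then have "ln t \<le> ln t / ln 2" by (simp add: field_simps)
      then have "ln t - 1 \<le> log 2 t - 1" by (simp add: log_def)
      also have "\<dots> = log 2 (t / 2)" using t0 by (simp add: log_divide)
      also have "\<dots> \<le> log 2 (real n)" using n2 t0 by simp
      finally show ?thesis .
    qed
    then have "0 \<le> log 2 (real n)" using t0 by linarith
    then have "real g = of_int \<lfloor>log 2 (real n)\<rfloor>" by (simp add: g_def)
    then have g: "real g \<le> log 2 (real n)" "log 2 (real n) - 1 < real g" by linarith+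
    have g2: "ln t / 2 \<le> real g" using g lg t0 by linarith
    have g1: "1 \<le> g" using g2 t0 by linarith
    have "2 powr real g \<le> real n" using g(1) npos by (simp add: le_log_iff)
    then have "real (2 ^ g) \<le> real n" by (simp add: powr_realpow)
    then have gn: "2 ^ g \<le> n" by (simp only: of_nat_le_iff)
    have "b * n / real g powr ?a \<le> b * t / (ln t / 2) powr ?a"
      using n sbr g2 t0 t(1) a by (intro frac_le mult_left_mono powr_mono2) auto
    also have "\<dots> = b * 2 powr ?a * (t / ln t powr ?a)" using t0 by (simp add: powr_divide)
    finally have e: "b * n / real g powr ?a \<le> b * 2 powr ?a * (t / ln t powr ?a)" .
    let ?d = "r * (b * 2 powr ?a * (t / ln t powr ?a))"
    have d: "0 \<le> ?d" using sbr t0 by simp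
    have tn: "0 \<le> t - (real n + s)" "t - (real n + s) \<le> 1" "0 \<le> t" using n t0 by auto
    have "N (lift (T t) w) \<le> ?d * N w" if w: "w \<in> K" for w
    proof -
      have wV: "w \<in> V" using w by (rule K_props(1))
      have "T t (cls w) = T (t - (real n + s)) (T (real n + s) (cls w))"
      proof -
        have "T ((t - (real n + s)) + (real n + s)) (cls w) = T (t - (real n + s)) (T (real n + s) (cls w))"
          using C0 cls_carrier[OF wV] tn sbr unfolding C0_semigroup_def by (meson add_nonneg_nonneg of_nat_0_le_iff)
        then show ?thesis by simp
      qed
      also have "\<dots> = cls (lift (T (t - (real n + s))) (lift (T (real n + s)) w))"
        using tn sbr wV by (simp add: cls_lift[OF T_operator])
      finally have "N (lift (T t) w) = N (lift (T (t - (real n + s))) (lift (T (real n + s)) w))"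
        using N_lift[OF T_operator[OF tn(3)] wV] by (simp add: vnorm_cls)
      also have "\<dots> \<le> r * N (lift (T (real n + s)) w)" using tn by (intro r) auto
      also have "\<dots> \<le> r * ((b * 2 powr ?a * (t / ln t powr ?a)) * N w)"
        using sbr by (intro mult_left_mono order_trans[OF growth[OF w g1 gn]] mult_right_mono e N_nonneg)
      finally show ?thesis by (simp add: mult.assoc)
    qed
    then have "vnorm X (T t (cls v)) \<le> 4 * ?d * N v" if "v \<in> V" for v
      using T_operator[OF tn(3)] d that by (intro vnorm_le_of_positive)
    then have "op_norm X (T t) \<le> 4 * ?d" using T_operator[OF tn(3)] d by (intro op_norm_le) auto
    then show ?thesis by (simp add: mult.assoc)
  qed
  have op0: "0 \<le> op_norm X (T t)" if "0 \<le> t" for t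
  proof -
    have "vnorm X (T t (cls 0)) \<le> op_norm X (T t)"
      using V_closed(1) by (intro op_norm_upper T_operator that) (simp_all add: cls_carrier vnorm_cls)
    then show ?thesis using N_lift[OF T_operator[OF that] V_closed(1)] N_nonneg[of "lift (T t) 0"] by linarith
  qed
  show ?thesis
  proof (rule bigoI[of _ ?c])
    show "\<forall>\<^sub>F t in at_top. norm (op_norm X (T t)) \<le> ?c * norm (t / ln t powr ?a)"
      using eventually_ge_at_top[of "2 * s + 4"] eventually_ge_at_top[of "exp 4"]
    proof eventually_elim
      case (elim t)
      have "0 \<le> t" using elim sbr by simp
      then show ?case using bound[OF elim] op0[of t] by simp
    qed
  qed
qed

end

end

theorem theorem3p1:
  fixes M :: "'a measure" and p q :: real
    and T :: "real \<Rightarrow> ('a \<Rightarrow> complex) set \<Rightarrow> ('a \<Rightarrow> complex) set"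
  assumes "sigma_finite_measure M"
    and "1 < p" and "1 / p + 1 / q = 1"
    and "C0_semigroup (Lp M p) T"
    and "Kreiss_bounded (Lp M p) T"
    and "uniformly_eventually_positive (Lp_cone M p) T"
  shows "(\<lambda>t. op_norm (Lp M p) (T t)) \<in> O[at_top](\<lambda>t. t / ln t powr max (1 / p) (1 / q))"
proof -
  have "0 \<le> p" using assms(2) by simp
  then obtain \<pi> :: "('a \<Rightarrow> complex) \<Rightarrow> 'a \<Rightarrow> complex" where \<pi>: "linear \<pi>" "\<And>f. \<pi> f \<in> lp_fun M p" "\<And>f. \<pi> (\<pi> f) = \<pi> f"
    "\<And>f. f \<in> lp_fun M p \<Longrightarrow> AE x in M. \<pi> f x = f x"
    "\<And>f g. f \<in> lp_fun M p \<Longrightarrow> g \<in> lp_fun M p \<Longrightarrow> AE x in M. f x = g x \<Longrightarrow> \<pi> f = \<pi> g"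
    using linear_representatives by blast
  interpret lp_representation M p \<pi>
    by (rule lp_representation.intro[OF assms(2) \<pi>])
  show ?thesis using op_norm_bigo assms by blast
qed

end
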